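(* Let $n\ge1$, $\varepsilon\in\{0,1\}$ and $2^*=2+8/n$. For any $p\ge2^*$ and $s>n/2$ there is a constant $C>0$ such that for all $u_0\in H^s(\mathbb{R}^n)$, $$\Big(\sum_{\alpha\in\mathbb{Z}^n}\|S_\varepsilon(t)u_0\|^p_{L^\infty_{t,x}(\mathbb{R}\times Q_\alpha)}\Big)^{1/p}\le C\|u_0\|_{H^s}.$$
   Context: $S_\varepsilon(t)=e^{it(\Delta^2-\varepsilon\Delta)}=\mathscr F^{-1}e^{it(|\xi|^4+\varepsilon|\xi|^2)}\mathscr F$, with $\mathscr F$ the spatial Fourier transform on $\mathbb{R}^n$. $Q_\alpha=\alpha+[-1/2,1/2)^n$ for $\alpha\in\mathbb{Z}^n$. $H^s=(I-\Delta)^{-s/2}L^2(\mathbb{R}^n)$. *)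

theory Defs
  imports "HOL-Analysis.Analysis" "HOL-Probability.Essential_Supremum"
begin

text \<open>Real powers of extended nonnegative reals, meant for exponents \<open>r > 0\<close> only.\<close>

definition enn_powr :: "ennreal \<Rightarrow> real \<Rightarrow> ennreal" where
  "enn_powr x r = (if x = \<infinity> then \<infinity> else ennreal (enn2real x powr r))"

text \<open>Elements of \<open>L\<^sup>2(\<real>\<^sup>n)\<close> are represented by Borel functions; every a.e.-class has a
  Borel representative.\<close>

definition L2norm :: "(real ^ 'n \<Rightarrow> complex) \<Rightarrow> ennreal" where
  "L2norm f = enn_powr (\<integral>\<^sup>+ x. ennreal ((norm (f x))\<^sup>2) \<partial>lborel) (1/2)"

definition L2_functions :: "(real ^ 'n \<Rightarrow> complex) set" where
  "L2_functions = {f \<in> borel_measurable lborel. L2norm f < \<infinity>}"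

text \<open>The Fourier transform on \<open>L\<^sup>2\<close> (Plancherel), in the unitary normalisation, as the limit in
  mean of the transforms of the truncations of \<open>f\<close> to balls. The sign \<open>\<sigma> = -1\<close> gives the Fourier
  transform, \<open>\<sigma> = 1\<close> its inverse. The limit \<open>g\<close> is unique up to null sets, so \<open>plancherel\<close>
  picks a representative of its class.\<close>

definition fourier_integral :: "real \<Rightarrow> (real ^ 'n \<Rightarrow> complex) \<Rightarrow> real ^ 'n \<Rightarrow> complex" where
  "fourier_integral \<sigma> f \<xi> =
     complex_of_real ((2 * pi) powr (- real CARD('n) / 2)) *
     (LINT x|lborel. cis (\<sigma> * (x \<bullet> \<xi>)) * f x)"

definition is_plancherel :: "real \<Rightarrow> (real ^ 'n \<Rightarrow> complex) \<Rightarrow> (real ^ 'n \<Rightarrow> complex) \<Rightarrow> bool" where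
  "is_plancherel \<sigma> f g \<longleftrightarrow> g \<in> L2_functions \<and>
     (\<lambda>k::nat. L2norm (\<lambda>\<xi>. fourier_integral \<sigma> (\<lambda>x. indicator (cball 0 (real k)) x * f x) \<xi> - g \<xi>))
       \<longlonglongrightarrow> 0"

definition plancherel :: "real \<Rightarrow> (real ^ 'n \<Rightarrow> complex) \<Rightarrow> real ^ 'n \<Rightarrow> complex" where
  "plancherel \<sigma> f = (SOME g. is_plancherel \<sigma> f g)"

abbreviation fourier :: "(real ^ 'n \<Rightarrow> complex) \<Rightarrow> real ^ 'n \<Rightarrow> complex" where
  "fourier \<equiv> plancherel (- 1)"

abbreviation inv_fourier :: "(real ^ 'n \<Rightarrow> complex) \<Rightarrow> real ^ 'n \<Rightarrow> complex" where
  "inv_fourier \<equiv> plancherel 1"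

definition fourier_multiplier ::
  "(real ^ 'n \<Rightarrow> complex) \<Rightarrow> (real ^ 'n \<Rightarrow> complex) \<Rightarrow> real ^ 'n \<Rightarrow> complex" where
  "fourier_multiplier m f = inv_fourier (\<lambda>\<xi>. m \<xi> * fourier f \<xi>)"

text \<open>\<open>(I - \<Delta>)\<^bsup>r/2\<^esup>\<close>\<close>

definition bessel :: "real \<Rightarrow> (real ^ 'n \<Rightarrow> complex) \<Rightarrow> real ^ 'n \<Rightarrow> complex" where
  "bessel r = fourier_multiplier (\<lambda>\<xi>. complex_of_real ((1 + (norm \<xi>)\<^sup>2) powr (r / 2)))"

text \<open>\<open>H\<^sup>s = (I - \<Delta>)\<^bsup>-s/2\<^esup> L\<^sup>2\<close>, for \<open>s \<ge> 0\<close> only (for \<open>s < 0\<close> it is not a space of functions).\<close>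

definition Sobolev :: "real \<Rightarrow> (real ^ 'n \<Rightarrow> complex) set" where
  "Sobolev s = {u \<in> borel_measurable lborel.
     \<exists>f \<in> L2_functions. AE x in lborel. u x = bessel (- s) f x}"

definition Sobolev_norm :: "real \<Rightarrow> (real ^ 'n \<Rightarrow> complex) \<Rightarrow> ennreal" where
  "Sobolev_norm s u = L2norm (bessel s u)"

definition propagator ::
  "real \<Rightarrow> real \<Rightarrow> (real ^ 'n \<Rightarrow> complex) \<Rightarrow> real ^ 'n \<Rightarrow> complex" where
  "propagator \<epsilon> t = fourier_multiplier (\<lambda>\<xi>. cis (t * ((norm \<xi>) ^ 4 + \<epsilon> * (norm \<xi>)\<^sup>2)))"

definition cube :: "int ^ 'n \<Rightarrow> (real ^ 'n) set" where
  "cube \<alpha> = {x. \<forall>i. real_of_int (\<alpha> $ i) - 1/2 \<le> x $ i \<and> x $ i < real_of_int (\<alpha> $ i) + 1/2}"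

text \<open>For each \<open>t\<close>, \<open>propagator \<epsilon> t u\<close> is determined only up to a null set of \<open>\<real>\<^sup>n\<close>, so the essential
  supremum over space-time has to be taken of a jointly measurable version of \<open>t \<mapsto> U t\<close>.
  Two such versions agree a.e. on \<open>\<real> \<times> \<real>\<^sup>n\<close> by Fubini, so the infimum below is over at most one
  value; it is \<open>\<infinity>\<close> if there is no such version.\<close>

definition spacetime_version ::
  "(real \<Rightarrow> real ^ 'n \<Rightarrow> complex) \<Rightarrow> (real \<times> (real ^ 'n) \<Rightarrow> complex) \<Rightarrow> bool" where
  "spacetime_version U v \<longleftrightarrow> v \<in> borel_measurable lborel \<and>
     (AE t in lborel. AE x in lborel. v (t, x) = U t x)"

definition Linf_spacetime_norm ::
  "(real \<Rightarrow> real ^ 'n \<Rightarrow> complex) \<Rightarrow> (real ^ 'n) set \<Rightarrow> ennreal" where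
  "Linf_spacetime_norm U A =
     (INF v \<in> {v. spacetime_version U v}.
        esssup (restrict_space lborel (UNIV \<times> A)) (\<lambda>z. ennreal (norm (v z))))"

end

theory Submission
  imports Defs "HOL-Complex_Analysis.Complex_Analysis" "HOL-Probability.Probability" "HOL-Real_Asymp.Real_Asymp"
begin

text \<open>It suffices to bound the \<open>\<ell>\<^sup>p\<close> norm of the values of the solution at one near-maximal space-time point
  per cube. The solution is split into dyadic frequency pieces, each rescaled to frequencies of size one with
  phase \<open>a \<bar>\<xi>\<bar>\<^sup>4 + b \<bar>\<xi>\<bar>\<^sup>2\<close>, where \<open>a\<close> and \<open>b\<close> lie in the unit interval and one of them is 1. For one piece the
  number \<open>N\<close> of sample points where it exceeds \<open>\<mu>\<close> is estimated by \<open>TT\<^sup>*\<close>: in the resulting double sum of kernel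
  values, pairs with time difference at most \<open>R\<close> contribute \<open>O(R N)\<close> by the spatial decay of the kernel, the
  other pairs \<open>O(R\<^bsup>-n/3\<^esup> N\<^sup>2)\<close> by dispersion. Optimising \<open>R\<close> gives a weak-type bound with exponent
  \<open>q = 2 + 6/n < 2 + 8/n\<close>. The loss against the sharp decay \<open>\<bar>\<tau>\<bar>\<^bsup>-n/2\<^esup>\<close> is thus harmless, and since \<open>q < p\<close> the
  weak type suffices. The constants of the pieces decay geometrically, at high frequencies because \<open>s > n/2\<close>,
  at low frequencies because \<open>q > 2\<close>.\<close>

section \<open>Contour shifts\<close>

text \<open>A compactly supported frequency cut-off has no holomorphic extension, so no contour
  could be moved. The analytic \<open>weight\<close> replaces it: it dominates a multiple of the
  indicator of the annulus, which suffices for \<open>TT*\<close>. The exponent n/3 comes from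
  squaring: the squared kernel is at most the integral over h of the autocorrelation of its
  integrand, where the linear phase \<open>y \<bullet> \<xi>\<close> is gone. A contour at height c
  tolerates only c^3 tau |h| <= 1, and a zero of order 2n of the weight yields c^(2n) = (tau
  |h|)^(-2n/3), integrable at h = 0 because 2/3 < 1; the square root leaves tau^(-n/3). If D
  measures how densely the samples crowd in space, mu^2 N^2 is bounded by R D N + R^(-n/3) N^2, and
  R = mu^(-6/n) produces q = 2 + 6/n. Rescaling frequency r to 1 turns the unit cubes into cubes of
  side r, so D grows like r^(-n) for small r. Its cost r^(-n/q) competes with the gain r^(n/2) of
  the L2 scaling: this is where q > 2 enters. As the transform is only a limit in mean, Plancherel
  and inversion come before the propagator can be written as an integral.\<close>

lemma nn_integral_lborel_translate:
  fixes f :: "'a::euclidean_space \<Rightarrow> ennreal"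
  assumes [measurable]: "f \<in> borel_measurable borel"
  shows "(\<integral>\<^sup>+x. f (a + x) \<partial>lborel) = (\<integral>\<^sup>+x. f x \<partial>lborel)"
proof -
  have "(\<integral>\<^sup>+x. f x \<partial>lborel) = (\<integral>\<^sup>+x. f x \<partial>distr lborel borel ((+) a))"
    by (simp add: lborel_distr_plus)
  also have "\<dots> = (\<integral>\<^sup>+x. f (a + x) \<partial>lborel)"
    by (subst nn_integral_distr) auto
  finally show ?thesis ..
qed

lemma integral_lborel_translate:
  fixes f :: "'a::euclidean_space \<Rightarrow> 'b::{banach, second_countable_topology}"
  assumes [measurable]: "f \<in> borel_measurable borel"
  shows "(LINT x|lborel. f (a + x)) = (LINT x|lborel. f x)"
proof -
  have "(LINT x|lborel. f x) = (LINT x|distr lborel borel ((+) a). f x)"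
    by (simp add: lborel_distr_plus)
  also have "\<dots> = (LINT x|lborel. f (a + x))"
    by (subst integral_distr) auto
  finally show ?thesis ..
qed

section \<open>Gaussian integrals in one and several dimensions\<close>

lemma has_bochner_integral_exp_neg_square:
  assumes "c > (0::real)"
  shows "has_bochner_integral lborel (\<lambda>x::real. exp (- c * x\<^sup>2)) (sqrt (pi / c))"
proof -
  define \<sigma> where "\<sigma> = sqrt (1 / (2 * c))"
  have \<sigma>: "\<sigma> > 0" and \<sigma>2: "\<sigma>\<^sup>2 = 1 / (2 * c)" using assms by (auto simp: \<sigma>_def)
  have "has_bochner_integral lborel (\<lambda>x. sqrt (2 * pi * \<sigma>\<^sup>2) * normal_density 0 \<sigma> x) (sqrt (2 * pi * \<sigma>\<^sup>2) * 1)"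
    using \<sigma> by (intro has_bochner_integral_mult_right) (auto simp: has_bochner_integral_iff)
  moreover have "sqrt (2 * pi * \<sigma>\<^sup>2) * normal_density 0 \<sigma> x = exp (- c * x\<^sup>2)" for x
    using \<sigma> assms unfolding normal_density_def \<sigma>2 by simp
  moreover have "sqrt (2 * pi * \<sigma>\<^sup>2) * 1 = sqrt (pi / c)"
    using assms unfolding \<sigma>2 by simp
  ultimately show ?thesis by simp
qed

lemma exp_neg_norm_square_prod:
  fixes x :: "'a::euclidean_space"
  shows "exp (- c * (norm x)\<^sup>2) = (\<Prod>b\<in>Basis. exp (- c * (x \<bullet> b)\<^sup>2))"
proof -
  have "(norm x)\<^sup>2 = (\<Sum>b\<in>Basis. (x \<bullet> b)\<^sup>2)"
    unfolding power2_norm_eq_inner by (subst euclidean_inner) (simp add: power2_eq_square)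
  then show ?thesis by (simp add: sum_distrib_left exp_sum)
qed

lemma has_bochner_integral_gaussian:
  assumes "c > (0::real)"
  shows "has_bochner_integral lborel (\<lambda>x::'a::euclidean_space. exp (- c * (norm x)\<^sup>2)) (sqrt (pi / c) ^ DIM('a))"
proof (rule has_bochner_integral_nn_integral)
  have *: "(\<integral>\<^sup>+x. ennreal (exp (- c * x\<^sup>2)) \<partial>lborel) = ennreal (sqrt (pi / c))"
    using has_bochner_integral_exp_neg_square[OF assms]
    by (subst nn_integral_eq_integral) (auto simp: has_bochner_integral_iff)
  have "(\<integral>\<^sup>+(x::'a). ennreal (exp (- c * (norm x)\<^sup>2)) \<partial>lborel)
      = (\<integral>\<^sup>+(x::'a). (\<Prod>b\<in>Basis. ennreal (exp (- c * (x \<bullet> b)\<^sup>2))) \<partial>lborel)"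
    unfolding exp_neg_norm_square_prod by (subst prod_ennreal) auto
  also have "\<dots> = (\<Prod>b\<in>(Basis::'a set). (\<integral>\<^sup>+x. ennreal (exp (- c * x\<^sup>2)) \<partial>lborel))"
    by (rule nn_integral_lborel_prod) auto
  also have "\<dots> = ennreal (sqrt (pi / c) ^ DIM('a))"
    unfolding * using assms by (simp add: ennreal_power)
  finally show "(\<integral>\<^sup>+(x::'a). ennreal (exp (- c * (norm x)\<^sup>2)) \<partial>lborel) = ennreal (sqrt (pi / c) ^ DIM('a))" .
qed (use assms in auto)

lemma integrable_gaussian:
  "c > (0::real) \<Longrightarrow> integrable lborel (\<lambda>x::'a::euclidean_space. exp (- c * (norm x)\<^sup>2))"
  using has_bochner_integral_gaussian by (auto simp: has_bochner_integral_iff)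

text \<open>Cauchy's theorem through a global primitive \<open>\<Phi>\<close>: the integrals over
  [-k, k] at heights 0 and \<open>c\<close> are increments of \<open>\<Phi>\<close>, so they differ
  by its two vertical increments at -k and k. By the mean value inequality each of these is at most
  \<open>B * exp (- k\<^sup>2) * c\<close>; dominated convergence then lets k tend to
  infinity.\<close>

lemma contour_shift_line:
  fixes f :: "complex \<Rightarrow> complex"
  assumes hol: "f holomorphic_on UNIV" and c: "0 \<le> c"
    and bound: "\<And>s \<eta>. 0 \<le> \<eta> \<Longrightarrow> \<eta> \<le> c \<Longrightarrow> norm (f (Complex s \<eta>)) \<le> B * exp (- s\<^sup>2)"
  shows "(LINT s|lborel. f (complex_of_real s)) = (LINT s|lborel. f (Complex s c))"
proof -
  obtain \<Phi> where \<Phi>: "\<And>z. (\<Phi> has_field_derivative f z) (at z)"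
    using holomorphic_convex_primitive'[OF _ _ hol] by auto
  have contf: "continuous_on UNIV f" by (rule holomorphic_on_imp_continuous_on[OF hol])
  have cont: "continuous_on A (\<lambda>s. f (Complex s \<eta>))" for \<eta> A
    unfolding Complex_eq by (intro continuous_on_compose2[OF contf] continuous_intros) auto
  have meas[measurable]: "(\<lambda>s. f (Complex s \<eta>)) \<in> borel_measurable borel" for \<eta>
    by (rule borel_measurable_continuous_onI) (rule cont)
  have gint: "integrable lborel (\<lambda>s::real. B * exp (- s\<^sup>2))"
    using integrable_gaussian[of 1, where 'a=real] by simp
  have fint: "integrable lborel (\<lambda>s. f (Complex s \<eta>))" if "0 \<le> \<eta>" "\<eta> \<le> c" for \<eta>
    by (rule Bochner_Integration.integrable_bound[OF gint]) (use bound[OF that] in \<open>auto intro: order_trans[OF _ abs_ge_self]\<close>)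
  have lim: "(\<lambda>k. LINT s|lborel. indicator {-real k..real k} s *\<^sub>R f (Complex s \<eta>)) \<longlonglongrightarrow> (LINT s|lborel. f (Complex s \<eta>))"
    if "0 \<le> \<eta>" "\<eta> \<le> c" for \<eta>
  proof (rule integral_dominated_convergence[OF _ _ gint])
    show "AE s in lborel. (\<lambda>k. indicator {-real k..real k} s *\<^sub>R f (Complex s \<eta>)) \<longlonglongrightarrow> f (Complex s \<eta>)"
    proof (intro AE_I2)
      fix s :: real
      obtain N :: nat where "\<bar>s\<bar> \<le> real N" using real_arch_simple by blast
      then have "\<forall>k\<ge>N. indicator {-real k..real k} s *\<^sub>R f (Complex s \<eta>) = f (Complex s \<eta>)"
        by (auto simp: indicator_def)
      then show "(\<lambda>k. indicator {-real k..real k} s *\<^sub>R f (Complex s \<eta>)) \<longlonglongrightarrow> f (Complex s \<eta>)"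
        by (intro tendsto_eventually) (auto simp: eventually_sequentially)
    qed
    show "AE s in lborel. norm (indicator {-real k..real k} s *\<^sub>R f (Complex s \<eta>)) \<le> B * exp (- s\<^sup>2)" for k
      using bound[OF that] by (auto simp: indicator_def intro!: AE_I2 order_trans[OF norm_ge_zero])
  qed auto
  have FTC: "(LINT s|lborel. indicator {-real k..real k} s *\<^sub>R f (Complex s \<eta>)) = \<Phi> (Complex k \<eta>) - \<Phi> (Complex (- real k) \<eta>)" for k \<eta>
  proof -
    have "((\<lambda>s. \<Phi> (Complex s \<eta>)) has_vector_derivative f (Complex s \<eta>)) (at s within {-real k..real k})" for s
    proof -
      have "((\<lambda>s. Complex s \<eta>) has_vector_derivative 1) (at s within {-real k..real k})"
        unfolding Complex_eq by (auto intro!: derivative_eq_intros)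
      from field_vector_diff_chain_within[OF this has_field_derivative_at_within[OF \<Phi>]] show ?thesis
        by (simp add: o_def)
    qed
    from has_bochner_integral_FTC_Icc[OF _ this cont] show ?thesis
      by (simp add: has_bochner_integral_iff)
  qed
  have side: "norm (\<Phi> (Complex r c) - \<Phi> (Complex r 0)) \<le> B * exp (- r\<^sup>2) * c" for r
  proof -
    have "norm (\<Phi> (Complex r c) - \<Phi> (Complex r 0)) \<le> (B * exp (- r\<^sup>2)) * norm (Complex r c - Complex r 0)"
    proof (rule field_differentiable_bound[where S = "closed_segment (Complex r 0) (Complex r c)" and f'=f])
      fix z assume z: "z \<in> closed_segment (Complex r 0) (Complex r c)"
      show "(\<Phi> has_field_derivative f z) (at z within closed_segment (Complex r 0) (Complex r c))"
        by (rule has_field_derivative_at_within[OF \<Phi>])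
      from z obtain u where u: "0 \<le> u" "u \<le> 1" "z = (1 - u) *\<^sub>R Complex r 0 + u *\<^sub>R Complex r c"
        by (auto simp: closed_segment_def)
      then have "z = Complex r (u * c)" by (auto simp: complex_eq_iff algebra_simps)
      moreover have "u * c \<le> c" using u c by (simp add: mult_left_le_one_le)
      ultimately show "norm (f z) \<le> B * exp (- r\<^sup>2)" using bound[of "u * c" r] u c by auto
    qed auto
    also have "norm (Complex r c - Complex r 0) = c" using c by (simp add: cmod_def)
    finally show ?thesis .
  qed
  have "(\<lambda>k. (LINT s|lborel. indicator {-real k..real k} s *\<^sub>R f (Complex s c))
          - (LINT s|lborel. indicator {-real k..real k} s *\<^sub>R f (Complex s 0))) \<longlonglongrightarrow> 0"
  proof (rule Lim_null_comparison)
    show "(\<lambda>k. 2 * (B * exp (- (real k)\<^sup>2) * c)) \<longlonglongrightarrow> 0"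
      by real_asymp
    show "\<forall>\<^sub>F k in sequentially. norm ((LINT s|lborel. indicator {-real k..real k} s *\<^sub>R f (Complex s c))
          - (LINT s|lborel. indicator {-real k..real k} s *\<^sub>R f (Complex s 0))) \<le> 2 * (B * exp (- (real k)\<^sup>2) * c)"
    proof (intro always_eventually allI)
      fix k
      have "norm ((\<Phi> (Complex k c) - \<Phi> (Complex k 0)) - (\<Phi> (Complex (- real k) c) - \<Phi> (Complex (- real k) 0)))
          \<le> B * exp (- (real k)\<^sup>2) * c + B * exp (- (real k)\<^sup>2) * c"
        by (rule order_trans[OF norm_triangle_ineq4 add_mono[OF side side[of "- real k", unfolded power2_minus]]])
      then show "norm ((LINT s|lborel. indicator {-real k..real k} s *\<^sub>R f (Complex s c))
          - (LINT s|lborel. indicator {-real k..real k} s *\<^sub>R f (Complex s 0))) \<le> 2 * (B * exp (- (real k)\<^sup>2) * c)"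
        unfolding FTC by (simp add: algebra_simps)
    qed
  qed
  moreover have "(\<lambda>k. (LINT s|lborel. indicator {-real k..real k} s *\<^sub>R f (Complex s c))
          - (LINT s|lborel. indicator {-real k..real k} s *\<^sub>R f (Complex s 0))) \<longlonglongrightarrow>
          (LINT s|lborel. f (Complex s c)) - (LINT s|lborel. f (Complex s 0))"
    by (intro tendsto_diff lim) (use c in auto)
  ultimately have "(LINT s|lborel. f (Complex s c)) - (LINT s|lborel. f (Complex s 0)) = 0"
    using LIMSEQ_unique by blast
  then show ?thesis by (simp add: complex_of_real_def)
qed

text \<open>No integrability is required, since the Bochner integral of a non-integrable function is
  0 by convention. Inner integrals of iterated integrals can thus be estimated at every point at
  once.\<close>

lemma integral_norm_bound_ennreal':
  fixes f :: "'a \<Rightarrow> 'b::{banach, second_countable_topology}"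
  shows "ennreal (norm (integral\<^sup>L M f)) \<le> (\<integral>\<^sup>+x. ennreal (norm (f x)) \<partial>M)"
  by (cases "integrable M f") (auto simp: integral_norm_bound_ennreal not_integrable_integral_eq)

text \<open>Averaging the integral over translates along \<open>\<omega>\<close> against the Gaussian \<open>exp (- z\<^sup>2)\<close> replaces an iterated
  integral in coordinates adapted to \<open>\<omega>\<close>: only the one-dimensional contour has to be shifted.\<close>

lemma contour_shift_translation:
  fixes \<Phi> :: "'a::euclidean_space \<Rightarrow> complex \<Rightarrow> complex" and \<omega> :: 'a
  assumes hol: "\<And>\<xi>. \<Phi> \<xi> holomorphic_on UNIV"
    and eqv: "\<And>\<xi> s z. \<Phi> (\<xi> + s *\<^sub>R \<omega>) z = \<Phi> \<xi> (z + of_real s)"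
    and meas: "\<And>z. (\<lambda>\<xi>. \<Phi> \<xi> z) \<in> borel_measurable borel"
    and c: "0 \<le> c"
    and bound: "\<And>\<xi> \<eta>. 0 \<le> \<eta> \<Longrightarrow> \<eta> \<le> c \<Longrightarrow> norm (\<Phi> \<xi> (Complex 0 \<eta>)) \<le> g \<xi>"
    and gint: "integrable lborel g" and gB: "\<And>\<xi>. g \<xi> \<le> B"
    and bound': "\<And>\<xi>. norm (\<Phi> \<xi> (Complex 0 c)) \<le> g' \<xi>"
    and g'int: "integrable lborel g'"
  shows "norm (LINT \<xi>|lborel. \<Phi> \<xi> 0) \<le> exp (c\<^sup>2) * (LINT \<xi>|lborel. g' \<xi>)"
proof -
  define \<rho> :: "complex \<Rightarrow> complex" where "\<rho> z = exp (- z\<^sup>2) / of_real (sqrt pi)" for z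
  have \<rho>_hol: "\<rho> holomorphic_on UNIV"
    unfolding \<rho>_def by (intro holomorphic_intros) auto
  have \<rho>_norm: "norm (\<rho> (Complex s \<eta>)) = exp (\<eta>\<^sup>2) * exp (- s\<^sup>2) / sqrt pi" for s \<eta>
    unfolding \<rho>_def by (simp add: norm_divide exp_add[symmetric] power2_eq_square)
  have \<rho>_int: "has_bochner_integral lborel (\<lambda>s. norm (\<rho> (Complex s \<eta>))) (exp (\<eta>\<^sup>2))" for \<eta>
  proof -
    have "has_bochner_integral lborel (\<lambda>s. exp (\<eta>\<^sup>2) / sqrt pi * exp (- 1 * s\<^sup>2)) (exp (\<eta>\<^sup>2) / sqrt pi * sqrt (pi / 1))"
      by (intro has_bochner_integral_mult_right has_bochner_integral_exp_neg_square) auto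
    then show ?thesis unfolding \<rho>_norm by simp
  qed
  have \<rho>_one: "(LINT s|lborel. \<rho> (Complex s 0)) = 1"
  proof -
    have "\<rho> (Complex s 0) = of_real (norm (\<rho> (Complex s 0)))" for s
      unfolding \<rho>_norm unfolding \<rho>_def
      by (simp add: complex_of_real_def[symmetric] exp_of_real[symmetric])
    then have "(LINT s|lborel. \<rho> (Complex s 0)) = (LINT s|lborel. complex_of_real (norm (\<rho> (Complex s 0))))"
      by simp
    also have "\<dots> = of_real 1"
      unfolding integral_complex_of_real using \<rho>_int[of 0] by (simp add: has_bochner_integral_iff)
    finally show ?thesis by simp
  qed
  have [measurable]: "\<rho> \<in> borel_measurable borel"
    by (intro borel_measurable_continuous_onI holomorphic_on_imp_continuous_on \<rho>_hol)
  have g0: "0 \<le> g \<xi>" for \<xi> using bound[of 0 \<xi>] c norm_ge_zero order_trans by blast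
  have B0: "0 \<le> B" using g0[of 0] gB[of 0] by simp
  define \<Psi> where "\<Psi> \<eta> \<xi> = \<Phi> \<xi> (Complex 0 \<eta>)" for \<eta> \<xi>
  have \<Psi>_meas[measurable]: "\<Psi> \<eta> \<in> borel_measurable borel" for \<eta>
    unfolding \<Psi>_def by (rule meas)
  \<comment> \<open>Moving along the real direction of the contour is a translation of the
    frequency, so bounds on the imaginary axis control \<open>\<Phi>\<close> on every horizontal
    line.\<close>
  have eqv': "\<Phi> \<xi> (Complex s \<eta>) = \<Psi> \<eta> (\<xi> + s *\<^sub>R \<omega>)" for \<xi> s \<eta>
  proof -
    have "Complex s \<eta> = Complex 0 \<eta> + of_real s" by (simp add: complex_eq_iff)
    then show ?thesis unfolding eqv \<Psi>_def by (rule arg_cong)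
  qed
  have [measurable]: "(\<lambda>p. \<Phi> (fst p) (Complex (snd p) \<eta>)) \<in> borel_measurable (borel \<Otimes>\<^sub>M borel)" for \<eta>
    unfolding eqv' by measurable
  have [measurable]: "(\<lambda>s. Complex s \<eta>) \<in> borel_measurable borel" for \<eta>
    unfolding Complex_eq by measurable
  have [measurable]: "g \<in> borel_measurable borel" "g' \<in> borel_measurable borel"
    using gint g'int borel_measurable_integrable by auto
  define H where "H \<eta> \<xi> s = \<rho> (Complex s \<eta>) * \<Phi> \<xi> (Complex s \<eta>)" for \<eta> \<xi> s
  have [measurable]: "(\<lambda>p. H \<eta> (fst p) (snd p)) \<in> borel_measurable (borel \<Otimes>\<^sub>M borel)" for \<eta>
    unfolding H_def by measurable
  \<comment> \<open>Tonelli and translation invariance. The factor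
    \<open>exp (\<eta>\<^sup>2)\<close> is the mass of the modulus of \<open>\<rho>\<close> on the
    line of height \<open>\<eta>\<close>; height 0 gives the integrability for Fubini, height
    \<open>c\<close> the factor \<open>exp (c\<^sup>2)\<close> of the conclusion.\<close>
  have nn: "(\<integral>\<^sup>+\<xi>. \<integral>\<^sup>+s. ennreal (norm (\<rho> (Complex s \<eta>))) * ennreal (f (\<xi> + s *\<^sub>R \<omega>)) \<partial>lborel \<partial>lborel)
      = ennreal (exp (\<eta>\<^sup>2)) * (\<integral>\<^sup>+\<xi>. ennreal (f \<xi>) \<partial>lborel)"
    if [measurable]: "f \<in> borel_measurable borel" for f :: "'a \<Rightarrow> real" and \<eta>
  proof -
    have "(\<integral>\<^sup>+\<xi>. \<integral>\<^sup>+s. ennreal (norm (\<rho> (Complex s \<eta>))) * ennreal (f (\<xi> + s *\<^sub>R \<omega>)) \<partial>lborel \<partial>lborel)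
       = (\<integral>\<^sup>+s. \<integral>\<^sup>+\<xi>. ennreal (norm (\<rho> (Complex s \<eta>))) * ennreal (f (\<xi> + s *\<^sub>R \<omega>)) \<partial>lborel \<partial>lborel)"
      by (rule lborel_pair.Fubini'[symmetric]) measurable
    also have "\<dots> = (\<integral>\<^sup>+s. ennreal (norm (\<rho> (Complex s \<eta>))) * (\<integral>\<^sup>+\<xi>. ennreal (f \<xi>) \<partial>lborel) \<partial>lborel)"
    proof (rule nn_integral_cong)
      fix s
      have "(\<integral>\<^sup>+\<xi>. ennreal (f (s *\<^sub>R \<omega> + \<xi>)) \<partial>lborel) = (\<integral>\<^sup>+\<xi>. ennreal (f \<xi>) \<partial>lborel)"
        by (rule nn_integral_lborel_translate) measurable
      then show "(\<integral>\<^sup>+\<xi>. ennreal (norm (\<rho> (Complex s \<eta>))) * ennreal (f (\<xi> + s *\<^sub>R \<omega>)) \<partial>lborel) =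
          ennreal (norm (\<rho> (Complex s \<eta>))) * (\<integral>\<^sup>+\<xi>. ennreal (f \<xi>) \<partial>lborel)"
        by (subst nn_integral_cmult) (auto simp: add.commute)
    qed
    also have "\<dots> = (\<integral>\<^sup>+s. ennreal (norm (\<rho> (Complex s \<eta>))) \<partial>lborel) * (\<integral>\<^sup>+\<xi>. ennreal (f \<xi>) \<partial>lborel)"
      by (rule nn_integral_multc) measurable
    also have "(\<integral>\<^sup>+s. ennreal (norm (\<rho> (Complex s \<eta>))) \<partial>lborel) = ennreal (exp (\<eta>\<^sup>2))"
      using \<rho>_int[of \<eta>] by (subst nn_integral_eq_integral) (auto simp: has_bochner_integral_iff)
    finally show ?thesis .
  qed
  have Hint: "integrable (lborel \<Otimes>\<^sub>M lborel) (\<lambda>(\<xi>, s). H 0 \<xi> s)"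
  proof (rule integrableI_bounded)
    have "(\<integral>\<^sup>+p. ennreal (norm (case p of (\<xi>, s) \<Rightarrow> H 0 \<xi> s)) \<partial>(lborel \<Otimes>\<^sub>M lborel))
        = (\<integral>\<^sup>+\<xi>. \<integral>\<^sup>+s. ennreal (norm (H 0 \<xi> s)) \<partial>lborel \<partial>lborel)"
      by (subst lborel.nn_integral_fst[symmetric]) (simp_all add: case_prod_beta)
    also have "\<dots> \<le> (\<integral>\<^sup>+\<xi>. \<integral>\<^sup>+s. ennreal (norm (\<rho> (Complex s 0))) * ennreal (g (\<xi> + s *\<^sub>R \<omega>)) \<partial>lborel \<partial>lborel)"
      unfolding H_def norm_mult eqv' ennreal_mult'[OF norm_ge_zero]
      by (intro nn_integral_mono mult_left_mono ennreal_leI bound[folded \<Psi>_def]) (use c in auto)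
    also have "\<dots> < \<infinity>"
      unfolding nn[OF \<open>g \<in> borel_measurable borel\<close>]
      using integrableD(2)[OF gint] g0 by (simp add: ennreal_mult_less_top less_top[symmetric])
    finally show "(\<integral>\<^sup>+p. ennreal (norm (case p of (\<xi>, s) \<Rightarrow> H 0 \<xi> s)) \<partial>(lborel \<Otimes>\<^sub>M lborel)) < \<infinity>" .
  qed (simp add: case_prod_beta)
  have "(LINT \<xi>|lborel. \<Phi> \<xi> 0) = (LINT s|lborel. \<rho> (Complex s 0) * (LINT \<xi>|lborel. \<Phi> \<xi> 0))"
    by (simp add: \<rho>_one)
  also have "\<dots> = (LINT s|lborel. LINT \<xi>|lborel. H 0 \<xi> s)"
  proof (rule Bochner_Integration.integral_cong[OF refl])
    fix s
    have "(LINT \<xi>|lborel. \<Psi> 0 (s *\<^sub>R \<omega> + \<xi>)) = (LINT \<xi>|lborel. \<Psi> 0 \<xi>)"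
      by (rule integral_lborel_translate) measurable
    moreover have "\<Phi> \<xi> 0 = \<Psi> 0 \<xi>" for \<xi> by (simp add: \<Psi>_def zero_complex.code[symmetric])
    ultimately show "\<rho> (Complex s 0) * (LINT \<xi>|lborel. \<Phi> \<xi> 0) = (LINT \<xi>|lborel. H 0 \<xi> s)"
      unfolding H_def eqv' by (simp add: add.commute)
  qed
  also have "\<dots> = (LINT \<xi>|lborel. LINT s|lborel. H 0 \<xi> s)"
    by (rule lborel_pair.Fubini_integral[OF Hint])
  \<comment> \<open>The shift is made for each fixed \<open>\<xi>\<close>. The decay in
    \<open>s\<close> that it requires is supplied by \<open>\<rho>\<close> alone, as
    \<open>\<Phi>\<close> is merely bounded by \<open>B\<close> on the strip.\<close>
  also have "\<dots> = (LINT \<xi>|lborel. LINT s|lborel. H c \<xi> s)"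
  proof (rule Bochner_Integration.integral_cong[OF refl])
    fix \<xi>
    have "(LINT s|lborel. (\<rho> (of_real s) * \<Phi> \<xi> (of_real s))) = (LINT s|lborel. (\<rho> (Complex s c) * \<Phi> \<xi> (Complex s c)))"
    proof (rule contour_shift_line[where B = "exp (c\<^sup>2) / sqrt pi * B"])
      show "(\<lambda>z. \<rho> z * \<Phi> \<xi> z) holomorphic_on UNIV"
        by (intro holomorphic_intros \<rho>_hol hol)
      fix s \<eta> assume \<eta>: "0 \<le> \<eta>" "\<eta> \<le> c"
      have "norm (\<rho> (Complex s \<eta>)) \<le> exp (c\<^sup>2) * exp (- s\<^sup>2) / sqrt pi"
        unfolding \<rho>_norm using \<eta> by (intro divide_right_mono mult_right_mono) (auto intro: power_mono)
      moreover have "norm (\<Phi> \<xi> (Complex s \<eta>)) \<le> B"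
        unfolding eqv' using bound[OF \<eta>, folded \<Psi>_def] gB order_trans by blast
      ultimately have "norm (\<rho> (Complex s \<eta>)) * norm (\<Phi> \<xi> (Complex s \<eta>)) \<le> (exp (c\<^sup>2) * exp (- s\<^sup>2) / sqrt pi) * B"
        by (intro mult_mono) auto
      then show "norm (\<rho> (Complex s \<eta>) * \<Phi> \<xi> (Complex s \<eta>)) \<le> exp (c\<^sup>2) / sqrt pi * B * exp (- s\<^sup>2)"
        by (simp add: norm_mult mult_ac)
    qed (rule c)
    then show "(LINT s|lborel. H 0 \<xi> s) = (LINT s|lborel. H c \<xi> s)"
      unfolding H_def complex_of_real_def .
  qed
  finally have eq: "(LINT \<xi>|lborel. \<Phi> \<xi> 0) = (LINT \<xi>|lborel. LINT s|lborel. H c \<xi> s)" .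
  have g'0: "0 \<le> g' \<xi>" for \<xi> using bound'[of \<xi>] norm_ge_zero order_trans by blast
  have "ennreal (norm (LINT \<xi>|lborel. \<Phi> \<xi> 0)) \<le> (\<integral>\<^sup>+\<xi>. ennreal (norm (LINT s|lborel. H c \<xi> s)) \<partial>lborel)"
    unfolding eq by (rule integral_norm_bound_ennreal')
  also have "\<dots> \<le> (\<integral>\<^sup>+\<xi>. \<integral>\<^sup>+s. ennreal (norm (H c \<xi> s)) \<partial>lborel \<partial>lborel)"
    by (intro nn_integral_mono integral_norm_bound_ennreal')
  also have "\<dots> \<le> (\<integral>\<^sup>+\<xi>. \<integral>\<^sup>+s. ennreal (norm (\<rho> (Complex s c))) * ennreal (g' (\<xi> + s *\<^sub>R \<omega>)) \<partial>lborel \<partial>lborel)"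
    unfolding H_def norm_mult eqv' ennreal_mult'[OF norm_ge_zero]
    by (intro nn_integral_mono mult_left_mono ennreal_leI bound'[folded \<Psi>_def]) auto
  also have "\<dots> = ennreal (exp (c\<^sup>2)) * (\<integral>\<^sup>+\<xi>. ennreal (g' \<xi>) \<partial>lborel)"
    by (rule nn) measurable
  also have "\<dots> = ennreal (exp (c\<^sup>2) * (LINT \<xi>|lborel. g' \<xi>))"
    using g'int g'0 by (subst nn_integral_eq_integral) (auto simp: ennreal_mult integral_nonneg_AE)
  finally show ?thesis
    using g'0 by (subst (asm) ennreal_le_iff) (auto intro!: mult_nonneg_nonneg integral_nonneg_AE)
qed

lemma cnj_measurable[measurable]: "cnj \<in> borel_measurable borel"
  by (intro borel_measurable_continuous_onI continuous_intros)

text \<open>Weyl differencing: the integral times its conjugate is a double integral, and the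
  substitution of \<open>\<xi> + h\<close> for the first variable with Fubini makes \<open>h\<close>
  the outer variable. A linear phase in \<open>A\<close> contributes only a constant of modulus 1 to
  each inner integral.\<close>

lemma norm_integral_square_le_autocorrelation:
  fixes A :: "'a::euclidean_space \<Rightarrow> complex"
  assumes A: "integrable lborel A"
  shows "ennreal ((norm (LINT \<xi>|lborel. A \<xi>))\<^sup>2)
    \<le> (\<integral>\<^sup>+h. ennreal (norm (LINT \<xi>|lborel. A (\<xi> + h) * cnj (A \<xi>))) \<partial>lborel)"
proof -
  have [measurable]: "A \<in> borel_measurable borel"
    using A borel_measurable_integrable by auto
  have tr: "(LINT h|lborel. A (\<xi> + h)) = (LINT \<xi>|lborel. A \<xi>)" for \<xi>
    by (rule integral_lborel_translate) simp
  have int: "integrable (lborel \<Otimes>\<^sub>M lborel) (\<lambda>(\<xi>, h). A (\<xi> + h) * cnj (A \<xi>))"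
  proof (rule integrableI_bounded)
    have "(\<integral>\<^sup>+p. ennreal (norm (case p of (\<xi>, h) \<Rightarrow> A (\<xi> + h) * cnj (A \<xi>))) \<partial>(lborel \<Otimes>\<^sub>M lborel))
        = (\<integral>\<^sup>+\<xi>. \<integral>\<^sup>+h. ennreal (norm (A \<xi>)) * ennreal (norm (A (\<xi> + h))) \<partial>lborel \<partial>lborel)"
      by (subst lborel.nn_integral_fst[symmetric]) (simp_all add: case_prod_beta norm_mult ennreal_mult mult.commute)
    also have "\<dots> = (\<integral>\<^sup>+\<xi>. ennreal (norm (A \<xi>)) * (\<integral>\<^sup>+h. ennreal (norm (A h)) \<partial>lborel) \<partial>lborel)"
      by (subst nn_integral_cmult) (simp_all add: nn_integral_lborel_translate[where f="\<lambda>x. ennreal (norm (A x))"])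
    also have "\<dots> = (\<integral>\<^sup>+\<xi>. ennreal (norm (A \<xi>)) \<partial>lborel) * (\<integral>\<^sup>+h. ennreal (norm (A h)) \<partial>lborel)"
      by (rule nn_integral_multc) simp
    also have "\<dots> < \<infinity>"
      using A unfolding integrable_iff_bounded by (simp add: ennreal_mult_less_top)
    finally show "(\<integral>\<^sup>+p. ennreal (norm (case p of (\<xi>, h) \<Rightarrow> A (\<xi> + h) * cnj (A \<xi>))) \<partial>(lborel \<Otimes>\<^sub>M lborel)) < \<infinity>" .
  qed measurable
  have "(LINT \<xi>|lborel. A \<xi>) * cnj (LINT \<xi>|lborel. A \<xi>)
      = (LINT \<xi>|lborel. (LINT h|lborel. A (\<xi> + h)) * cnj (A \<xi>))"
    unfolding tr by simp
  also have "\<dots> = (LINT \<xi>|lborel. LINT h|lborel. A (\<xi> + h) * cnj (A \<xi>))"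
    by simp
  also have "\<dots> = (LINT h|lborel. LINT \<xi>|lborel. A (\<xi> + h) * cnj (A \<xi>))"
    by (rule lborel_pair.Fubini_integral[OF int, symmetric])
  finally have eq: "complex_of_real ((norm (LINT \<xi>|lborel. A \<xi>))\<^sup>2) = (LINT h|lborel. LINT \<xi>|lborel. A (\<xi> + h) * cnj (A \<xi>))"
    by (simp only: complex_norm_square)
  have "(norm (LINT \<xi>|lborel. A \<xi>))\<^sup>2 = norm (complex_of_real ((norm (LINT \<xi>|lborel. A \<xi>))\<^sup>2))"
    by (simp only: norm_of_real abs_of_nonneg zero_le_power2)
  then show ?thesis unfolding eq by (simp only: integral_norm_bound_ennreal')
qed

section \<open>The weighted dispersive kernel\<close>

text \<open>The holomorphic extension in \<open>z\<close> of the squared norm of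
  \<open>\<xi> + z *\<^sub>R \<omega>\<close>, for a unit vector \<open>\<omega>\<close>. Norms
  enter the weight and the phase only through their squares, so both extend along the line.\<close>

definition line_square :: "'a::euclidean_space \<Rightarrow> 'a \<Rightarrow> complex \<Rightarrow> complex" where
  "line_square \<omega> \<xi> z = of_real ((norm \<xi>)\<^sup>2) + 2 * z * of_real (\<xi> \<bullet> \<omega>) + z\<^sup>2"

lemma norm_add_scaleR_unit:
  fixes \<omega> :: "'a::real_inner"
  shows "norm \<omega> = 1 \<Longrightarrow> (norm (\<xi> + s *\<^sub>R \<omega>))\<^sup>2 = (norm \<xi>)\<^sup>2 + 2 * s * (\<xi> \<bullet> \<omega>) + s\<^sup>2"
  unfolding power2_norm_eq_inner
  by (simp add: inner_add_left inner_add_right norm_eq_1 inner_commute algebra_simps power2_eq_square)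

lemma line_square_translate:
  assumes "norm \<omega> = 1"
  shows "line_square \<omega> (\<xi> + s *\<^sub>R \<omega>) z = line_square \<omega> \<xi> (z + of_real s)"
  unfolding line_square_def norm_add_scaleR_unit[OF assms]
  using assms by (simp add: inner_add_left norm_eq_1 algebra_simps power2_eq_square)

lemma line_square_0: "line_square \<omega> \<xi> 0 = of_real ((norm \<xi>)\<^sup>2)"
  by (simp add: line_square_def)

lemma line_square_holomorphic: "line_square \<omega> \<xi> holomorphic_on S"
  unfolding line_square_def by (intro holomorphic_intros)

lemma line_square_measurable[measurable]: "(\<lambda>\<xi>. line_square \<omega> \<xi> z) \<in> borel_measurable borel"
  unfolding line_square_def by measurable

lemma line_square_imag:
  "Re (line_square \<omega> \<xi> (Complex 0 \<eta>)) = (norm \<xi>)\<^sup>2 - \<eta>\<^sup>2"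
  "Im (line_square \<omega> \<xi> (Complex 0 \<eta>)) = 2 * \<eta> * (\<xi> \<bullet> \<omega>)"
  by (simp_all add: line_square_def power2_eq_square)

lemma abs_inner_unit_le: "norm \<omega> = 1 \<Longrightarrow> \<bar>\<xi> \<bullet> \<omega>\<bar> \<le> norm (\<xi>::'a::real_inner)"
  using Cauchy_Schwarz_ineq2[of \<xi> \<omega>] by simp

lemma norm_line_square_imag_le:
  assumes "norm \<omega> = 1" "0 \<le> \<eta>"
  shows "norm (line_square \<omega> \<xi> (Complex 0 \<eta>)) \<le> (norm \<xi> + \<eta>)\<^sup>2"
proof -
  have "norm (line_square \<omega> \<xi> (Complex 0 \<eta>)) \<le> norm (complex_of_real ((norm \<xi>)\<^sup>2))
      + norm (2 * Complex 0 \<eta> * of_real (\<xi> \<bullet> \<omega>)) + norm ((Complex 0 \<eta>)\<^sup>2)"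
    unfolding line_square_def by (intro norm_triangle_mono order_refl)
  also have "\<dots> = (norm \<xi>)\<^sup>2 + 2 * \<eta> * \<bar>\<xi> \<bullet> \<omega>\<bar> + \<eta>\<^sup>2"
  proof -
    have "norm (Complex 0 \<eta>) = \<eta>" using assms by (simp add: cmod_def)
    then show ?thesis using assms by (simp add: norm_mult norm_power abs_mult)
  qed
  also have "\<dots> \<le> (norm \<xi>)\<^sup>2 + 2 * \<eta> * norm \<xi> + \<eta>\<^sup>2"
    using abs_inner_unit_le[OF assms(1)] assms(2) by (intro add_mono mult_left_mono order_refl) auto
  also have "\<dots> = (norm \<xi> + \<eta>)\<^sup>2" by (simp add: power2_eq_square algebra_simps)
  finally show ?thesis .
qed

text \<open>The real part is \<open>((norm \<xi>)\<^sup>2 - \<eta>\<^sup>2)\<^sup>2 - (2 * \<eta> *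
  (\<xi> \<bullet> \<omega>))\<^sup>2\<close>; the two negative terms lose at most 2 and 4 times the
  squared norm when \<open>\<eta> \<le> 1\<close>. Hence the quartic exponential keeps its decay on
  the shifted contours, up to a quadratic error.\<close>

lemma Re_line_square_imag_square_ge:
  assumes "norm \<omega> = 1" "0 \<le> \<eta>" "\<eta> \<le> 1"
  shows "(norm \<xi>)^4 - 6 * (norm \<xi>)\<^sup>2 \<le> Re ((line_square \<omega> \<xi> (Complex 0 \<eta>))\<^sup>2)"
proof -
  let ?X = "(norm \<xi>)\<^sup>2" and ?u = "\<xi> \<bullet> \<omega>"
  have u: "?u\<^sup>2 \<le> ?X"
    using abs_inner_unit_le[OF assms(1), of \<xi>] power_mono[of "\<bar>?u\<bar>" "norm \<xi>" 2] by simp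
  have e: "\<eta>\<^sup>2 \<le> 1" using assms by (simp add: power_le_one)
  have "\<eta>\<^sup>2 * ?u\<^sup>2 \<le> 1 * ?X" by (intro mult_mono u e) auto
  moreover have "\<eta>\<^sup>2 * ?X \<le> 1 * ?X" by (intro mult_mono e) auto
  moreover have "(\<eta>\<^sup>2)\<^sup>2 \<ge> 0" by simp
  moreover have "Re ((line_square \<omega> \<xi> (Complex 0 \<eta>))\<^sup>2) = (?X - \<eta>\<^sup>2)\<^sup>2 - (2 * \<eta> * ?u)\<^sup>2"
    by (simp add: line_square_imag power2_eq_square)
  moreover have "(?X - \<eta>\<^sup>2)\<^sup>2 - (2 * \<eta> * ?u)\<^sup>2 = (norm \<xi>)^4 - 2 * (\<eta>\<^sup>2 * ?X) + (\<eta>\<^sup>2)\<^sup>2 - 4 * (\<eta>\<^sup>2 * ?u\<^sup>2)"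
    by (simp add: power2_eq_square power4_eq_xxxx algebra_simps)
  ultimately show ?thesis by linarith
qed

text \<open>Beyond \<open>M = max 1 (3 * A)\<close> each lower power is at most \<open>X^3\<close>,
  and \<open>3 * A * X^3 \<le> X^4\<close>; below \<open>M\<close> the left side is at most its
  value at \<open>M\<close>. All growth caused by shifts and by the polynomial part of the weight is
  absorbed this way.\<close>

lemma quartic_dominates:
  fixes A :: real
  assumes "0 \<le> A"
  obtains C where "\<And>X. 0 \<le> X \<Longrightarrow> A * X^3 + A * X\<^sup>2 + A * X \<le> X^4 + C"
proof -
  define M where "M = max 1 (3 * A)"
  have "A * X^3 + A * X\<^sup>2 + A * X \<le> X^4 + A * (M^3 + M\<^sup>2 + M)" if "0 \<le> X" for X
  proof (cases "X \<le> M")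
    case True
    then have "A * (X^3 + X\<^sup>2 + X) \<le> A * (M^3 + M\<^sup>2 + M)"
      using that assms by (intro mult_left_mono add_mono power_mono) auto
    moreover have "X^4 \<ge> 0" by simp
    ultimately show ?thesis unfolding distrib_left by linarith
  next
    case False
    then have X: "X \<ge> 1" "X \<ge> 3 * A" by (auto simp: M_def)
    have "X\<^sup>2 \<le> X^3" "X \<le> X^3"
      using X power_increasing[of 2 3 X] power_increasing[of 1 3 X] by auto
    then have "A * X\<^sup>2 \<le> A * X^3" "A * X \<le> A * X^3" using assms by (auto intro: mult_left_mono)
    moreover have "3 * A * X^3 \<le> X * X^3" using X by (intro mult_right_mono) auto
    moreover have "X * X^3 = X^4" by (simp add: power_Suc[symmetric])
    moreover have "A * (M^3 + M\<^sup>2 + M) \<ge> 0" using assms by (auto simp: M_def)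
    ultimately show ?thesis by (simp only: mult.assoc)
  qed
  then show thesis by (rule that)
qed

lemma one_plus_power_le_exp: "0 \<le> X \<Longrightarrow> (X + 1) ^ m \<le> exp (real m * X)" for X :: real
  using power_mono[of "X + 1" "exp X" m] exp_ge_add_one_self[of X] by (simp add: exp_of_nat_mult add.commute)

text \<open>The even degree makes this a polynomial in the squared norm times a Gaussian of the
  squared norm, hence entire along complex lines. The order \<open>2 * DIM('a)\<close> of the zero
  at the origin compensates for the degenerate Hessian of the pure quartic phase there.\<close>

definition weight :: "'a::euclidean_space \<Rightarrow> real" where
  "weight \<xi> = (norm \<xi>) ^ (2 * DIM('a)) * exp (- ((norm \<xi>) ^ 4))"

definition dispersion :: "real \<Rightarrow> real \<Rightarrow> 'a::euclidean_space \<Rightarrow> real" where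
  "dispersion a b \<xi> = a * (norm \<xi>) ^ 4 + b * (norm \<xi>)\<^sup>2"

definition kernel :: "real \<Rightarrow> real \<Rightarrow> real \<Rightarrow> 'a::euclidean_space \<Rightarrow> complex" where
  "kernel a b \<tau> y = (LINT \<xi>|lborel. of_real (weight \<xi>) * cis (y \<bullet> \<xi> + \<tau> * dispersion a b \<xi>))"

lemma weight_measurable[measurable]: "weight \<in> borel_measurable borel"
  unfolding weight_def by measurable

lemma dispersion_measurable[measurable]: "dispersion a b \<in> borel_measurable borel"
  unfolding dispersion_def by measurable

lemma cis_measurable[measurable]: "cis \<in> borel_measurable borel"
  by (intro borel_measurable_continuous_onI continuous_intros)

lemma weight_nonneg: "0 \<le> weight \<xi>"
  by (simp add: weight_def)

lemma weight_bound:
  obtains C where "\<And>\<xi>::'a::euclidean_space. weight \<xi> \<le> C * exp (- (norm \<xi>)\<^sup>2)"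
proof -
  obtain C where C: "\<And>X. 0 \<le> X \<Longrightarrow> real (2 * DIM('a) + 1) * X^3 + real (2 * DIM('a) + 1) * X\<^sup>2 + real (2 * DIM('a) + 1) * X \<le> X^4 + C"
    using quartic_dominates[of "real (2 * DIM('a) + 1)"] by auto
  have "weight \<xi> \<le> exp C * exp (- (norm \<xi>)\<^sup>2)" for \<xi> :: 'a
  proof -
    let ?X = "norm \<xi>"
    have "weight \<xi> \<le> (?X + 1) ^ (2 * DIM('a)) * exp (- (?X ^ 4))"
      unfolding weight_def by (intro mult_right_mono power_mono) auto
    also have "\<dots> \<le> exp (real (2 * DIM('a)) * ?X) * exp (- (?X ^ 4))"
      by (intro mult_right_mono one_plus_power_le_exp) auto
    also have "\<dots> \<le> exp (C - ?X\<^sup>2)"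
    proof -
      have "real (2 * DIM('a)) * ?X \<le> real (2 * DIM('a) + 1) * ?X" by (intro mult_right_mono) auto
      moreover have "1 * ?X\<^sup>2 \<le> real (2 * DIM('a) + 1) * ?X\<^sup>2" by (intro mult_right_mono) auto
      moreover have "0 \<le> real (2 * DIM('a) + 1) * ?X^3" by simp
      ultimately have "real (2 * DIM('a)) * ?X - ?X ^ 4 \<le> C - ?X\<^sup>2" using C[OF norm_ge_zero[of \<xi>]] by linarith
      then show ?thesis by (simp add: exp_add[symmetric])
    qed
    finally show ?thesis by (simp add: exp_add[symmetric])
  qed
  then show thesis by (rule that)
qed

lemma weight_integrable: "integrable lborel (weight :: 'a::euclidean_space \<Rightarrow> real)"
proof -
  obtain C where C: "\<And>\<xi>::'a. weight \<xi> \<le> C * exp (- (norm \<xi>)\<^sup>2)" using weight_bound by blast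
  have "integrable lborel (\<lambda>\<xi>::'a. C * exp (- 1 * (norm \<xi>)\<^sup>2))"
    by (intro integrable_mult_right integrable_gaussian) auto
  then show ?thesis
    by (rule Bochner_Integration.integrable_bound)
       (auto simp: weight_nonneg intro: order_trans[OF C abs_ge_self])
qed

text \<open>For bounded times the contour shift by \<open>\<i> y / \<bar>y\<bar>\<close> turns the phase \<open>y \<bullet> \<xi>\<close> into decay, while
  the quartic exponential absorbs the growth of the propagator.\<close>

lemma kernel_local_decay:
  obtains C where "0 < C" "\<And>a b \<tau> (y::'a::euclidean_space). 0 \<le> a \<Longrightarrow> a \<le> 1 \<Longrightarrow> 0 \<le> b \<Longrightarrow> b \<le> 1 \<Longrightarrow> \<bar>\<tau>\<bar> \<le> 1 \<Longrightarrow>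
    norm (kernel a b \<tau> y) \<le> C * exp (- norm y)"
proof -
  let ?k = "DIM('a)"
  \<comment> \<open>The linear coefficient must cover 2k from the polynomial part of the weight and
    6 from the phase, the quadratic one 6 from the shifted quartic and 1 for the Gaussian left over,
    the cubic one 4 from the phase. The common value 2k + 7 covers all three.\<close>
  obtain C where C: "\<And>X. 0 \<le> X \<Longrightarrow> real (2 * ?k + 7) * X^3 + real (2 * ?k + 7) * X\<^sup>2 + real (2 * ?k + 7) * X \<le> X^4 + C"
    using quartic_dominates[of "real (2 * ?k + 7)"] by auto
  define I where "I = (LINT \<xi>|lborel. exp (- (norm (\<xi>::'a))\<^sup>2))"
  have I: "integrable lborel (\<lambda>\<xi>::'a. exp (- (norm \<xi>)\<^sup>2))"
    using integrable_gaussian[of 1, where 'a='a] by simp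
  have I0: "0 \<le> I" unfolding I_def by (intro integral_nonneg_AE) auto
  have main: "norm (kernel a b \<tau> y) \<le> exp 1 * exp C * I * exp (- norm y)"
    if ab: "0 \<le> a" "a \<le> 1" "0 \<le> b" "b \<le> 1" and \<tau>: "\<bar>\<tau>\<bar> \<le> 1" for a b \<tau> and y :: 'a
  proof -
    obtain \<omega> :: 'a where \<omega>: "norm \<omega> = 1" "y = norm y *\<^sub>R \<omega>"
    proof (cases "y = 0")
      case True
      then show thesis using that[of "SOME b. b \<in> Basis"] SOME_Basis by simp
    next
      case False
      then show thesis using that[of "y /\<^sub>R norm y"] by simp
    qed
    have y\<omega>: "y \<bullet> \<omega> = norm y"
      by (subst \<omega>(2)) (use \<omega>(1) in \<open>simp add: norm_eq_1\<close>)
    \<comment> \<open>The integrand of the kernel with every squared norm replaced by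
      \<open>line_square\<close> and \<open>y \<bullet> \<xi>\<close> by its extension, whose slope
      in \<open>z\<close> is \<open>norm y\<close> because \<open>\<omega>\<close> points along
      \<open>y\<close>.\<close>
    define \<Phi> where "\<Phi> \<xi> z = (line_square \<omega> \<xi> z) ^ ?k * exp (- (line_square \<omega> \<xi> z)\<^sup>2) *
        exp (\<i> * (of_real (y \<bullet> \<xi>) + z * of_real (norm y))) *
        exp (\<i> * of_real \<tau> * (of_real a * (line_square \<omega> \<xi> z)\<^sup>2 + of_real b * line_square \<omega> \<xi> z))" for \<xi> z
    have \<Phi>0: "\<Phi> \<xi> 0 = of_real (weight \<xi>) * cis (y \<bullet> \<xi> + \<tau> * dispersion a b \<xi>)" for \<xi>
      unfolding \<Phi>_def line_square_0 weight_def dispersion_def cis_conv_exp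
      by (simp add: exp_add[symmetric] exp_of_real[symmetric] power_mult[symmetric] algebra_simps)
    have bd: "norm (\<Phi> \<xi> (Complex 0 \<eta>)) \<le> exp C * exp (- \<eta> * norm y) * exp (- (norm \<xi>)\<^sup>2)"
      if \<eta>: "0 \<le> \<eta>" "\<eta> \<le> 1" for \<xi> \<eta>
    proof -
      let ?q = "line_square \<omega> \<xi> (Complex 0 \<eta>)" and ?X = "norm \<xi>"
      have 1: "norm (?q ^ ?k) \<le> exp (real (2 * ?k) * ?X)"
      proof -
        have "norm ?q \<le> (?X + \<eta>)\<^sup>2" by (rule norm_line_square_imag_le[OF \<omega>(1) \<eta>(1)])
        also have "\<dots> \<le> (?X + 1)\<^sup>2" using \<eta> by (intro power_mono) auto
        finally have "norm ?q ^ ?k \<le> ((?X + 1)\<^sup>2) ^ ?k" by (intro power_mono) auto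
        also have "\<dots> \<le> exp (real (2 * ?k) * ?X)"
          unfolding power_mult[symmetric] by (rule one_plus_power_le_exp) simp
        finally show ?thesis by (simp add: norm_power)
      qed
      have 2: "norm (exp (- ?q\<^sup>2)) \<le> exp (6 * ?X\<^sup>2 - ?X^4)"
        using Re_line_square_imag_square_ge[OF \<omega>(1) \<eta>, of \<xi>] by simp
      have 3: "norm (exp (\<i> * (of_real (y \<bullet> \<xi>) + Complex 0 \<eta> * of_real (norm y)))) = exp (- \<eta> * norm y)"
        by simp
      have 4: "norm (exp (\<i> * of_real \<tau> * (of_real a * ?q\<^sup>2 + of_real b * ?q))) \<le> exp (4 * ?X^3 + 6 * ?X)"
      proof -
        have u: "\<bar>\<xi> \<bullet> \<omega>\<bar> \<le> ?X" by (rule abs_inner_unit_le[OF \<omega>(1)])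
        have "\<bar>Im ?q\<bar> = 2 * (\<eta> * \<bar>\<xi> \<bullet> \<omega>\<bar>)" using \<eta> by (simp add: line_square_imag abs_mult)
        also have "\<dots> \<le> 2 * (1 * ?X)" using \<eta> u by (intro mult_left_mono mult_mono) auto
        finally have q1: "\<bar>Im ?q\<bar> \<le> 2 * ?X" by simp
        have "\<bar>Re ?q\<bar> \<le> ?X\<^sup>2 + 1"
          using \<eta> power_le_one[of \<eta> 2] zero_le_power2[of \<eta>] zero_le_power2[of ?X]
          unfolding line_square_imag abs_le_iff by linarith
        then have "\<bar>Im ?q\<bar> * \<bar>Re ?q\<bar> \<le> (2 * ?X) * (?X\<^sup>2 + 1)" using q1 by (intro mult_mono) auto
        moreover have "Im (?q\<^sup>2) = 2 * (Im ?q * Re ?q)" by (simp add: power2_eq_square)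
        ultimately have q2: "\<bar>Im (?q\<^sup>2)\<bar> \<le> 4 * ?X^3 + 4 * ?X"
          by (simp add: abs_mult power2_eq_square power3_eq_cube algebra_simps)
        have "\<bar>\<tau> * (a * Im (?q\<^sup>2) + b * Im ?q)\<bar> \<le> 1 * (1 * \<bar>Im (?q\<^sup>2)\<bar> + 1 * \<bar>Im ?q\<bar>)"
          unfolding abs_mult using ab \<tau>
          by (intro mult_mono order_trans[OF abs_triangle_ineq] add_mono)
             (auto simp: abs_mult intro!: mult_right_mono mult_left_le_one_le)
        then have "\<bar>\<tau> * (a * Im (?q\<^sup>2) + b * Im ?q)\<bar> \<le> (4 * ?X^3 + 4 * ?X) + 2 * ?X"
          unfolding mult_1 by (rule order_trans[OF _ add_mono[OF q2 q1]])
        moreover have "Re (\<i> * of_real \<tau> * (of_real a * ?q\<^sup>2 + of_real b * ?q)) = - (\<tau> * (a * Im (?q\<^sup>2) + b * Im ?q))"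
          by simp
        ultimately have "Re (\<i> * of_real \<tau> * (of_real a * ?q\<^sup>2 + of_real b * ?q)) \<le> 4 * ?X^3 + 6 * ?X"
          by (simp only: abs_le_iff) simp
        then show ?thesis unfolding norm_exp_eq_Re exp_le_cancel_iff .
      qed
      have "norm (\<Phi> \<xi> (Complex 0 \<eta>)) \<le> exp (real (2 * ?k) * ?X) * exp (6 * ?X\<^sup>2 - ?X^4) * exp (- \<eta> * norm y) * exp (4 * ?X^3 + 6 * ?X)"
        unfolding \<Phi>_def norm_mult 3 by (intro mult_mono 1 2 4) auto
      also have "\<dots> = exp (real (2 * ?k) * ?X + 6 * ?X\<^sup>2 - ?X^4 + 4 * ?X^3 + 6 * ?X) * exp (- \<eta> * norm y)"
        by (simp add: exp_add[symmetric] algebra_simps)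
      also have "\<dots> \<le> exp (C - ?X\<^sup>2) * exp (- \<eta> * norm y)"
      proof -
        have "real (2 * ?k) * ?X + 6 * ?X \<le> real (2 * ?k + 7) * ?X" by (simp add: algebra_simps)
        moreover have "7 * ?X\<^sup>2 \<le> real (2 * ?k + 7) * ?X\<^sup>2" by (intro mult_right_mono) auto
        moreover have "4 * ?X^3 \<le> real (2 * ?k + 7) * ?X^3" by (intro mult_right_mono) auto
        ultimately have "real (2 * ?k) * ?X + 6 * ?X\<^sup>2 - ?X^4 + 4 * ?X^3 + 6 * ?X \<le> C - ?X\<^sup>2"
          using C[OF norm_ge_zero[of \<xi>]] by linarith
        then show ?thesis by simp
      qed
      also have "\<dots> = exp C * exp (- \<eta> * norm y) * exp (- ?X\<^sup>2)"
        by (simp add: exp_add[symmetric])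
      finally show ?thesis .
    qed
    have "norm (LINT \<xi>|lborel. \<Phi> \<xi> 0) \<le> exp (1\<^sup>2) * (LINT \<xi>|lborel. exp C * exp (- norm y) * exp (- (norm (\<xi>::'a))\<^sup>2))"
    proof (rule contour_shift_translation[where \<Phi>=\<Phi> and \<omega>=\<omega> and g="\<lambda>\<xi>. exp C * exp (- (norm \<xi>)\<^sup>2)" and B="exp C"])
      show "\<Phi> \<xi> holomorphic_on UNIV" for \<xi>
        unfolding \<Phi>_def by (intro holomorphic_intros line_square_holomorphic)
      show "\<Phi> (\<xi> + s *\<^sub>R \<omega>) z = \<Phi> \<xi> (z + of_real s)" for \<xi> s z
        unfolding \<Phi>_def line_square_translate[OF \<omega>(1)]
        by (simp add: inner_add_right y\<omega> algebra_simps)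
      show "(\<lambda>\<xi>. \<Phi> \<xi> z) \<in> borel_measurable borel" for z
        unfolding \<Phi>_def by measurable
      \<comment> \<open>Intermediate heights only justify the shift, so the decay in
        \<open>y\<close> is given away here; it is kept at the final height 1.\<close>
      show "norm (\<Phi> \<xi> (Complex 0 \<eta>)) \<le> exp C * exp (- (norm \<xi>)\<^sup>2)" if "0 \<le> \<eta>" "\<eta> \<le> 1" for \<xi> \<eta>
      proof -
        have "exp (- \<eta> * norm y) \<le> 1" using that by simp
        then have "exp C * exp (- \<eta> * norm y) * exp (- (norm \<xi>)\<^sup>2) \<le> exp C * 1 * exp (- (norm \<xi>)\<^sup>2)"
          by (intro mult_mono) auto
        then show ?thesis unfolding mult_1_right by (rule order_trans[OF bd[OF that]])
      qed
      show "norm (\<Phi> \<xi> (Complex 0 1)) \<le> exp C * exp (- norm y) * exp (- (norm \<xi>)\<^sup>2)" for \<xi>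
        using bd[of 1 \<xi>] by simp
    qed (use I in auto)
    then show ?thesis unfolding kernel_def \<Phi>0 I_def by (simp add: mult_ac)
  qed
  have "norm (kernel a b \<tau> y) \<le> (exp 1 * exp C * I + 1) * exp (- norm y)"
    if "0 \<le> a" "a \<le> 1" "0 \<le> b" "b \<le> 1" "\<bar>\<tau>\<bar> \<le> 1" for a b \<tau> and y :: 'a
    by (rule order_trans[OF main[OF that]]) (auto intro: mult_right_mono)
  moreover have "0 < exp 1 * exp C * I + 1" using I0 by (simp add: add_nonneg_pos)
  ultimately show thesis using that by blast
qed

text \<open>With u the component of \<open>\<xi>\<close> along \<open>\<omega>\<close>, the quartic
  part contributes \<open>\<eta> * r * 4 * a\<close> times the squared norm plus 2u^2 + 3ur + r^2,
  minus \<open>4 * a * \<eta>^3 * r\<close>. Completing the square bounds 2u^2 + 3ur + r^2 below by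
  -u^2/4, so three quarters of the squared norm survive whatever the sign of u.\<close>

lemma line_square_phase_ge:
  fixes \<omega> \<xi> :: "'a::euclidean_space"
  assumes \<omega>: "norm \<omega> = 1" and \<eta>: "0 \<le> \<eta>" and a: "0 \<le> a" "a \<le> 1" and r: "0 \<le> r"
  defines "q \<equiv> line_square \<omega> \<xi> (Complex 0 \<eta>)" and "q' \<equiv> line_square \<omega> (\<xi> + r *\<^sub>R \<omega>) (Complex 0 \<eta>)"
  shows "\<eta> * r * (3 * a * (norm \<xi>)\<^sup>2 + 2 * b) - 4 * \<eta>^3 * r \<le> Im (of_real a * (q'\<^sup>2 - q\<^sup>2) + of_real b * (q' - q))"
proof -
  let ?X = "(norm \<xi>)\<^sup>2" and ?u = "\<xi> \<bullet> \<omega>"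
  have u2: "?u\<^sup>2 \<le> ?X"
    using abs_inner_unit_le[OF \<omega>, of \<xi>] power_mono[of "\<bar>?u\<bar>" "norm \<xi>" 2] by simp
  have q: "Re q = ?X - \<eta>\<^sup>2" "Im q = 2 * \<eta> * ?u"
    unfolding q_def by (rule line_square_imag)+
  have q': "Re q' = ?X + 2 * r * ?u + r\<^sup>2 - \<eta>\<^sup>2" "Im q' = 2 * \<eta> * (?u + r)"
    unfolding q'_def line_square_imag norm_add_scaleR_unit[OF \<omega>]
    using \<omega> by (simp_all add: inner_add_left norm_eq_1)
  have "Im (of_real a * (q'\<^sup>2 - q\<^sup>2) + of_real b * (q' - q))
      = a * (2 * (Re q' * Im q') - 2 * (Re q * Im q)) + b * (Im q' - Im q)"
    by (simp add: power2_eq_square)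
  also have "\<dots> = \<eta> * r * (4 * a * (?X + 2 * ?u\<^sup>2 + 3 * ?u * r + r\<^sup>2) + 2 * b) - 4 * a * \<eta>^3 * r"
    unfolding q q' by (simp add: algebra_simps power2_eq_square power3_eq_cube)
  also have "\<dots> \<ge> \<eta> * r * (4 * a * (3/4 * ?X) + 2 * b) - 4 * 1 * (\<eta>^3 * r)"
  proof -
    have "2 * ?u\<^sup>2 + 3 * ?u * r + r\<^sup>2 + ?u\<^sup>2 / 4 = (r + 3/2 * ?u)\<^sup>2"
      by (simp add: power2_eq_square algebra_simps)
    then have "2 * ?u\<^sup>2 + 3 * ?u * r + r\<^sup>2 \<ge> - (?u\<^sup>2 / 4)"
      using zero_le_power2[of "r + 3/2 * ?u"] by linarith
    then have "3/4 * ?X \<le> ?X + 2 * ?u\<^sup>2 + 3 * ?u * r + r\<^sup>2" using u2 by linarith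
    then have "\<eta> * r * (4 * a * (3/4 * ?X) + 2 * b) \<le> \<eta> * r * (4 * a * (?X + 2 * ?u\<^sup>2 + 3 * ?u * r + r\<^sup>2) + 2 * b)"
      using \<eta> r a by (intro mult_left_mono add_mono order_refl) auto
    moreover have "a * (\<eta>^3 * r) \<le> 1 * (\<eta>^3 * r)"
      using \<eta> r a by (intro mult_right_mono) auto
    ultimately show ?thesis by (simp only: mult.assoc)
  qed
  finally show ?thesis by (simp add: mult_ac)
qed

lemma power_mult_exp_neg_le_fact: "0 \<le> t \<Longrightarrow> t ^ k * exp (- t) \<le> fact k" for t :: real
proof -
  assume t: "0 \<le> t"
  have "(\<Sum>n\<in>{k}. t ^ n /\<^sub>R fact n) \<le> (\<Sum>n. t ^ n /\<^sub>R fact n)"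
    using summable_exp_generic[of t] t by (intro sum_le_suminf) auto
  then have "t ^ k / fact k \<le> exp t"
    unfolding exp_def by (simp add: divide_inverse mult.commute)
  then show ?thesis by (simp add: exp_minus field_simps)
qed

text \<open>If \<open>a = 1\<close>, write X = cY: the Gaussian in Y absorbs the power of Y + 1 by
  completing the square, at the cost \<open>exp (k\<^sup>2)\<close>. If \<open>b = 1\<close>, the
  factor \<open>exp (- 1 / c\<^sup>2)\<close> is itself at most \<open>fact k * c ^ (2 * k)\<close>.
  The growing exponential on the right is harmless against the quartic decay of the weight.\<close>

lemma gaussian_scaled_bound:
  fixes k :: nat
  obtains C where "\<And>X c a b. 0 \<le> X \<Longrightarrow> 0 < c \<Longrightarrow> c \<le> 1 \<Longrightarrow> 0 \<le> a \<Longrightarrow> 0 \<le> b \<Longrightarrow> a = 1 \<or> b = 1 \<Longrightarrow>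
    (X + c) ^ (2 * k) * exp (- ((3 * a * X\<^sup>2 + 2 * b) / c\<^sup>2)) \<le> C * c ^ (2 * k) * exp (real (2 * k) * X)"
proof -
  have "(X + c) ^ (2 * k) * exp (- ((3 * a * X\<^sup>2 + 2 * b) / c\<^sup>2)) \<le> (exp ((real k)\<^sup>2) + fact k) * c ^ (2 * k) * exp (real (2 * k) * X)"
    if X: "0 \<le> X" and c: "0 < c" "c \<le> 1" and ab: "0 \<le> a" "0 \<le> b" "a = 1 \<or> b = 1" for X c a b :: real
    using ab(3)
  proof
    assume a: "a = 1"
    let ?Y = "X / c"
    have Y: "0 \<le> ?Y" using X c by simp
    have "(X + c) ^ (2 * k) = c ^ (2 * k) * (?Y + 1) ^ (2 * k)"
      unfolding power_mult_distrib[symmetric] using c by (simp add: distrib_left)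
    also have "\<dots> \<le> c ^ (2 * k) * exp (real (2 * k) * ?Y)"
      using c by (intro mult_left_mono one_plus_power_le_exp Y) auto
    finally have 1: "(X + c) ^ (2 * k) \<le> c ^ (2 * k) * exp (real (2 * k) * ?Y)" .
    have "0 \<le> b / c\<^sup>2" using ab by simp
    then have 2: "exp (- ((3 * a * X\<^sup>2 + 2 * b) / c\<^sup>2)) \<le> exp (- (?Y\<^sup>2))"
    proof -
      have "(3 * a * X\<^sup>2 + 2 * b) / c\<^sup>2 = 3 * ?Y\<^sup>2 + 2 * (b / c\<^sup>2)"
        using a by (simp add: power_divide add_divide_distrib)
      then show ?thesis using \<open>0 \<le> b / c\<^sup>2\<close> zero_le_power2[of ?Y] unfolding exp_le_cancel_iff by linarith
    qed
    have 3: "real (2 * k) * ?Y - ?Y\<^sup>2 \<le> (real k)\<^sup>2"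
      using zero_le_power2[of "?Y - real k"] by (simp add: power2_diff mult_ac)
    have "(X + c) ^ (2 * k) * exp (- ((3 * a * X\<^sup>2 + 2 * b) / c\<^sup>2)) \<le> (c ^ (2 * k) * exp (real (2 * k) * ?Y)) * exp (- (?Y\<^sup>2))"
      using c X by (intro mult_mono 1 2) auto
    also have "\<dots> = c ^ (2 * k) * exp (real (2 * k) * ?Y - ?Y\<^sup>2)"
      by (simp add: exp_diff exp_minus divide_inverse)
    also have "\<dots> \<le> c ^ (2 * k) * (exp ((real k)\<^sup>2) + fact k)"
      using 3 c by (intro mult_left_mono) (auto intro: order_trans[of _ "exp ((real k)\<^sup>2)"])
    also have "\<dots> = c ^ (2 * k) * (exp ((real k)\<^sup>2) + fact k) * 1" by simp
    also have "\<dots> \<le> c ^ (2 * k) * (exp ((real k)\<^sup>2) + fact k) * exp (real (2 * k) * X)"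
      using X c by (intro mult_left_mono mult_nonneg_nonneg add_nonneg_nonneg) auto
    finally show ?thesis by (simp add: mult_ac)
  next
    assume b: "b = 1"
    let ?t = "1 / c\<^sup>2"
    have t: "0 \<le> ?t" by simp
    have "(X + c) ^ (2 * k) \<le> (X + 1) ^ (2 * k)" using X c by (intro power_mono) auto
    also have "\<dots> \<le> exp (real (2 * k) * X)" by (rule one_plus_power_le_exp[OF X])
    finally have 1: "(X + c) ^ (2 * k) \<le> exp (real (2 * k) * X)" .
    have "0 \<le> a * X\<^sup>2 / c\<^sup>2" using ab by simp
    then have "exp (- ((3 * a * X\<^sup>2 + 2 * b) / c\<^sup>2)) \<le> exp (- ?t)"
    proof -
      have "(3 * a * X\<^sup>2 + 2 * b) / c\<^sup>2 = 3 * (a * X\<^sup>2 / c\<^sup>2) + 2 * ?t"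
        using b by (simp add: add_divide_distrib mult.assoc)
      then show ?thesis using \<open>0 \<le> a * X\<^sup>2 / c\<^sup>2\<close> t unfolding exp_le_cancel_iff by linarith
    qed
    also have "exp (- ?t) \<le> fact k * c ^ (2 * k)"
      using power_mult_exp_neg_le_fact[OF t, of k] c
      by (simp add: power_divide power_mult[symmetric] field_simps)
    also have "\<dots> \<le> (exp ((real k)\<^sup>2) + fact k) * c ^ (2 * k)"
      using c by (intro mult_right_mono) auto
    finally have 2: "exp (- ((3 * a * X\<^sup>2 + 2 * b) / c\<^sup>2)) \<le> (exp ((real k)\<^sup>2) + fact k) * c ^ (2 * k)" .
    have "(X + c) ^ (2 * k) * exp (- ((3 * a * X\<^sup>2 + 2 * b) / c\<^sup>2)) \<le> exp (real (2 * k) * X) * ((exp ((real k)\<^sup>2) + fact k) * c ^ (2 * k))"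
      using c X by (intro mult_mono 1 2) auto
    then show ?thesis by (simp add: mult_ac)
  qed
  then show thesis by (rule that)
qed

text \<open>A shift by \<open>\<i> c h / \<bar>h\<bar>\<close> makes the differenced phase decay like \<open>exp (- \<tau> c \<bar>h\<bar> \<bar>\<xi>\<bar>\<^sup>2)\<close> up to an error
  \<open>exp (\<tau> c\<^sup>3 \<bar>h\<bar>)\<close>, which the choice \<open>c\<^sup>3 = 1 / (\<tau> \<bar>h\<bar>)\<close> keeps bounded; the zero of the weight at the
  origin then gains a power of \<open>c\<close>.\<close>

lemma kernel_autocorrelation_bound:
  obtains C where "0 \<le> C" "\<And>a b \<tau> c (h::'a::euclidean_space). 0 \<le> a \<Longrightarrow> a \<le> 1 \<Longrightarrow> 0 \<le> b \<Longrightarrow> a = 1 \<or> b = 1 \<Longrightarrow>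
    0 < \<tau> \<Longrightarrow> h \<noteq> 0 \<Longrightarrow> 0 < c \<Longrightarrow> c \<le> 1 \<Longrightarrow> c^3 * (\<tau> * norm h) \<le> 1 \<Longrightarrow> c = 1 \<or> c^3 * (\<tau> * norm h) = 1 \<Longrightarrow>
    norm (LINT \<xi>|lborel. of_real (weight (\<xi> + h) * weight \<xi>) * cis (\<tau> * (dispersion a b (\<xi> + h) - dispersion a b \<xi>)))
      \<le> C * c ^ (2 * DIM('a)) * exp (- (norm h)\<^sup>2 / 4)"
proof -
  let ?k = "DIM('a)"
  obtain C1 where C1: "\<And>X c a b. 0 \<le> X \<Longrightarrow> 0 < c \<Longrightarrow> c \<le> 1 \<Longrightarrow> 0 \<le> a \<Longrightarrow> 0 \<le> b \<Longrightarrow> a = 1 \<or> b = 1 \<Longrightarrow>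
    (X + c) ^ (2 * ?k) * exp (- ((3 * a * X\<^sup>2 + 2 * b) / c\<^sup>2)) \<le> C1 * c ^ (2 * ?k) * exp (real (2 * ?k) * X)"
    using gaussian_scaled_bound[of ?k] by blast
  obtain C2 where C2: "\<And>X. 0 \<le> X \<Longrightarrow> real (2 * ?k + 7) * X^3 + real (2 * ?k + 7) * X\<^sup>2 + real (2 * ?k + 7) * X \<le> X^4 + C2"
    using quartic_dominates[of "real (2 * ?k + 7)"] by auto
  have C2': "exp (real (2 * ?k) * X) * exp (6 * X\<^sup>2 - X^4) \<le> exp C2 * exp (- X\<^sup>2)" if "0 \<le> X" for X
  proof -
    have "real (2 * ?k) * X \<le> real (2 * ?k + 7) * X" using that by (intro mult_right_mono) auto
    moreover have "7 * X\<^sup>2 \<le> real (2 * ?k + 7) * X\<^sup>2" by (intro mult_right_mono) auto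
    moreover have "0 \<le> real (2 * ?k + 7) * X^3" using that by simp
    ultimately have "real (2 * ?k) * X + (6 * X\<^sup>2 - X^4) \<le> C2 + - X\<^sup>2"
      using C2[OF that] by linarith
    then show ?thesis unfolding exp_add[symmetric] by simp
  qed
  define I where "I = (LINT \<xi>|lborel. exp (- 1/2 * (norm (\<xi>::'a))\<^sup>2))"
  have Iint: "integrable lborel (\<lambda>\<xi>::'a. exp (- 1/2 * (norm \<xi>)\<^sup>2))"
    using integrable_gaussian[of "1/2", where 'a='a] by simp
  have I0: "0 \<le> I" unfolding I_def by (intro integral_nonneg_AE) auto
  have C10: "0 \<le> C1" using C1[of 0 1 1 1] by (simp add: zero_le_mult_iff) (smt (verit) exp_gt_zero)
  \<comment> \<open>\<open>exp 4\<close> bounds the cubic error of the phase, which is at most 4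
    because \<open>\<eta>^3 * (\<tau> * norm h) \<le> 1\<close>; \<open>C1 + 1\<close> serves both
    alternatives for \<open>c\<close>; each of the two weights contributes one factor
    \<open>exp C2\<close>.\<close>
  define C3 where "C3 = exp 4 * (C1 + 1) * (exp C2)\<^sup>2"
  have C30: "0 \<le> C3" using C10 by (simp add: C3_def)
  have main: "norm (LINT \<xi>|lborel. of_real (weight (\<xi> + h) * weight \<xi>) * cis (\<tau> * (dispersion a b (\<xi> + h) - dispersion a b \<xi>)))
      \<le> exp 1 * C3 * I * c ^ (2 * DIM('a)) * exp (- (norm h)\<^sup>2 / 4)"
    if ab: "0 \<le> a" "a \<le> 1" "0 \<le> b" "a = 1 \<or> b = 1" and \<tau>: "0 < \<tau>" and h: "h \<noteq> 0"
      and c: "0 < c" "c \<le> 1" "c^3 * (\<tau> * norm h) \<le> 1" "c = 1 \<or> c^3 * (\<tau> * norm h) = 1" for a b \<tau> c and h :: 'a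
  proof -
    define \<omega> where "\<omega> = h /\<^sub>R norm h"
    have \<omega>: "norm \<omega> = 1" using h by (simp add: \<omega>_def)
    have h\<omega>: "h = norm h *\<^sub>R \<omega>" using h by (simp add: \<omega>_def)
    let ?q = "\<lambda>\<xi> z. line_square \<omega> \<xi> z" and ?q' = "\<lambda>\<xi> z. line_square \<omega> (\<xi> + h) z"
    define \<Phi> where "\<Phi> \<xi> z = (?q \<xi> z) ^ ?k * (?q' \<xi> z) ^ ?k * exp (- (?q \<xi> z)\<^sup>2) * exp (- (?q' \<xi> z)\<^sup>2) *
        exp (\<i> * of_real \<tau> * (of_real a * ((?q' \<xi> z)\<^sup>2 - (?q \<xi> z)\<^sup>2) + of_real b * (?q' \<xi> z - ?q \<xi> z)))" for \<xi> z
    have \<Phi>0: "\<Phi> \<xi> 0 = of_real (weight (\<xi> + h) * weight \<xi>) * cis (\<tau> * (dispersion a b (\<xi> + h) - dispersion a b \<xi>))" for \<xi>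
      unfolding \<Phi>_def line_square_0 weight_def dispersion_def cis_conv_exp
      by (simp add: exp_of_real[symmetric] power_mult[symmetric] algebra_simps)
    \<comment> \<open>The triangle inequality trades part of the two Gaussians for decay in
      \<open>h\<close>, which makes the autocorrelation integrable at infinity, and leaves half a
      Gaussian for the integral over \<open>\<xi>\<close>.\<close>
    have gauss: "exp (- (norm \<xi>)\<^sup>2) * exp (- (norm (\<xi> + h))\<^sup>2) \<le> exp (- 1/2 * (norm \<xi>)\<^sup>2) * exp (- (norm h)\<^sup>2 / 4)" for \<xi>
    proof -
      have "norm h \<le> norm (\<xi> + h) + norm \<xi>" using norm_triangle_ineq4[of "\<xi> + h" \<xi>] by simp
      then have "(norm h)\<^sup>2 \<le> (norm (\<xi> + h) + norm \<xi>)\<^sup>2" by (intro power_mono) auto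
      also have "\<dots> \<le> 2 * (norm (\<xi> + h))\<^sup>2 + 2 * (norm \<xi>)\<^sup>2"
        using zero_le_power2[of "norm (\<xi> + h) - norm \<xi>"] by (simp add: power2_diff power2_sum)
      finally have "- (norm \<xi>)\<^sup>2 + - (norm (\<xi> + h))\<^sup>2 \<le> - 1/2 * (norm \<xi>)\<^sup>2 + - (norm h)\<^sup>2 / 4"
        using zero_le_power2[of "norm (\<xi> + h)"] by linarith
      then show ?thesis unfolding exp_add[symmetric] by simp
    qed
    have bd: "norm (\<Phi> \<xi> (Complex 0 \<eta>)) \<le> (norm \<xi> + \<eta>) ^ (2 * ?k) * exp (- (\<tau> * (\<eta> * norm h * (3 * a * (norm \<xi>)\<^sup>2 + 2 * b)))) *
        (exp 4 * exp C2 * exp (- (norm (\<xi> + h))\<^sup>2) * exp (6 * (norm \<xi>)\<^sup>2 - (norm \<xi>)^4))"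
      if \<eta>: "0 \<le> \<eta>" "\<eta> \<le> c" for \<xi> \<eta>
    proof -
      have \<eta>1: "\<eta> \<le> 1" using \<eta> c by simp
      let ?z = "Complex 0 \<eta>" and ?X = "norm \<xi>" and ?X' = "norm (\<xi> + h)"
      have 1: "norm (?q \<xi> ?z) ^ ?k \<le> (?X + \<eta>) ^ (2 * ?k)"
        unfolding power_mult by (intro power_mono norm_line_square_imag_le \<omega> \<eta>) auto
      have "norm (?q' \<xi> ?z) ^ ?k \<le> (?X' + \<eta>) ^ (2 * ?k)"
        unfolding power_mult by (intro power_mono norm_line_square_imag_le \<omega> \<eta>) auto
      also have "\<dots> \<le> (?X' + 1) ^ (2 * ?k)" using \<eta> \<eta>1 by (intro power_mono) auto
      also have "\<dots> \<le> exp (real (2 * ?k) * ?X')" by (rule one_plus_power_le_exp) simp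
      finally have 2: "norm (?q' \<xi> ?z) ^ ?k \<le> exp (real (2 * ?k) * ?X')" .
      have 3: "norm (exp (- (?q \<xi> ?z)\<^sup>2)) \<le> exp (6 * ?X\<^sup>2 - ?X^4)"
        using Re_line_square_imag_square_ge[OF \<omega> \<eta>(1) \<eta>1, of \<xi>] by simp
      have 4: "norm (exp (- (?q' \<xi> ?z)\<^sup>2)) \<le> exp (6 * ?X'\<^sup>2 - ?X'^4)"
        using Re_line_square_imag_square_ge[OF \<omega> \<eta>(1) \<eta>1, of "\<xi> + h"] by simp
      have 5: "norm (exp (\<i> * of_real \<tau> * (of_real a * ((?q' \<xi> ?z)\<^sup>2 - (?q \<xi> ?z)\<^sup>2) + of_real b * (?q' \<xi> ?z - ?q \<xi> ?z))))
          \<le> exp (- (\<tau> * (\<eta> * norm h * (3 * a * ?X\<^sup>2 + 2 * b)))) * exp 4"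
      proof -
        let ?W = "of_real a * ((?q' \<xi> ?z)\<^sup>2 - (?q \<xi> ?z)\<^sup>2) + of_real b * (?q' \<xi> ?z - ?q \<xi> ?z)"
        have "\<eta> * norm h * (3 * a * ?X\<^sup>2 + 2 * b) - 4 * \<eta>^3 * norm h \<le> Im ?W"
          using line_square_phase_ge[OF \<omega> \<eta>(1) ab(1,2) norm_ge_zero[of h], of \<xi> b] unfolding h\<omega>[symmetric] .
        then have "\<tau> * (\<eta> * norm h * (3 * a * ?X\<^sup>2 + 2 * b) - 4 * \<eta>^3 * norm h) \<le> \<tau> * Im ?W"
          using \<tau> by (intro mult_left_mono) auto
        moreover have "\<eta>^3 * (\<tau> * norm h) \<le> 1"
          by (rule order_trans[OF mult_right_mono[OF power_mono[OF \<eta>(2,1)]] c(3)]) (use \<tau> in auto)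
        ultimately have "- (\<tau> * Im ?W) \<le> - (\<tau> * (\<eta> * norm h * (3 * a * ?X\<^sup>2 + 2 * b))) + 4"
          by (simp add: right_diff_distrib mult_ac)
        moreover have "Re (\<i> * of_real \<tau> * ?W) = - (\<tau> * Im ?W)"
          by (simp del: minus_complex.sel plus_complex.sel)
        ultimately show ?thesis unfolding norm_exp_eq_Re exp_add[symmetric] by (simp del: times_complex.sel)
      qed
      have "norm (\<Phi> \<xi> ?z) \<le> (?X + \<eta>) ^ (2 * ?k) * exp (real (2 * ?k) * ?X') * exp (6 * ?X\<^sup>2 - ?X^4) * exp (6 * ?X'\<^sup>2 - ?X'^4) *
          (exp (- (\<tau> * (\<eta> * norm h * (3 * a * ?X\<^sup>2 + 2 * b)))) * exp 4)"
        unfolding \<Phi>_def norm_mult norm_power using \<eta> by (intro mult_mono 1 2 3 4 5) auto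
      also have "\<dots> = (?X + \<eta>) ^ (2 * ?k) * exp (- (\<tau> * (\<eta> * norm h * (3 * a * ?X\<^sup>2 + 2 * b)))) *
          (exp 4 * (exp (real (2 * ?k) * ?X') * exp (6 * ?X'\<^sup>2 - ?X'^4)) * exp (6 * ?X\<^sup>2 - ?X^4))"
        by (simp only: mult_ac)
      also have "\<dots> \<le> (?X + \<eta>) ^ (2 * ?k) * exp (- (\<tau> * (\<eta> * norm h * (3 * a * ?X\<^sup>2 + 2 * b)))) *
          (exp 4 * (exp C2 * exp (- ?X'\<^sup>2)) * exp (6 * ?X\<^sup>2 - ?X^4))"
        using \<eta> by (intro mult_left_mono mult_right_mono C2') auto
      finally show ?thesis by (simp only: mult_ac)
    qed
    have "norm (LINT \<xi>|lborel. \<Phi> \<xi> 0) \<le> exp (c\<^sup>2) * (LINT \<xi>|lborel. (C3 * c ^ (2 * ?k) * exp (- (norm h)\<^sup>2 / 4)) * exp (- 1/2 * (norm (\<xi>::'a))\<^sup>2))"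
    proof (rule contour_shift_translation[where \<Phi>=\<Phi> and \<omega>=\<omega> and g="\<lambda>\<xi>. exp 4 * (exp C2)\<^sup>2 * exp (- 1/2 * (norm \<xi>)\<^sup>2)" and B="exp 4 * (exp C2)\<^sup>2"])
      show "\<Phi> \<xi> holomorphic_on UNIV" for \<xi>
        unfolding \<Phi>_def by (intro holomorphic_intros line_square_holomorphic)
      show "\<Phi> (\<xi> + s *\<^sub>R \<omega>) z = \<Phi> \<xi> (z + of_real s)" for \<xi> s z
      proof -
        have "\<xi> + s *\<^sub>R \<omega> + h = (\<xi> + h) + s *\<^sub>R \<omega>" by simp
        then show ?thesis unfolding \<Phi>_def by (simp only: line_square_translate[OF \<omega>])
      qed
      show "(\<lambda>\<xi>. \<Phi> \<xi> z) \<in> borel_measurable borel" for z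
        unfolding \<Phi>_def by measurable
      show "0 \<le> c" using c by simp
      show "norm (\<Phi> \<xi> (Complex 0 \<eta>)) \<le> exp 4 * (exp C2)\<^sup>2 * exp (- 1/2 * (norm \<xi>)\<^sup>2)" if \<eta>: "0 \<le> \<eta>" "\<eta> \<le> c" for \<xi> \<eta>
      proof -
        let ?X = "norm \<xi>" and ?X' = "norm (\<xi> + h)"
        have "(?X + \<eta>) ^ (2 * ?k) \<le> (?X + 1) ^ (2 * ?k)" using \<eta> c by (intro power_mono) auto
        also have "\<dots> \<le> exp (real (2 * ?k) * ?X)" by (rule one_plus_power_le_exp) simp
        finally have 1: "(?X + \<eta>) ^ (2 * ?k) \<le> exp (real (2 * ?k) * ?X)" .
        have 2: "exp (- (\<tau> * (\<eta> * norm h * (3 * a * ?X\<^sup>2 + 2 * b)))) \<le> 1" using ab \<tau> \<eta> by simp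
        have "norm (\<Phi> \<xi> (Complex 0 \<eta>)) \<le> exp (real (2 * ?k) * ?X) * 1 * (exp 4 * exp C2 * exp (- ?X'\<^sup>2) * exp (6 * ?X\<^sup>2 - ?X^4))"
          using \<eta> by (intro order_trans[OF bd[OF \<eta>]] mult_mono 1 2) auto
        also have "\<dots> = exp 4 * exp C2 * exp (- ?X'\<^sup>2) * (exp (real (2 * ?k) * ?X) * exp (6 * ?X\<^sup>2 - ?X^4))"
          by (simp only: mult_ac mult_1)
        also have "\<dots> \<le> exp 4 * exp C2 * exp (- ?X'\<^sup>2) * (exp C2 * exp (- ?X\<^sup>2))"
          by (intro mult_left_mono C2') auto
        also have "\<dots> = exp 4 * (exp C2)\<^sup>2 * (exp (- ?X\<^sup>2) * exp (- ?X'\<^sup>2))"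
          by (simp only: mult_ac power2_eq_square)
        also have "\<dots> \<le> exp 4 * (exp C2)\<^sup>2 * (exp (- 1/2 * ?X\<^sup>2) * 1)"
        proof (intro mult_left_mono order_trans[OF gauss])
          show "exp (- (norm h)\<^sup>2 / 4) \<le> 1" by simp
        qed auto
        finally show ?thesis by simp
      qed
      show "integrable lborel (\<lambda>\<xi>::'a. exp 4 * (exp C2)\<^sup>2 * exp (- 1/2 * (norm \<xi>)\<^sup>2))"
        by (intro integrable_mult_right Iint)
      show "exp 4 * (exp C2)\<^sup>2 * exp (- 1/2 * (norm \<xi>)\<^sup>2) \<le> exp 4 * (exp C2)\<^sup>2" for \<xi> :: 'a
        by simp
      show "integrable lborel (\<lambda>\<xi>::'a. (C3 * c ^ (2 * ?k) * exp (- (norm h)\<^sup>2 / 4)) * exp (- 1/2 * (norm \<xi>)\<^sup>2))"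
        by (intro integrable_mult_right Iint)
      show "norm (\<Phi> \<xi> (Complex 0 c)) \<le> (C3 * c ^ (2 * ?k) * exp (- (norm h)\<^sup>2 / 4)) * exp (- 1/2 * (norm \<xi>)\<^sup>2)" for \<xi>
      proof -
        let ?X = "norm \<xi>" and ?X' = "norm (\<xi> + h)"
        \<comment> \<open>For \<open>c = 1\<close> the power of \<open>c\<close> is trivial and the
          decay is given away. Otherwise \<open>\<tau> * c * norm h = 1 / c\<^sup>2\<close>, exactly
          the scale at which \<open>gaussian_scaled_bound\<close> converts the zero of the weight
          into \<open>c ^ (2 * ?k)\<close>.\<close>
        have 1: "(?X + c) ^ (2 * ?k) * exp (- (\<tau> * (c * norm h * (3 * a * ?X\<^sup>2 + 2 * b)))) \<le> (C1 + 1) * c ^ (2 * ?k) * exp (real (2 * ?k) * ?X)"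
          using c(4)
        proof
          assume c1: "c = 1"
          have "(?X + c) ^ (2 * ?k) \<le> exp (real (2 * ?k) * ?X)" unfolding c1 by (rule one_plus_power_le_exp) simp
          then have "(?X + c) ^ (2 * ?k) * exp (- (\<tau> * (c * norm h * (3 * a * ?X\<^sup>2 + 2 * b)))) \<le> exp (real (2 * ?k) * ?X) * 1"
            using ab \<tau> c by (intro mult_mono) auto
          also have "\<dots> \<le> (C1 + 1) * c ^ (2 * ?k) * exp (real (2 * ?k) * ?X)"
            unfolding c1 using C10 by simp
          finally show ?thesis .
        next
          assume c2: "c^3 * (\<tau> * norm h) = 1"
          have "\<tau> * (c * norm h) = 1 / c\<^sup>2"
            using c2 c by (simp add: field_simps power2_eq_square power3_eq_cube)
          then have "\<tau> * (c * norm h * (3 * a * ?X\<^sup>2 + 2 * b)) = (3 * a * ?X\<^sup>2 + 2 * b) / c\<^sup>2"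
            unfolding mult.assoc[symmetric] by simp
          then have "(?X + c) ^ (2 * ?k) * exp (- (\<tau> * (c * norm h * (3 * a * ?X\<^sup>2 + 2 * b)))) \<le> C1 * c ^ (2 * ?k) * exp (real (2 * ?k) * ?X)"
            using C1[OF norm_ge_zero[of \<xi>] c(1,2) ab(1,3,4)] by simp
          also have "\<dots> \<le> (C1 + 1) * c ^ (2 * ?k) * exp (real (2 * ?k) * ?X)"
            using c by (intro mult_right_mono) auto
          finally show ?thesis .
        qed
        have "norm (\<Phi> \<xi> (Complex 0 c)) \<le> ((C1 + 1) * c ^ (2 * ?k) * exp (real (2 * ?k) * ?X)) * (exp 4 * exp C2 * exp (- ?X'\<^sup>2) * exp (6 * ?X\<^sup>2 - ?X^4))"
          using c by (intro order_trans[OF bd] mult_right_mono 1) auto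
        also have "\<dots> = (C1 + 1) * c ^ (2 * ?k) * exp 4 * exp C2 * exp (- ?X'\<^sup>2) * (exp (real (2 * ?k) * ?X) * exp (6 * ?X\<^sup>2 - ?X^4))"
          by (simp only: mult_ac)
        also have "\<dots> \<le> (C1 + 1) * c ^ (2 * ?k) * exp 4 * exp C2 * exp (- ?X'\<^sup>2) * (exp C2 * exp (- ?X\<^sup>2))"
          using c C10 by (intro mult_left_mono C2') auto
        also have "\<dots> = C3 * c ^ (2 * ?k) * (exp (- ?X\<^sup>2) * exp (- ?X'\<^sup>2))"
          unfolding C3_def by (simp only: mult_ac power2_eq_square)
        also have "\<dots> \<le> C3 * c ^ (2 * ?k) * (exp (- 1/2 * ?X\<^sup>2) * exp (- (norm h)\<^sup>2 / 4))"
          using C30 c by (intro mult_left_mono gauss) auto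
        finally show ?thesis by (simp only: mult_ac)
      qed
    qed
    also have "\<dots> = exp (c\<^sup>2) * C3 * I * c ^ (2 * ?k) * exp (- (norm h)\<^sup>2 / 4)"
      unfolding I_def by (simp only: integral_mult_right_zero mult_ac)
    also have "\<dots> \<le> exp 1 * C3 * I * c ^ (2 * ?k) * exp (- (norm h)\<^sup>2 / 4)"
      using c C30 I0 by (intro mult_right_mono) (auto simp: power_le_one)
    finally show ?thesis unfolding \<Phi>0 .
  qed
  show thesis by (rule that[OF _ main]) (use C30 I0 in auto)
qed

text \<open>The singularity is integrable because 2/3 < 1, and the Gaussian takes care of infinity.
  The exponent is the share of one coordinate in the singularity of order 2n/3 of the
  autocorrelation bound.\<close>

lemma nn_integral_inverse_power_gaussian_finite:
  "(\<integral>\<^sup>+(x::real). ennreal (\<bar>x\<bar> powr (- 2/3) * exp (- x\<^sup>2 / 4)) \<partial>lborel) < \<infinity>"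
proof -
  let ?f = "\<lambda>x::real. indicator {0..1} x * ennreal (x powr (- 2/3))"
  have 1: "(\<integral>\<^sup>+x. ?f x \<partial>lborel) < \<infinity>"
  proof -
    have "((\<lambda>x::real. x powr (- 2/3)) has_integral (1 powr (- 2/3 + 1) / (- 2/3 + 1))) {0..1}"
      by (rule has_integral_powr_from_0) auto
    then have "((\<lambda>x::real. if x \<in> {0..1} then x powr (- 2/3) else 0) has_integral (1 powr (- 2/3 + 1) / (- 2/3 + 1))) UNIV"
      by (simp only: has_integral_restrict_UNIV)
    then have "(\<integral>\<^sup>+x. ennreal (if x \<in> {0..1} then x powr (- 2/3) else 0) \<partial>lborel) = ennreal (1 powr (- 2/3 + 1) / (- 2/3 + 1))"
      by (rule nn_integral_has_integral_lborel[rotated 2]) auto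
    moreover have "(\<integral>\<^sup>+x. ennreal (if x \<in> {0..1} then x powr (- 2/3) else 0) \<partial>lborel) = (\<integral>\<^sup>+x. ?f x \<partial>lborel)"
      by (intro nn_integral_cong) (auto simp: indicator_def)
    ultimately show ?thesis by simp
  qed
  have 2: "(\<integral>\<^sup>+x. ?f (- x) \<partial>lborel) = (\<integral>\<^sup>+x. ?f x \<partial>lborel)"
    using nn_integral_real_affine[of ?f "-1" 0] by simp
  have 3: "(\<integral>\<^sup>+(x::real). ennreal (exp (- x\<^sup>2 / 4)) \<partial>lborel) < \<infinity>"
    using integrable_gaussian[of "1/4", where 'a=real] unfolding integrable_iff_bounded by simp
  have "(\<integral>\<^sup>+(x::real). ennreal (\<bar>x\<bar> powr (- 2/3) * exp (- x\<^sup>2 / 4)) \<partial>lborel)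
      \<le> (\<integral>\<^sup>+x. (?f x + ?f (- x)) + ennreal (exp (- x\<^sup>2 / 4)) \<partial>lborel)"
  proof (intro nn_integral_mono)
    fix x :: real
    consider "0 \<le> x" "x \<le> 1" | "-1 \<le> x" "x \<le> 0" | "\<bar>x\<bar> > 1" by linarith
    then show "ennreal (\<bar>x\<bar> powr (- 2/3) * exp (- x\<^sup>2 / 4)) \<le> (?f x + ?f (- x)) + ennreal (exp (- x\<^sup>2 / 4))"
    proof cases
      case 1
      then have "ennreal (\<bar>x\<bar> powr (- 2/3) * exp (- x\<^sup>2 / 4)) \<le> ?f x"
        by (auto intro!: ennreal_leI mult_left_le)
      then show ?thesis by (rule order_trans) (simp add: add.assoc)
    next
      case 2
      then have "ennreal (\<bar>x\<bar> powr (- 2/3) * exp (- x\<^sup>2 / 4)) \<le> ?f (- x)"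
        by (auto intro!: ennreal_leI mult_left_le)
      also have "\<dots> \<le> ?f x + ?f (- x)" by simp
      also have "\<dots> \<le> (?f x + ?f (- x)) + ennreal (exp (- x\<^sup>2 / 4))" by simp
      finally show ?thesis .
    next
      case 3
      then have "\<bar>x\<bar> powr (- 2/3) \<le> 1 powr (- 2/3)" by (intro powr_mono2') auto
      then have "ennreal (\<bar>x\<bar> powr (- 2/3) * exp (- x\<^sup>2 / 4)) \<le> ennreal (exp (- x\<^sup>2 / 4))"
        by (intro ennreal_leI mult_left_le_one_le) auto
      then show ?thesis by (rule order_trans) simp
    qed
  qed
  also have "\<dots> = ((\<integral>\<^sup>+x. ?f x \<partial>lborel) + (\<integral>\<^sup>+x. ?f (- x) \<partial>lborel)) + (\<integral>\<^sup>+(x::real). ennreal (exp (- x\<^sup>2 / 4)) \<partial>lborel)"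
    by (subst nn_integral_add, measurable, subst nn_integral_add, measurable)
  also have "\<dots> < \<infinity>" unfolding 2 using 1 3 by simp
  finally show ?thesis .
qed

lemma AE_lborel_inner_Basis_nonzero:
  "AE x in lborel. \<forall>b\<in>Basis. (x::'a::euclidean_space) \<bullet> b \<noteq> 0"
proof (rule AE_finite_allI)
  fix b :: 'a assume "b \<in> Basis"
  then have "b \<noteq> 0" by auto
  then have "negligible {x. b \<bullet> x = 0}" by (intro negligible_hyperplane) auto
  moreover have "{x. b \<bullet> x = 0} \<in> sets lborel" by measurable
  ultimately have "{x. b \<bullet> x = 0} \<in> null_sets lborel"
    by (simp add: negligible_iff_null_sets null_sets_completion_iff)
  then show "AE x in lborel. x \<bullet> b \<noteq> 0"
    by (rule AE_I') (auto simp: inner_commute)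
qed simp

text \<open>Every coordinate is at most the norm in modulus, so the negative power of the norm is at
  most the product over the coordinates of \<open>\<bar>h \<bullet> b\<bar> powr (- 2/3)\<close>,
  off the coordinate hyperplanes. With the factorised Gaussian only one-dimensional integrals remain
  and no polar coordinates enter.\<close>

lemma nn_integral_norm_inverse_power_gaussian_finite:
  "(\<integral>\<^sup>+(h::'a::euclidean_space). ennreal (norm h powr (- 2/3 * DIM('a)) * exp (- (norm h)\<^sup>2 / 4)) \<partial>lborel) < \<infinity>"
proof -
  let ?g = "\<lambda>x::real. \<bar>x\<bar> powr (- 2/3) * exp (- x\<^sup>2 / 4)"
  have "AE (h::'a) in lborel. ennreal (norm h powr (- 2/3 * DIM('a)) * exp (- (norm h)\<^sup>2 / 4)) \<le> (\<Prod>b\<in>Basis. ennreal (?g (h \<bullet> b)))"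
    using AE_lborel_inner_Basis_nonzero
  proof eventually_elim
    fix h :: 'a assume h: "\<forall>b\<in>Basis. h \<bullet> b \<noteq> 0"
    then have "h \<noteq> 0" using SOME_Basis by auto
    then have "norm h powr (- 2/3 * DIM('a)) = (\<Prod>b\<in>(Basis::'a set). norm h powr (- 2/3))"
    proof -
      have "(norm h powr (- 2/3)) ^ DIM('a) = norm h powr (- 2/3 * DIM('a))"
        using \<open>h \<noteq> 0\<close> by (simp add: powr_realpow[symmetric] powr_powr)
      then show ?thesis by simp
    qed
    also have "\<dots> \<le> (\<Prod>b\<in>Basis. \<bar>h \<bullet> b\<bar> powr (- 2/3))"
      using h by (intro prod_mono) (auto intro!: powr_mono2' Basis_le_norm)
    finally have "norm h powr (- 2/3 * DIM('a)) * exp (- (1/4) * (norm h)\<^sup>2)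
        \<le> (\<Prod>b\<in>Basis. \<bar>h \<bullet> b\<bar> powr (- 2/3)) * (\<Prod>b\<in>Basis. exp (- (1/4) * (h \<bullet> b)\<^sup>2))"
      unfolding exp_neg_norm_square_prod by (intro mult_right_mono prod_nonneg) auto
    then have "norm h powr (- 2/3 * DIM('a)) * exp (- (norm h)\<^sup>2 / 4) \<le> (\<Prod>b\<in>Basis. ?g (h \<bullet> b))"
      unfolding prod.distrib[symmetric] by simp
    then show "ennreal (norm h powr (- 2/3 * DIM('a)) * exp (- (norm h)\<^sup>2 / 4)) \<le> (\<Prod>b\<in>Basis. ennreal (?g (h \<bullet> b)))"
      by (subst prod_ennreal) (auto intro: ennreal_leI)
  qed
  then have "(\<integral>\<^sup>+(h::'a). ennreal (norm h powr (- 2/3 * DIM('a)) * exp (- (norm h)\<^sup>2 / 4)) \<partial>lborel)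
      \<le> (\<integral>\<^sup>+(h::'a). (\<Prod>b\<in>Basis. ennreal (?g (h \<bullet> b))) \<partial>lborel)"
    by (rule nn_integral_mono_AE)
  also have "\<dots> = (\<Prod>b\<in>(Basis::'a set). \<integral>\<^sup>+x. ennreal (?g x) \<partial>lborel)"
    by (rule nn_integral_lborel_prod) auto
  also have "\<dots> < \<infinity>"
    using nn_integral_inverse_power_gaussian_finite
    by (simp add: power_less_top_ennreal)
  finally show ?thesis .
qed

lemma kernel_minus: "kernel a b (- \<tau>) (- y) = cnj (kernel a b \<tau> y)"
proof -
  have "cnj (kernel a b \<tau> y) = (LINT \<xi>|lborel. cnj (of_real (weight \<xi>) * cis (y \<bullet> \<xi> + \<tau> * dispersion a b \<xi>)))"
    unfolding kernel_def by (simp only: Bochner_Integration.integral_cnj)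
  then show ?thesis
    unfolding kernel_def by (simp add: cis_cnj algebra_simps)
qed

text \<open>The squared kernel is at most the integral of the autocorrelation, which is
  \<open>O((\<tau> * norm h) powr (- 2/3 * n))\<close> times a Gaussian in \<open>h\<close>;
  integrating and taking the root halves the exponent of \<open>\<tau>\<close>. The bound does not
  see \<open>y\<close>, which enters the autocorrelation only through
  \<open>cis (y \<bullet> h)\<close>. Negative times follow by conjugation.\<close>

lemma kernel_dispersive_decay:
  obtains C where "0 < C" "\<And>a b \<tau> (y::'a::euclidean_space). 0 \<le> a \<Longrightarrow> a \<le> 1 \<Longrightarrow> 0 \<le> b \<Longrightarrow> a = 1 \<or> b = 1 \<Longrightarrow> \<tau> \<noteq> 0 \<Longrightarrow>
    norm (kernel a b \<tau> y) \<le> C * \<bar>\<tau>\<bar> powr (- real DIM('a) / 3)"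
proof -
  let ?n = "DIM('a)"
  obtain C where C: "0 \<le> C" "\<And>a b \<tau> c (h::'a). 0 \<le> a \<Longrightarrow> a \<le> 1 \<Longrightarrow> 0 \<le> b \<Longrightarrow> a = 1 \<or> b = 1 \<Longrightarrow>
    0 < \<tau> \<Longrightarrow> h \<noteq> 0 \<Longrightarrow> 0 < c \<Longrightarrow> c \<le> 1 \<Longrightarrow> c^3 * (\<tau> * norm h) \<le> 1 \<Longrightarrow> c = 1 \<or> c^3 * (\<tau> * norm h) = 1 \<Longrightarrow>
    norm (LINT \<xi>|lborel. of_real (weight (\<xi> + h) * weight \<xi>) * cis (\<tau> * (dispersion a b (\<xi> + h) - dispersion a b \<xi>)))
      \<le> C * c ^ (2 * ?n) * exp (- (norm h)\<^sup>2 / 4)"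
    using kernel_autocorrelation_bound by blast
  obtain I where I: "0 \<le> I" "(\<integral>\<^sup>+(h::'a). ennreal (norm h powr (- 2/3 * ?n) * exp (- (norm h)\<^sup>2 / 4)) \<partial>lborel) = ennreal I"
    using nn_integral_norm_inverse_power_gaussian_finite[where 'a='a] by (auto simp: less_top_ennreal)
  have pos: "norm (kernel a b \<tau> y) \<le> sqrt (C * I) * \<bar>\<tau>\<bar> powr (- real ?n / 3)"
    if ab: "0 \<le> a" "a \<le> 1" "0 \<le> b" "a = 1 \<or> b = 1" and \<tau>: "0 < \<tau>" for a b \<tau> and y :: 'a
  proof -
    define A where "A \<xi> = of_real (weight \<xi>) * cis (y \<bullet> \<xi> + \<tau> * dispersion a b \<xi>)" for \<xi> :: 'a
    have [measurable]: "A \<in> borel_measurable borel" unfolding A_def by measurable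
    have Aint: "integrable lborel A"
      by (rule Bochner_Integration.integrable_bound[OF weight_integrable]) (auto simp: A_def norm_mult)
    have J: "norm (LINT \<xi>|lborel. A (\<xi> + h) * cnj (A \<xi>)) \<le> C * \<tau> powr (- 2/3 * ?n) * (norm h powr (- 2/3 * ?n) * exp (- (norm h)\<^sup>2 / 4))"
      if h: "h \<noteq> 0" for h
    proof -
      let ?J = "LINT \<xi>|lborel. of_real (weight (\<xi> + h) * weight \<xi>) * cis (\<tau> * (dispersion a b (\<xi> + h) - dispersion a b \<xi>))"
      have "A (\<xi> + h) * cnj (A \<xi>) = cis (y \<bullet> h) * (of_real (weight (\<xi> + h) * weight \<xi>) * cis (\<tau> * (dispersion a b (\<xi> + h) - dispersion a b \<xi>)))" for \<xi>
      proof -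
        have "cis (y \<bullet> (\<xi> + h) + \<tau> * dispersion a b (\<xi> + h)) * cis (- (y \<bullet> \<xi> + \<tau> * dispersion a b \<xi>))
            = cis (y \<bullet> h) * cis (\<tau> * (dispersion a b (\<xi> + h) - dispersion a b \<xi>))"
          unfolding cis_mult by (rule arg_cong[where f=cis]) (simp add: inner_add_right algebra_simps)
        then show ?thesis unfolding A_def by (simp add: cis_cnj mult_ac)
      qed
      then have "norm (LINT \<xi>|lborel. A (\<xi> + h) * cnj (A \<xi>)) = norm ?J"
        by (simp add: norm_mult)
      also define r where "r = (\<tau> * norm h) powr (-1/3)"
      \<comment> \<open>\<open>r\<close> balances the cubic error exactly,
        \<open>r^3 * (\<tau> * norm h) = 1\<close>; the minimum with 1 keeps the shift admissible
        when \<open>\<tau> * norm h\<close> is small.\<close>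
      define c where "c = min 1 r"
      have th: "0 < \<tau> * norm h" using \<tau> h by simp
      have r0: "0 < r" unfolding r_def using \<tau> h by simp
      have r3: "r^3 * (\<tau> * norm h) = 1"
      proof -
        have "r^3 = (\<tau> * norm h) powr (-1)"
          unfolding r_def using \<tau> h by (simp add: powr_realpow[symmetric] powr_powr)
        then show ?thesis using \<tau> h by (simp add: powr_minus field_simps)
      qed
      have "norm ?J \<le> C * c ^ (2 * ?n) * exp (- (norm h)\<^sup>2 / 4)"
      proof (rule C(2)[OF ab \<tau> h])
        show "c^3 * (\<tau> * norm h) \<le> 1"
          by (rule order_trans[OF mult_right_mono[OF power_mono[of c r 3]]]) (use r0 th r3 in \<open>auto simp: c_def\<close>)
        show "c = 1 \<or> c^3 * (\<tau> * norm h) = 1" using r3 by (auto simp: c_def min_def)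
      qed (use r0 in \<open>auto simp: c_def\<close>)
      also have "c ^ (2 * ?n) \<le> r ^ (2 * ?n)" using r0 by (intro power_mono) (auto simp: c_def)
      also have "r ^ (2 * ?n) = \<tau> powr (- 2/3 * ?n) * norm h powr (- 2/3 * ?n)"
        unfolding r_def using \<tau> h by (simp add: powr_realpow[symmetric] powr_powr powr_mult)
      finally show ?thesis using C(1) by (simp add: mult_ac mult_left_mono mult_right_mono)
    qed
    have "ennreal ((norm (kernel a b \<tau> y))\<^sup>2) \<le> (\<integral>\<^sup>+h. ennreal (norm (LINT \<xi>|lborel. A (\<xi> + h) * cnj (A \<xi>))) \<partial>lborel)"
      using norm_integral_square_le_autocorrelation[OF Aint] unfolding A_def kernel_def .
    also have "\<dots> \<le> (\<integral>\<^sup>+h. ennreal (C * \<tau> powr (- 2/3 * ?n)) * ennreal (norm (h::'a) powr (- 2/3 * ?n) * exp (- (norm h)\<^sup>2 / 4)) \<partial>lborel)"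
    proof (rule nn_integral_mono_AE)
      show "AE (h::'a) in lborel. ennreal (norm (LINT \<xi>|lborel. A (\<xi> + h) * cnj (A \<xi>)))
         \<le> ennreal (C * \<tau> powr (- 2/3 * ?n)) * ennreal (norm h powr (- 2/3 * ?n) * exp (- (norm h)\<^sup>2 / 4))"
        using AE_lborel_singleton[of "0::'a"]
      proof eventually_elim
        case (elim h)
        then show ?case using J[OF elim] C(1) by (simp add: ennreal_mult'[symmetric] ennreal_leI)
      qed
    qed
    also have "\<dots> = ennreal (C * \<tau> powr (- 2/3 * ?n) * I)"
      using C(1) I by (subst nn_integral_cmult) (auto simp: ennreal_mult)
    finally have "(norm (kernel a b \<tau> y))\<^sup>2 \<le> C * \<tau> powr (- 2/3 * ?n) * I"
      using C(1) I(1) by (subst (asm) ennreal_le_iff) auto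
    also have "\<dots> = (sqrt (C * I) * \<bar>\<tau>\<bar> powr (- real ?n / 3))\<^sup>2"
    proof -
      have "(\<tau> powr (- real ?n / 3))\<^sup>2 = \<tau> powr (- 2/3 * ?n)"
        using \<tau> by (simp add: powr_realpow[symmetric] powr_powr mult.commute)
      then show ?thesis using C(1) I(1) \<tau> by (simp add: power_mult_distrib)
    qed
    finally show ?thesis
      by (rule power2_le_imp_le) (use C(1) I(1) in auto)
  qed
  have "norm (kernel a b \<tau> y) \<le> (sqrt (C * I) + 1) * \<bar>\<tau>\<bar> powr (- real ?n / 3)"
    if ab: "0 \<le> a" "a \<le> 1" "0 \<le> b" "a = 1 \<or> b = 1" and \<tau>: "\<tau> \<noteq> 0" for a b \<tau> and y :: 'a
  proof -
    have "norm (kernel a b \<tau> y) = norm (kernel a b \<bar>\<tau>\<bar> (if 0 < \<tau> then y else - y))"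
      using kernel_minus[of a b \<tau> y] by simp
    also have "\<dots> \<le> sqrt (C * I) * \<bar>\<tau>\<bar> powr (- real ?n / 3)"
      using pos[OF ab, of "\<bar>\<tau>\<bar>"] \<tau> by simp
    also have "\<dots> \<le> (sqrt (C * I) + 1) * \<bar>\<tau>\<bar> powr (- real ?n / 3)" by (intro mult_right_mono) auto
    finally show ?thesis .
  qed
  moreover have "0 < sqrt (C * I) + 1" using C(1) I(1) by (simp add: add_nonneg_pos)
  ultimately show thesis using that by blast
qed

section \<open>Level sets of sampled waves\<close>

text \<open>The selector depends on the indices only through their blocks, so the sum over pairs of
  indices collapses to pairs of block sums.\<close>

lemma sum_blocks:
  fixes z :: "'i \<Rightarrow> complex" and k :: "'i \<Rightarrow> int"
  assumes "finite E"
  defines "s \<equiv> \<lambda>m. \<Sum>i\<in>{i\<in>E. k i = m}. z i"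
  shows "(\<Sum>i\<in>E. \<Sum>j\<in>E. of_bool (P (k i) (k j)) * (z i * cnj (z j)))
       = (\<Sum>m\<in>k ` E. \<Sum>l\<in>k ` E. of_bool (P m l) * (s m * cnj (s l)))"
proof -
  have inner: "(\<Sum>j\<in>E. of_bool (P m (k j)) * cnj (z j)) = (\<Sum>l\<in>k ` E. of_bool (P m l) * cnj (s l))" for m
    unfolding sum.image_gen[OF assms(1), of "\<lambda>j. of_bool (P m (k j)) * cnj (z j)" k] s_def
    by (simp add: sum_distrib_left)
  have "(\<Sum>i\<in>E. \<Sum>j\<in>E. of_bool (P (k i) (k j)) * (z i * cnj (z j)))
      = (\<Sum>i\<in>E. z i * (\<Sum>l\<in>k ` E. of_bool (P (k i) l) * cnj (s l)))"
    unfolding inner[symmetric] by (simp add: sum_distrib_left mult_ac)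
  also have "\<dots> = (\<Sum>m\<in>k ` E. s m * (\<Sum>l\<in>k ` E. of_bool (P m l) * cnj (s l)))"
    unfolding sum.image_gen[OF assms(1), of "\<lambda>i. z i * (\<Sum>l\<in>k ` E. of_bool (P (k i) l) * cnj (s l))" k]
    by (simp add: s_def sum_distrib_right)
  finally show ?thesis by (simp add: sum_distrib_left mult_ac)
qed

text \<open>With \<open>s\<^sub>m\<close> the sum over the block \<open>k = m\<close>, the pairs \<open>\<bar>m - l\<bar> \<le> R\<close> contribute at most
  \<open>(2 R + 1) \<Sum> \<bar>s\<^sub>m\<bar>\<^sup>2\<close> by AM-GM. Sorting times into unit blocks this way confines the local part to time
  differences at most 1, where the kernel bound is uniform.\<close>

lemma norm_sum_square_blocks_le:
  fixes z :: "'i \<Rightarrow> complex" and k :: "'i \<Rightarrow> int" and R :: nat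
  assumes E: "finite E"
  shows "(norm (\<Sum>i\<in>E. z i))\<^sup>2 \<le>
     (2 * real R + 1) * Re (\<Sum>i\<in>E. \<Sum>j\<in>E. of_bool (k i = k j) * (z i * cnj (z j)))
     + Re (\<Sum>i\<in>E. \<Sum>j\<in>E. of_bool (\<bar>k i - k j\<bar> > int R) * (z i * cnj (z j)))"
proof -
  define s where "s m = (\<Sum>i\<in>{i\<in>E. k i = m}. z i)" for m
  let ?K = "k ` E"
  have K: "finite ?K" using E by simp
  have "complex_of_real ((norm (\<Sum>i\<in>E. z i))\<^sup>2) = (\<Sum>i\<in>E. \<Sum>j\<in>E. z i * cnj (z j))"
    by (simp only: complex_norm_square cnj_sum sum_product)
  also have "\<dots> = (\<Sum>i\<in>E. \<Sum>j\<in>E. of_bool (\<bar>k i - k j\<bar> \<le> int R) * (z i * cnj (z j)))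
      + (\<Sum>i\<in>E. \<Sum>j\<in>E. of_bool (\<bar>k i - k j\<bar> > int R) * (z i * cnj (z j)))"
    unfolding sum.distrib[symmetric] by (intro sum.cong refl) (auto simp: of_bool_def)
  finally have eq: "(norm (\<Sum>i\<in>E. z i))\<^sup>2 = Re (\<Sum>i\<in>E. \<Sum>j\<in>E. of_bool (\<bar>k i - k j\<bar> \<le> int R) * (z i * cnj (z j)))
      + Re (\<Sum>i\<in>E. \<Sum>j\<in>E. of_bool (\<bar>k i - k j\<bar> > int R) * (z i * cnj (z j)))"
    by (metis Re_complex_of_real plus_complex.sel(1))
  \<comment> \<open>Read from right to left, this returns the squared block sums to a sum over pairs
    of samples, which after integration against the weight becomes a sum of kernel values.\<close>
  have diag: "Re (\<Sum>i\<in>E. \<Sum>j\<in>E. of_bool (k i = k j) * (z i * cnj (z j))) = (\<Sum>m\<in>?K. (norm (s m))\<^sup>2)"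
  proof -
    have "(\<Sum>m\<in>?K. \<Sum>l\<in>?K. of_bool (m = l) * (s m * cnj (s l))) = (\<Sum>m\<in>?K. s m * cnj (s m))"
    proof (rule sum.cong[OF refl])
      fix m assume "m \<in> ?K"
      then show "(\<Sum>l\<in>?K. of_bool (m = l) * (s m * cnj (s l))) = s m * cnj (s m)"
        using K by (subst sum.remove[of _ m]) auto
    qed
    then show ?thesis
      unfolding sum_blocks[OF E, where P="(=)"] s_def[symmetric]
      by (simp only: complex_norm_square[symmetric] of_real_sum[symmetric] Re_complex_of_real)
  qed
  have "Re (\<Sum>i\<in>E. \<Sum>j\<in>E. of_bool (\<bar>k i - k j\<bar> \<le> int R) * (z i * cnj (z j)))
      = (\<Sum>m\<in>?K. \<Sum>l\<in>?K. of_bool (\<bar>m - l\<bar> \<le> int R) * Re (s m * cnj (s l)))"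
    unfolding sum_blocks[OF E, where P="\<lambda>m l. \<bar>m - l\<bar> \<le> int R"] s_def[symmetric]
    by (auto simp: of_bool_def intro!: sum.cong)
  also have "\<dots> \<le> (\<Sum>m\<in>?K. \<Sum>l\<in>?K. of_bool (\<bar>m - l\<bar> \<le> int R) * (((norm (s m))\<^sup>2 + (norm (s l))\<^sup>2) / 2))"
  proof (intro sum_mono mult_left_mono)
    fix m l
    have "Re (s m * cnj (s l)) \<le> norm (s m) * norm (s l)"
      using complex_Re_le_cmod[of "s m * cnj (s l)"] by (simp add: norm_mult)
    also have "\<dots> \<le> ((norm (s m))\<^sup>2 + (norm (s l))\<^sup>2) / 2"
      using zero_le_power2[of "norm (s m) - norm (s l)"] by (simp add: power2_diff)
    finally show "Re (s m * cnj (s l)) \<le> ((norm (s m))\<^sup>2 + (norm (s l))\<^sup>2) / 2" .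
  qed auto
  also have "\<dots> = (\<Sum>m\<in>?K. \<Sum>l\<in>?K. of_bool (\<bar>m - l\<bar> \<le> int R) * ((norm (s m))\<^sup>2 / 2))
      + (\<Sum>m\<in>?K. \<Sum>l\<in>?K. of_bool (\<bar>m - l\<bar> \<le> int R) * ((norm (s l))\<^sup>2 / 2))"
    by (simp add: sum.distrib[symmetric] add_divide_distrib distrib_left)
  also have "(\<Sum>m\<in>?K. \<Sum>l\<in>?K. of_bool (\<bar>m - l\<bar> \<le> int R) * ((norm (s l))\<^sup>2 / 2))
      = (\<Sum>m\<in>?K. \<Sum>l\<in>?K. of_bool (\<bar>m - l\<bar> \<le> int R) * ((norm (s m))\<^sup>2 / 2))"
    by (subst sum.swap) (simp add: abs_minus_commute)
  also have "(\<Sum>m\<in>?K. \<Sum>l\<in>?K. of_bool (\<bar>m - l\<bar> \<le> int R) * ((norm (s m))\<^sup>2 / 2))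
      + (\<Sum>m\<in>?K. \<Sum>l\<in>?K. of_bool (\<bar>m - l\<bar> \<le> int R) * ((norm (s m))\<^sup>2 / 2))
      = (\<Sum>m\<in>?K. (norm (s m))\<^sup>2 * (\<Sum>l\<in>?K. of_bool (\<bar>m - l\<bar> \<le> int R)))"
    unfolding sum.distrib[symmetric] by (simp add: sum_distrib_left sum.distrib[symmetric] mult_ac)
  also have "\<dots> \<le> (\<Sum>m\<in>?K. (norm (s m))\<^sup>2 * (2 * real R + 1))"
  proof (intro sum_mono mult_left_mono)
    fix m
    have "(\<Sum>l\<in>?K. of_bool (\<bar>m - l\<bar> \<le> int R) :: real) = real (card (?K \<inter> {l. \<bar>m - l\<bar> \<le> int R}))"
      by (simp add: of_bool_def sum.If_cases[OF K])
    also have "card (?K \<inter> {l. \<bar>m - l\<bar> \<le> int R}) \<le> card {m - int R..m + int R}"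
      by (intro card_mono) auto
    finally show "(\<Sum>l\<in>?K. of_bool (\<bar>m - l\<bar> \<le> int R) :: real) \<le> 2 * real R + 1" by simp
  qed auto
  also have "\<dots> = (2 * real R + 1) * (\<Sum>m\<in>?K. (norm (s m))\<^sup>2)"
    by (simp add: sum_distrib_left mult.commute)
  finally show ?thesis unfolding eq diag by simp
qed

lemma mult_le_weighted_squares:
  fixes s g t :: real
  assumes "0 < t"
  shows "s * g \<le> 1 / (2 * t) * s\<^sup>2 + t / 2 * g\<^sup>2"
proof -
  have "2 * (s * g) * t \<le> s\<^sup>2 + (t * g)\<^sup>2"
    using zero_le_power2[of "s - t * g"] by (simp add: power2_diff mult_ac)
  then have "s * g \<le> (s\<^sup>2 + (t * g)\<^sup>2) / (2 * t)"
    using assms by (simp add: pos_le_divide_eq mult_ac)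
  also have "\<dots> = 1 / (2 * t) * s\<^sup>2 + t / 2 * g\<^sup>2"
    using assms by (simp add: field_simps power2_eq_square)
  finally show ?thesis .
qed

lemma square_le_of_weighted_bound:
  fixes t :: real
  assumes "0 < t" "t \<le> A / (2 * t) * Q + t / 2"
  shows "t * t \<le> A * Q"
proof -
  have "t / 2 \<le> A * Q / (2 * t)" using assms(2) by simp
  then show ?thesis using assms(1) by (simp add: field_simps)
qed

text \<open>One frequency piece after rescaling, with data \<open>G\<close> of L2 norm at most 1,
  seen at space-time points indexed by \<open>'i\<close>. The assumptions concern only
  \<open>a\<close>, \<open>b\<close> and \<open>G\<close>, so the predicate
  \<open>sampled_wave a b G\<close> leaves the points \<open>(\<tau> i, y i)\<close>
  arbitrary.\<close>

locale sampled_wave =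
  fixes a b :: real and \<tau> :: "'i \<Rightarrow> real" and y :: "'i \<Rightarrow> 'a::euclidean_space" and G :: "'a \<Rightarrow> complex"
  assumes ab: "0 \<le> a" "a \<le> 1" "0 \<le> b" "b \<le> 1" "a = 1 \<or> b = 1"
    and G_measurable[measurable]: "G \<in> borel_measurable borel"
    and G_supp: "\<And>\<xi>. G \<xi> \<noteq> 0 \<Longrightarrow> 1 \<le> norm \<xi> \<and> norm \<xi> \<le> 2"
    and G_int: "integrable lborel (\<lambda>\<xi>. (norm (G \<xi>))\<^sup>2)"
    and G_norm: "(LINT \<xi>|lborel. (norm (G \<xi>))\<^sup>2) \<le> 1"
begin

definition wave :: "'i \<Rightarrow> complex" where
  "wave i = (LINT \<xi>|lborel. cis (y i \<bullet> \<xi> + \<tau> i * dispersion a b \<xi>) * G \<xi>)"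

text \<open>On the bounded support \<open>t \<le> 1 + t\<^sup>2\<close> turns square integrability
  into integrability.\<close>

lemma norm_G_le: "norm (G \<xi>) \<le> indicator (cball 0 2) \<xi> + (norm (G \<xi>))\<^sup>2"
proof (cases "G \<xi> = 0")
  case False
  then have "\<xi> \<in> cball 0 2" using G_supp by auto
  moreover have "norm (G \<xi>) \<le> 1 + (norm (G \<xi>))\<^sup>2"
  proof -
    have "2 * norm (G \<xi>) \<le> 1 + (norm (G \<xi>))\<^sup>2"
      using zero_le_power2[of "norm (G \<xi>) - 1"] by (simp add: power2_diff)
    then show ?thesis using norm_ge_zero[of "G \<xi>"] by linarith
  qed
  ultimately show ?thesis by simp
qed simp

lemma integrable_dominant: "integrable lborel (\<lambda>\<xi>. indicator (cball (0::'a) 2) \<xi> + (norm (G \<xi>))\<^sup>2)"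
  by (intro Bochner_Integration.integrable_add G_int integrable_real_indicator emeasure_bounded_finite) auto

lemma G_integrable: "integrable lborel G"
  by (rule Bochner_Integration.integrable_bound[OF integrable_dominant])
     (use norm_G_le in \<open>auto intro: order_trans[OF _ abs_ge_self]\<close>)

text \<open>This crude bound, uniform in \<open>G\<close> and in the sample, confines the relevant
  levels \<open>\<mu>\<close> to a bounded interval, so that constants can later be absorbed into
  negative powers of \<open>\<mu>\<close>.\<close>

lemma norm_wave_le: "norm (wave i) \<le> measure lborel (cball (0::'a) 2) + 1"
proof -
  have "norm (wave i) \<le> (LINT \<xi>|lborel. norm (cis (y i \<bullet> \<xi> + \<tau> i * dispersion a b \<xi>) * G \<xi>))"
    unfolding wave_def by (rule integral_norm_bound)
  also have "\<dots> = (LINT \<xi>|lborel. norm (G \<xi>))" by (simp add: norm_mult)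
  also have "\<dots> \<le> (LINT \<xi>|lborel. indicator (cball (0::'a) 2) \<xi> + (norm (G \<xi>))\<^sup>2)"
    using G_integrable integrable_dominant norm_G_le by (intro integral_mono) auto
  also have "\<dots> = measure lborel (cball (0::'a) 2) + (LINT \<xi>|lborel. (norm (G \<xi>))\<^sup>2)"
    by (subst Bochner_Integration.integral_add) (auto intro!: G_int integrable_real_indicator emeasure_bounded_finite)
  finally show ?thesis using G_norm by linarith
qed

text \<open>On the annulus the fourth power of the norm is at most 16; this is the origin of the
  factor \<open>exp 16\<close> in the level set estimates.\<close>

lemma weight_ge: "G \<xi> \<noteq> 0 \<Longrightarrow> exp (- 16) \<le> weight \<xi>"
proof -
  assume "G \<xi> \<noteq> 0"
  then have *: "1 \<le> norm \<xi>" "norm \<xi> \<le> 2" using G_supp by auto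
  have "1 \<le> norm \<xi> ^ (2 * DIM('a))" using * by (simp add: one_le_power)
  moreover have "norm \<xi> ^ 4 \<le> 2 ^ 4" using * by (intro power_mono) auto
  ultimately have "1 * exp (- 16) \<le> norm \<xi> ^ (2 * DIM('a)) * exp (- (norm \<xi> ^ 4))"
    by (intro mult_mono) auto
  then show ?thesis by (simp add: weight_def)
qed

text \<open>The duality behind \<open>TT*\<close>, by hand. Aligning the phases of the samples gives
  a trigonometric sum \<open>S\<close> with \<open>\<mu> * card E\<close> at most the integral of
  \<open>S * G\<close>. As \<open>G\<close> lives where the weight is bounded below and has L2 norm
  at most 1, the square of this is at most \<open>exp 16\<close> times the weighted energy of
  \<open>S\<close>. Expanding the energy over pairs yields kernel values: \<open>D\<close> controls
  those in one time block, \<open>R\<close> separates the far ones.\<close>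

lemma level_set_inequality:
  fixes E :: "'i set" and R :: nat
  assumes E: "finite E" and \<mu>: "0 \<le> \<mu>" "\<And>i. i \<in> E \<Longrightarrow> \<mu> \<le> norm (wave i)" and R: "R \<ge> 1"
    and D: "\<And>i. i \<in> E \<Longrightarrow> (\<Sum>j\<in>E. exp (- norm (y i - y j))) \<le> D"
    and K0: "0 \<le> K0" "\<And>t x. t \<noteq> 0 \<Longrightarrow> norm (kernel a b t (x::'a)) \<le> K0 * \<bar>t\<bar> powr (- real DIM('a) / 3)"
    and K1: "0 \<le> K1" "\<And>t x. \<bar>t\<bar> \<le> 1 \<Longrightarrow> norm (kernel a b t (x::'a)) \<le> K1 * exp (- norm x)"
  shows "\<mu>\<^sup>2 * (real (card E))\<^sup>2 \<le> exp 16 *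
    ((2 * real R + 1) * (K1 * D * real (card E)) + K0 * real R powr (- real DIM('a) / 3) * (real (card E))\<^sup>2)"
\<comment> \<open>The degenerate case is split off because the energy estimate below divides by
  \<open>\<mu> * card E\<close>.\<close>
proof (cases "\<mu> * real (card E) = 0")
  case True
  then have zero: "\<mu>\<^sup>2 * (real (card E))\<^sup>2 = 0" by (simp add: power_mult_distrib[symmetric])
  have "0 \<le> D \<or> E = {}"
  proof (cases "E = {}")
    case False
    then obtain i where "i \<in> E" by blast
    from order_trans[OF sum_nonneg D[OF this]] show ?thesis by simp
  qed simp
  then have "0 \<le> K1 * D * real (card E)" using K1 by auto
  then have f: "0 \<le> (2 * real R + 1) * (K1 * D * real (card E))" by (rule mult_nonneg_nonneg[rotated]) simp
  have g: "0 \<le> K0 * real R powr (- real DIM('a) / 3) * (real (card E))\<^sup>2" using K0(1) by simp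
  show ?thesis unfolding zero by (rule mult_nonneg_nonneg[OF exp_ge_zero add_nonneg_nonneg[OF f g]])
next
  case False
  let ?N = "real (card E)"
  have \<mu>N: "0 < \<mu> * ?N" using False mult_nonneg_nonneg[OF \<mu>(1) of_nat_0_le_iff[of "card E"]] by linarith
  define k where "k i = \<lfloor>\<tau> i\<rfloor>" for i
  \<comment> \<open>Where the wave vanishes \<open>sgn\<close> is 0, so \<open>c i\<close> has norm
    at most 1 rather than equal to 1; only the upper bound enters.\<close>
  define c where "c i = cnj (sgn (wave i))" for i
  define e where "e i \<xi> = cis (y i \<bullet> \<xi> + \<tau> i * dispersion a b \<xi>)" for i \<xi>
  define z where "z i \<xi> = c i * e i \<xi>" for i \<xi>
  define S where "S \<xi> = (\<Sum>i\<in>E. z i \<xi>)" for \<xi>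
  have [measurable]: "e i \<in> borel_measurable borel" for i unfolding e_def by measurable
  have [measurable]: "z i \<in> borel_measurable borel" for i unfolding z_def by measurable
  have [measurable]: "S \<in> borel_measurable borel" unfolding S_def by measurable
  have c_norm: "norm (c i) \<le> 1" for i by (simp add: c_def norm_sgn)
  have e_norm: "norm (e i \<xi>) = 1" for i \<xi> by (simp add: e_def)
  have z_norm: "norm (z i \<xi>) \<le> 1" for i \<xi> by (simp add: z_def norm_mult e_norm c_norm)
  have S_norm: "norm (S \<xi>) \<le> ?N" for \<xi>
    unfolding S_def by (rule order_trans[OF norm_sum]) (use sum_bounded_above[of E "\<lambda>i. norm (z i \<xi>)" 1] z_norm in auto)
  have cw: "c i * wave i = of_real (norm (wave i))" for i
  proof (cases "wave i = 0")
    case False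
    have "c i * wave i = of_real (inverse (norm (wave i))) * (wave i * cnj (wave i))"
      unfolding c_def sgn_div_norm by (simp add: scaleR_conv_of_real mult_ac)
    also have "\<dots> = of_real (inverse (norm (wave i)) * (norm (wave i))\<^sup>2)"
      by (simp only: complex_norm_square[symmetric] of_real_mult)
    also have "inverse (norm (wave i)) * (norm (wave i))\<^sup>2 = norm (wave i)"
      using False by (simp add: power2_eq_square)
    finally show ?thesis .
  qed simp
  have zint: "integrable lborel (\<lambda>\<xi>. weight \<xi> * (z i \<xi> * cnj (z j \<xi>)))" for i j
  proof (rule Bochner_Integration.integrable_bound[OF weight_integrable])
    have "norm (z i \<xi> * cnj (z j \<xi>)) \<le> 1" for \<xi>
      unfolding norm_mult complex_mod_cnj by (intro mult_le_one z_norm) auto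
    then show "AE \<xi>::'a in lborel. norm (weight \<xi> * (z i \<xi> * cnj (z j \<xi>))) \<le> norm (weight \<xi>)"
      by (auto simp: norm_mult abs_of_nonneg[OF weight_nonneg] intro!: mult_left_le weight_nonneg)
  qed measurable
  have zK: "(LINT \<xi>|lborel. weight \<xi> * (z i \<xi> * cnj (z j \<xi>))) = c i * cnj (c j) * kernel a b (\<tau> i - \<tau> j) (y i - y j)" for i j
  proof -
    have "weight \<xi> * (z i \<xi> * cnj (z j \<xi>)) = c i * cnj (c j) * (of_real (weight \<xi>) * cis ((y i - y j) \<bullet> \<xi> + (\<tau> i - \<tau> j) * dispersion a b \<xi>))" for \<xi>
    proof -
      have "cis (y i \<bullet> \<xi> + \<tau> i * dispersion a b \<xi>) * cis (- (y j \<bullet> \<xi> + \<tau> j * dispersion a b \<xi>)) = cis ((y i - y j) \<bullet> \<xi> + (\<tau> i - \<tau> j) * dispersion a b \<xi>)"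
        unfolding cis_mult by (rule arg_cong[where f=cis]) (simp add: inner_diff_left algebra_simps)
      then show ?thesis unfolding z_def e_def by (simp add: cis_cnj mult_ac)
    qed
    then show ?thesis unfolding kernel_def by (simp only: integral_mult_right_zero)
  qed
  have zKn: "norm (LINT \<xi>|lborel. weight \<xi> * (z i \<xi> * cnj (z j \<xi>))) \<le> norm (kernel a b (\<tau> i - \<tau> j) (y i - y j))" for i j
    unfolding zK norm_mult complex_mod_cnj using c_norm by (intro mult_left_le_one_le mult_le_one) auto
  define Q where "Q = (LINT \<xi>|lborel. weight \<xi> * (norm (S \<xi>))\<^sup>2)"
  have Qint: "integrable lborel (\<lambda>\<xi>. weight \<xi> * (norm (S \<xi>))\<^sup>2)"
  proof (rule Bochner_Integration.integrable_bound)
    show "integrable lborel (\<lambda>\<xi>::'a. ?N\<^sup>2 * weight \<xi>)" by (intro integrable_mult_right weight_integrable)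
    have "weight \<xi> * (norm (S \<xi>))\<^sup>2 \<le> weight \<xi> * ?N\<^sup>2" for \<xi>
      by (intro mult_left_mono power_mono S_norm weight_nonneg) auto
    then show "AE \<xi> in lborel. norm (weight \<xi> * (norm (S \<xi>))\<^sup>2) \<le> norm (?N\<^sup>2 * weight \<xi>)"
      by (auto simp: abs_mult abs_of_nonneg[OF weight_nonneg] mult.commute)
  qed measurable
  \<comment> \<open>AM-GM under the integral with the weight t = \<open>\<mu> * ?N\<close>: the part
    carrying \<open>G\<close> is at most t/2 and is absorbed on the left, leaving t^2 <=
    \<open>exp 16 * Q\<close>. This takes the place of the Cauchy-Schwarz inequality.\<close>
  have "\<mu> * ?N \<le> exp 16 / (2 * (\<mu> * ?N)) * Q + \<mu> * ?N / 2"
  proof -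
    have "\<mu> * ?N \<le> (\<Sum>i\<in>E. norm (wave i))"
      using sum_mono[of E "\<lambda>_. \<mu>" "\<lambda>i. norm (wave i)"] \<mu>(2) by (simp add: mult.commute)
    also have "\<dots> = norm (\<Sum>i\<in>E. c i * wave i)"
      unfolding cw of_real_sum[symmetric] norm_of_real by (rule abs_of_nonneg[symmetric], rule sum_nonneg) simp
    also have "(\<Sum>i\<in>E. c i * wave i) = (LINT \<xi>|lborel. S \<xi> * G \<xi>)"
    proof -
      have "integrable lborel (\<lambda>\<xi>. e i \<xi> * G \<xi>)" for i
        by (rule Bochner_Integration.integrable_bound[OF G_integrable]) (auto simp: norm_mult e_norm)
      then have "(LINT \<xi>|lborel. (\<Sum>i\<in>E. c i * (e i \<xi> * G \<xi>))) = (\<Sum>i\<in>E. c i * wave i)"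
        unfolding wave_def e_def[symmetric] by (subst Bochner_Integration.integral_sum) auto
      then show ?thesis unfolding S_def z_def by (simp add: sum_distrib_right mult.assoc)
    qed
    also have "norm (LINT \<xi>|lborel. S \<xi> * G \<xi>) \<le> (LINT \<xi>|lborel. norm (S \<xi> * G \<xi>))"
      by (rule integral_norm_bound)
    also have "\<dots> \<le> (LINT \<xi>|lborel. exp 16 / (2 * (\<mu> * ?N)) * (weight \<xi> * (norm (S \<xi>))\<^sup>2) + \<mu> * ?N / 2 * (norm (G \<xi>))\<^sup>2)"
    proof (rule integral_mono)
      show "integrable lborel (\<lambda>\<xi>. norm (S \<xi> * G \<xi>))"
      proof (rule Bochner_Integration.integrable_bound)
        show "integrable lborel (\<lambda>\<xi>. ?N * norm (G \<xi>))" using G_integrable by auto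
      qed (auto simp: norm_mult intro!: mult_right_mono S_norm)
      show "integrable lborel (\<lambda>\<xi>. exp 16 / (2 * (\<mu> * ?N)) * (weight \<xi> * (norm (S \<xi>))\<^sup>2) + \<mu> * ?N / 2 * (norm (G \<xi>))\<^sup>2)"
        by (intro Bochner_Integration.integrable_add integrable_mult_right Qint G_int)
      fix \<xi>
      show "norm (S \<xi> * G \<xi>) \<le> exp 16 / (2 * (\<mu> * ?N)) * (weight \<xi> * (norm (S \<xi>))\<^sup>2) + \<mu> * ?N / 2 * (norm (G \<xi>))\<^sup>2"
      proof (cases "G \<xi> = 0")
        case True
        have "0 \<le> exp 16 / (2 * (\<mu> * ?N))" using \<mu>N by (intro divide_nonneg_pos) auto
        then have "0 \<le> exp 16 / (2 * (\<mu> * ?N)) * (weight \<xi> * (norm (S \<xi>))\<^sup>2)"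
          by (rule mult_nonneg_nonneg) (simp add: weight_nonneg)
        then show ?thesis using True by simp
      next
        case False
        let ?s = "norm (S \<xi>)" and ?g = "norm (G \<xi>)" and ?t = "\<mu> * ?N"
        have "?s * ?g \<le> 1 / (2 * ?t) * ?s\<^sup>2 + ?t / 2 * ?g\<^sup>2"
          by (rule mult_le_weighted_squares[OF \<mu>N])
        also have "\<dots> \<le> 1 / (2 * ?t) * (exp 16 * weight \<xi> * ?s\<^sup>2) + ?t / 2 * ?g\<^sup>2"
        proof -
          have "exp 16 * exp (- 16) \<le> exp 16 * weight \<xi>" by (intro mult_left_mono weight_ge False) auto
          then have "1 \<le> exp 16 * weight \<xi>" by (simp add: exp_minus)
          then have "1 * ?s\<^sup>2 \<le> exp 16 * weight \<xi> * ?s\<^sup>2" by (intro mult_right_mono) auto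
          then show ?thesis using \<mu>N by (intro add_mono mult_left_mono) auto
        qed
        finally show ?thesis by (simp add: norm_mult mult_ac)
      qed
    qed
    also have "\<dots> = exp 16 / (2 * (\<mu> * ?N)) * Q + \<mu> * ?N / 2 * (LINT \<xi>|lborel. (norm (G \<xi>))\<^sup>2)"
      unfolding Q_def
      by (subst Bochner_Integration.integral_add) (auto intro!: integrable_mult_right Qint G_int simp del: mult_eq_0_iff)
    also have "\<dots> \<le> exp 16 / (2 * (\<mu> * ?N)) * Q + \<mu> * ?N / 2 * 1"
      using \<mu>N by (intro add_left_mono mult_left_mono G_norm) auto
    finally show ?thesis by simp
  qed
  then have "(\<mu> * ?N) * (\<mu> * ?N) \<le> exp 16 * Q" by (rule square_le_of_weighted_bound[OF \<mu>N])
  then have A: "\<mu>\<^sup>2 * ?N\<^sup>2 \<le> exp 16 * Q" by (simp add: power2_eq_square mult_ac)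
  define near where "near = (\<Sum>i\<in>E. \<Sum>j\<in>E. of_bool (k i = k j) * (LINT \<xi>|lborel. weight \<xi> * (z i \<xi> * cnj (z j \<xi>))))"
  define far where "far = (\<Sum>i\<in>E. \<Sum>j\<in>E. of_bool (\<bar>k i - k j\<bar> > int R) * (LINT \<xi>|lborel. weight \<xi> * (z i \<xi> * cnj (z j \<xi>))))"
  have B: "Q \<le> (2 * real R + 1) * Re near + Re far"
  proof -
    \<comment> \<open>The weight times the right side of the block inequality, before real parts are
      taken: its integral can be computed term by term into \<open>near\<close> and
      \<open>far\<close>.\<close>
    define F where "F \<xi> = (2 * real R + 1) * (\<Sum>i\<in>E. \<Sum>j\<in>E. of_bool (k i = k j) * (weight \<xi> * (z i \<xi> * cnj (z j \<xi>))))
        + (\<Sum>i\<in>E. \<Sum>j\<in>E. of_bool (\<bar>k i - k j\<bar> > int R) * (weight \<xi> * (z i \<xi> * cnj (z j \<xi>))))" for \<xi>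
    have Fint: "integrable lborel F"
      unfolding F_def by (intro Bochner_Integration.integrable_add integrable_mult_right Bochner_Integration.integrable_sum zint)
    have FI: "(LINT \<xi>|lborel. F \<xi>) = (2 * real R + 1) * near + far"
      unfolding F_def near_def far_def
      by (subst Bochner_Integration.integral_add)
         (auto intro!: integrable_mult_right Bochner_Integration.integrable_sum zint simp: Bochner_Integration.integral_sum zint)
    have "Q \<le> (LINT \<xi>|lborel. Re (F \<xi>))"
      unfolding Q_def
    proof (rule integral_mono[OF Qint integrable_Re[OF Fint]])
      fix \<xi>
      have "weight \<xi> * (norm (S \<xi>))\<^sup>2 \<le> weight \<xi> * ((2 * real R + 1) * Re (\<Sum>i\<in>E. \<Sum>j\<in>E. of_bool (k i = k j) * (z i \<xi> * cnj (z j \<xi>)))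
        + Re (\<Sum>i\<in>E. \<Sum>j\<in>E. of_bool (\<bar>k i - k j\<bar> > int R) * (z i \<xi> * cnj (z j \<xi>))))"
        unfolding S_def by (intro mult_left_mono norm_sum_square_blocks_le E weight_nonneg)
      also have "\<dots> = Re (F \<xi>)"
      proof -
        have "F \<xi> = of_real (weight \<xi>) * (of_real (2 * real R + 1) * (\<Sum>i\<in>E. \<Sum>j\<in>E. of_bool (k i = k j) * (z i \<xi> * cnj (z j \<xi>)))
          + (\<Sum>i\<in>E. \<Sum>j\<in>E. of_bool (\<bar>k i - k j\<bar> > int R) * (z i \<xi> * cnj (z j \<xi>))))"
          unfolding F_def by (simp add: distrib_left sum_distrib_left mult_ac)
        moreover have "Re (of_real u * (of_real r * A + B)) = u * (r * Re A + Re B)" for u r A B by simp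
        ultimately show ?thesis by (simp only:)
      qed
      finally show "weight \<xi> * (norm (S \<xi>))\<^sup>2 \<le> Re (F \<xi>)" .
    qed
    also have "\<dots> = Re (LINT \<xi>|lborel. F \<xi>)" using Fint by simp
    also have "\<dots> = (2 * real R + 1) * Re near + Re far" unfolding FI by simp
    finally show ?thesis .
  qed
  have "norm near \<le> K1 * D * ?N"
  proof -
    have "norm near \<le> (\<Sum>i\<in>E. \<Sum>j\<in>E. K1 * exp (- norm (y i - y j)))"
      unfolding near_def
    proof (intro order_trans[OF norm_sum] sum_mono)
      fix i j
      show "norm (of_bool (k i = k j) * (LINT \<xi>|lborel. weight \<xi> * (z i \<xi> * cnj (z j \<xi>)))) \<le> K1 * exp (- norm (y i - y j))"
      proof (cases "k i = k j")
        case True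
        then have "\<bar>\<tau> i - \<tau> j\<bar> \<le> 1" unfolding k_def by linarith
        with order_trans[OF zKn K1(2)] True show ?thesis by simp
      qed (use K1(1) in simp)
    qed
    also have "\<dots> \<le> (\<Sum>i\<in>E. K1 * D)"
      unfolding sum_distrib_left[symmetric] using K1(1) by (intro sum_mono mult_left_mono D)
    finally show ?thesis by (simp add: mult_ac)
  qed
  then have N: "Re near \<le> K1 * D * ?N" using complex_Re_le_cmod order_trans by blast
  have "norm far \<le> K0 * real R powr (- real DIM('a) / 3) * ?N\<^sup>2"
  proof -
    have "norm far \<le> (\<Sum>i\<in>E. \<Sum>j\<in>E. K0 * real R powr (- real DIM('a) / 3))"
      unfolding far_def
    proof (intro order_trans[OF norm_sum] sum_mono)
      fix i j
      show "norm (of_bool (\<bar>k i - k j\<bar> > int R) * (LINT \<xi>|lborel. weight \<xi> * (z i \<xi> * cnj (z j \<xi>)))) \<le> K0 * real R powr (- real DIM('a) / 3)"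
      proof (cases "\<bar>k i - k j\<bar> > int R")
        case True
        \<comment> \<open>Integer parts that differ by more than \<open>R\<close> differ by at least
          \<open>R + 1\<close>, so the times differ by more than \<open>R\<close>.\<close>
        then have t: "real R \<le> \<bar>\<tau> i - \<tau> j\<bar>" unfolding k_def by linarith
        then have "\<bar>\<tau> i - \<tau> j\<bar> powr (- real DIM('a) / 3) \<le> real R powr (- real DIM('a) / 3)"
          using R by (intro powr_mono2') auto
        moreover have "\<tau> i - \<tau> j \<noteq> 0" using t R by auto
        ultimately have "norm (LINT \<xi>|lborel. weight \<xi> * (z i \<xi> * cnj (z j \<xi>))) \<le> K0 * real R powr (- real DIM('a) / 3)"
          using order_trans[OF order_trans[OF zKn K0(2)] mult_left_mono[OF _ K0(1)]] by blast
        then show ?thesis using True by simp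
      qed (use K0(1) in simp)
    qed
    then show ?thesis by (simp add: power2_eq_square mult_ac)
  qed
  then have Fr: "Re far \<le> K0 * real R powr (- real DIM('a) / 3) * ?N\<^sup>2" using complex_Re_le_cmod order_trans by blast
  have "Q \<le> (2 * real R + 1) * (K1 * D * ?N) + K0 * real R powr (- real DIM('a) / 3) * ?N\<^sup>2"
    using B by (rule order_trans) (intro add_mono mult_left_mono N Fr; simp)
  then show ?thesis using A by (meson exp_ge_zero mult_left_mono order_trans)
qed

end

text \<open>\<open>R\<close> is taken just large enough for the far pairs to use up at most half of
  \<open>\<mu>\<^sup>2 * (card E)\<^sup>2\<close>; what remains is
  \<open>\<mu>\<^sup>2 * card E\<close> bounded by a constant times \<open>R * D\<close>. The
  constant does not depend on \<open>a\<close>, \<open>b\<close>, \<open>G\<close> or the sample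
  points, so it serves all frequency pieces at once.\<close>

lemma sampled_wave_level_set_card:
  obtains C where "0 < C"
    "\<And>a b \<tau> (y :: 'i \<Rightarrow> 'a::euclidean_space) G E \<mu> D. sampled_wave a b G \<Longrightarrow> finite E \<Longrightarrow> 0 < \<mu> \<Longrightarrow>
      (\<And>i. i \<in> E \<Longrightarrow> \<mu> \<le> norm (sampled_wave.wave a b \<tau> y G i)) \<Longrightarrow> 0 \<le> D \<Longrightarrow>
      (\<And>i. i \<in> E \<Longrightarrow> (\<Sum>j\<in>E. exp (- norm (y i - y j))) \<le> D) \<Longrightarrow>
      real (card E) \<le> C * D * \<mu> powr (- (2 + 6 / real DIM('a)))"
proof -
  let ?n = "real DIM('a)"
  have n: "0 < ?n" by simp
  obtain K0 where K0: "0 < K0" "\<And>a b t (x::'a). 0 \<le> a \<Longrightarrow> a \<le> 1 \<Longrightarrow> 0 \<le> b \<Longrightarrow> a = 1 \<or> b = 1 \<Longrightarrow> t \<noteq> 0 \<Longrightarrow>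
      norm (kernel a b t x) \<le> K0 * \<bar>t\<bar> powr (- ?n / 3)"
    using kernel_dispersive_decay by blast
  obtain K1 where K1: "0 < K1" "\<And>a b t (x::'a). 0 \<le> a \<Longrightarrow> a \<le> 1 \<Longrightarrow> 0 \<le> b \<Longrightarrow> b \<le> 1 \<Longrightarrow> \<bar>t\<bar> \<le> 1 \<Longrightarrow>
      norm (kernel a b t x) \<le> K1 * exp (- norm x)"
    using kernel_local_decay by blast
  define M where "M = measure lborel (cball (0::'a) 2) + 1"
  have M: "0 < M" unfolding M_def by (simp add: add_nonneg_pos)
  define A where "A = (2 * exp 16 * K0) powr (3 / ?n)"
  define C where "C = 2 * exp 16 * K1 * (2 * A + 3 * M powr (6 / ?n))"
  have A: "0 < A" unfolding A_def using K0 by simp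
  have C: "0 < C" unfolding C_def using K1 A M by (simp add: add_pos_nonneg)
  have "real (card E) \<le> C * D * \<mu> powr (- (2 + 6 / ?n))"
    if sw: "sampled_wave a b G" and E: "finite E" and \<mu>: "0 < \<mu>" "\<And>i. i \<in> E \<Longrightarrow> \<mu> \<le> norm (sampled_wave.wave a b \<tau> y G i)"
      and D: "0 \<le> D" "\<And>i. i \<in> E \<Longrightarrow> (\<Sum>j\<in>E. exp (- norm (y i - y j))) \<le> D"
    for a b \<tau> and y :: "'i \<Rightarrow> 'a" and G E \<mu> D
  proof (cases "E = {}")
    case True
    then show ?thesis using C D \<mu> by simp
  next
    case False
    interpret sampled_wave a b \<tau> y G by (rule sw)
    let ?N = "real (card E)"
    have N: "0 < ?N" using False E by (simp add: card_gt_0_iff)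
    obtain i where "i \<in> E" using False by blast
    then have \<mu>M: "\<mu> \<le> M" using \<mu>(2) norm_wave_le[of i] unfolding M_def by (meson order_trans)
    have minus: "\<mu> powr (- 6 / ?n) = 1 / \<mu> powr (6 / ?n)"
      using powr_minus_divide[of \<mu> "6 / ?n"] by simp
    \<comment> \<open>Solves \<open>exp 16 * K0 * X powr (- ?n / 3) = \<mu>\<^sup>2 / 2\<close>;
      rounding up to \<open>R\<close> only improves the far term.\<close>
    define X where "X = (2 * exp 16 * K0 / \<mu>\<^sup>2) powr (3 / ?n)"
    have X0: "0 < X" unfolding X_def using K0 \<mu> by simp
    have X: "X = A * \<mu> powr (- 6 / ?n)"
    proof -
      have "(\<mu>\<^sup>2) powr (3 / ?n) = \<mu> powr (6 / ?n)"
        by (simp add: power2_eq_square powr_mult powr_add[symmetric])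
      then show ?thesis unfolding X_def A_def minus powr_divide by simp
    qed
    define R where "R = nat \<lceil>X\<rceil>"
    have R: "X \<le> real R" "real R \<le> X + 1" unfolding R_def using X0 by linarith+
    then have R1: "1 \<le> R" using X0 by linarith
    have "real R powr (- ?n / 3) \<le> X powr (- ?n / 3)" using R X0 by (intro powr_mono2') auto
    also have "X powr (- ?n / 3) = \<mu>\<^sup>2 / (2 * exp 16 * K0)"
    proof -
      have "X powr (- ?n / 3) = (2 * exp 16 * K0 / \<mu>\<^sup>2) powr (- 1)"
        unfolding X_def powr_powr by simp
      also have "\<dots> = \<mu>\<^sup>2 / (2 * exp 16 * K0)"
        using K0 \<mu> by (subst powr_minus_divide) simp
      finally show ?thesis .
    qed
    finally have "exp 16 * (K0 * real R powr (- ?n / 3)) \<le> exp 16 * (K0 * (\<mu>\<^sup>2 / (2 * exp 16 * K0)))"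
      using K0 by (intro mult_left_mono) auto
    also have "\<dots> = \<mu>\<^sup>2 / 2" using K0 by (simp add: field_simps)
    finally have far: "exp 16 * (K0 * real R powr (- ?n / 3)) * ?N\<^sup>2 \<le> \<mu>\<^sup>2 / 2 * ?N\<^sup>2" by (rule mult_right_mono) simp
    have "\<mu>\<^sup>2 * ?N\<^sup>2 \<le> exp 16 * ((2 * real R + 1) * (K1 * D * ?N) + K0 * real R powr (- ?n / 3) * ?N\<^sup>2)"
    proof (rule level_set_inequality[OF E _ _ R1 D(2)])
      show "norm (kernel a b t x) \<le> K0 * \<bar>t\<bar> powr (- ?n / 3)" if "t \<noteq> 0" for t and x :: 'a
        using K0(2) ab that by blast
      show "norm (kernel a b t x) \<le> K1 * exp (- norm x)" if "\<bar>t\<bar> \<le> 1" for t and x :: 'a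
        using K1(2) ab that by blast
    qed (use \<mu> K0 K1 in auto)
    then have "\<mu>\<^sup>2 * ?N\<^sup>2 \<le> exp 16 * ((2 * real R + 1) * (K1 * D * ?N)) + \<mu>\<^sup>2 / 2 * ?N\<^sup>2"
      using far by (simp add: distrib_left mult.assoc)
    then have "(\<mu>\<^sup>2 * ?N) * ?N \<le> (2 * exp 16 * K1 * (2 * real R + 1) * D) * ?N"
      by (simp add: power2_eq_square algebra_simps)
    then have "\<mu>\<^sup>2 * ?N \<le> 2 * exp 16 * K1 * (2 * real R + 1) * D"
      using N by (simp only: mult_le_cancel_right_pos)
    also have "\<dots> \<le> 2 * exp 16 * K1 * ((2 * A + 3 * M powr (6 / ?n)) * \<mu> powr (- 6 / ?n)) * D"
    proof (intro mult_right_mono mult_left_mono D)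
      \<comment> \<open>From \<open>R \<le> X + 1\<close> comes
        \<open>2 * R + 1 \<le> 2 * X + 3\<close>; since \<open>\<mu> \<le> M\<close>, the additive 3
        is at most a multiple of the same power of \<open>\<mu>\<close> as \<open>X\<close>.\<close>
      have "1 \<le> (M / \<mu>) powr (6 / ?n)" using \<mu> \<mu>M by (intro ge_one_powr_ge_zero) auto
      also have "\<dots> = M powr (6 / ?n) * \<mu> powr (- 6 / ?n)"
        unfolding minus powr_divide by simp
      finally show "2 * real R + 1 \<le> (2 * A + 3 * M powr (6 / ?n)) * \<mu> powr (- 6 / ?n)"
        using R(2) unfolding X by (simp add: distrib_right)
    qed (use K1 in auto)
    finally have "\<mu>\<^sup>2 * ?N \<le> C * D * \<mu> powr (- 6 / ?n)" unfolding C_def by (simp add: mult_ac)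
    then have "?N \<le> C * D * \<mu> powr (- 6 / ?n) / \<mu>\<^sup>2" using \<mu> by (simp add: pos_le_divide_eq mult.commute)
    also have "\<dots> = C * D * \<mu> powr (- (2 + 6 / ?n))"
    proof -
      have "- (2 + 6 / ?n) = - 6 / ?n + - 2" by simp
      then have "\<mu> powr (- (2 + 6 / ?n)) = \<mu> powr (- 6 / ?n + - 2)" by (rule arg_cong)
      also have "\<dots> = \<mu> powr (- 6 / ?n) * \<mu> powr (- 2)" by (rule powr_add)
      also have "\<mu> powr (- 2) = inverse (\<mu>\<^sup>2)" using \<mu> by (simp add: powr_minus powr_realpow)
      finally show ?thesis by (simp add: divide_inverse)
    qed
    finally show ?thesis .
  qed
  then show thesis using that C by blast
qed

text \<open>Apply the level set bound at the smallest value: all m elements lie above it, so it is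
  at most (K/m)^(1/q). Removing that element and repeating bounds the m-th largest value in the same
  way for each m, and the p-th powers add up.\<close>

lemma sum_powr_le_of_level_set_card:
  fixes w :: "'i \<Rightarrow> real" and p q K :: real
  assumes "finite E" "0 < q" "0 \<le> p" "0 \<le> K"
    and w: "\<And>i. i \<in> E \<Longrightarrow> 0 \<le> w i"
    and card: "\<And>E' \<mu>. E' \<subseteq> E \<Longrightarrow> 0 < \<mu> \<Longrightarrow> (\<And>i. i \<in> E' \<Longrightarrow> \<mu> \<le> w i) \<Longrightarrow> real (card E') \<le> K * \<mu> powr (- q)"
  shows "(\<Sum>i\<in>E. w i powr p) \<le> K powr (p / q) * (\<Sum>m=1..card E. real m powr (- p / q))"
  using assms(1) w card
proof (induction "card E" arbitrary: E)
  case 0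
  then show ?case by simp
next
  case (Suc N)
  then have ne: "E \<noteq> {}" by auto
  then have "Min (w ` E) \<in> w ` E" using Suc by (intro Min_in) auto
  then obtain i where i: "i \<in> E" "w i = Min (w ` E)" by auto
  have min: "w i \<le> w j" if "j \<in> E" for j using i that Suc.prems by simp
  have cardE: "card (E - {i}) = N" using Suc.hyps(2) i Suc.prems by simp
  have IH: "(\<Sum>j\<in>E - {i}. w j powr p) \<le> K powr (p / q) * (\<Sum>m=1..card (E - {i}). real m powr (- p / q))"
  proof (rule Suc.hyps(1))
    show "N = card (E - {i})" using cardE by simp
    show "real (card E') \<le> K * \<mu> powr (- q)" if "E' \<subseteq> E - {i}" "0 < \<mu>" "\<And>j. j \<in> E' \<Longrightarrow> \<mu> \<le> w j" for E' \<mu>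
      using Suc.prems(3)[of E' \<mu>] that by blast
  qed (use Suc.prems in auto)
  have "w i powr p \<le> K powr (p / q) * real (Suc N) powr (- p / q)"
  proof (cases "w i = 0")
    case False
    then have wi: "0 < w i" using Suc.prems(2)[OF i(1)] by simp
    have "real (Suc N) \<le> K * w i powr (- q)"
      using Suc.prems(3)[OF order_refl wi min] Suc.hyps(2) by simp
    then have "w i powr q \<le> K / real (Suc N)"
      using wi by (simp add: powr_minus field_simps)
    then have "(w i powr q) powr (p / q) \<le> (K / real (Suc N)) powr (p / q)"
      using assms by (intro powr_mono2) auto
    moreover have "(w i powr q) powr (p / q) = w i powr p" using assms(2) by (simp add: powr_powr)
    moreover have "(K / real (Suc N)) powr (p / q) = K powr (p / q) * real (Suc N) powr (- p / q)"
      using assms(4) by (subst powr_divide) (auto simp: powr_minus_divide)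
    ultimately show ?thesis by (simp only:)
  qed simp
  moreover have "(\<Sum>j\<in>E. w j powr p) = w i powr p + (\<Sum>j\<in>E - {i}. w j powr p)"
    using i Suc.prems by (simp add: sum.remove)
  moreover have "(\<Sum>m=1..card E. real m powr (- p / q)) = real (Suc N) powr (- p / q) + (\<Sum>m=1..N. real m powr (- p / q))"
    using Suc.hyps(2)[symmetric] by simp
  ultimately show ?case using IH unfolding cardE by (simp add: distrib_left)
qed

text \<open>The passage from weak type to a p-th power sum: \<open>p > q\<close> makes the exponent
  \<open>- p / q\<close> smaller than -1, so the series in m converges and the bound is independent
  of the number of samples.\<close>

lemma sampled_wave_sum_powr_le:
  fixes p :: real
  defines "q \<equiv> 2 + 6 / real DIM('a::euclidean_space)"
  assumes p: "p > q"
  obtains C where "0 < C"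
    "\<And>a b \<tau> (y :: 'i \<Rightarrow> 'a) G E D. sampled_wave a b G \<Longrightarrow> finite E \<Longrightarrow> 0 \<le> D \<Longrightarrow>
      (\<And>i. i \<in> E \<Longrightarrow> (\<Sum>j\<in>E. exp (- norm (y i - y j))) \<le> D) \<Longrightarrow>
      (\<Sum>i\<in>E. norm (sampled_wave.wave a b \<tau> y G i) powr p) \<le> C * D powr (p / q)"
proof -
  obtain C where C: "0 < C"
    "\<And>a b \<tau> (y :: 'i \<Rightarrow> 'a::euclidean_space) G E \<mu> D. sampled_wave a b G \<Longrightarrow> finite E \<Longrightarrow> 0 < \<mu> \<Longrightarrow>
      (\<And>i. i \<in> E \<Longrightarrow> \<mu> \<le> norm (sampled_wave.wave a b \<tau> y G i)) \<Longrightarrow> 0 \<le> D \<Longrightarrow>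
      (\<And>i. i \<in> E \<Longrightarrow> (\<Sum>j\<in>E. exp (- norm (y i - y j))) \<le> D) \<Longrightarrow>
      real (card E) \<le> C * D * \<mu> powr (- q)"
    unfolding q_def using sampled_wave_level_set_card by blast
  have q: "0 < q" unfolding q_def by (simp add: add_pos_nonneg)
  define Z where "Z = (\<Sum>m. real m powr (- p / q))"
  have sumZ: "summable (\<lambda>m. real m powr (- p / q))"
    using p q by (subst summable_real_powr_iff) (simp add: field_simps)
  have Z0: "0 \<le> Z" unfolding Z_def by (intro suminf_nonneg sumZ) auto
  have "(\<Sum>i\<in>E. norm (sampled_wave.wave a b \<tau> y G i) powr p) \<le> (C powr (p / q) * (Z + 1)) * D powr (p / q)"
    if sw: "sampled_wave a b G" and E: "finite E" and D: "0 \<le> D" "\<And>i. i \<in> E \<Longrightarrow> (\<Sum>j\<in>E. exp (- norm (y i - y j))) \<le> D"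
    for a b \<tau> and y :: "'i \<Rightarrow> 'a" and G E D
  proof -
    have "(\<Sum>i\<in>E. norm (sampled_wave.wave a b \<tau> y G i) powr p) \<le> (C * D) powr (p / q) * (\<Sum>m=1..card E. real m powr (- p / q))"
    proof (rule sum_powr_le_of_level_set_card[OF E q])
      show "real (card E') \<le> C * D * \<mu> powr (- q)"
        if "E' \<subseteq> E" "0 < \<mu>" "\<And>i. i \<in> E' \<Longrightarrow> \<mu> \<le> norm (sampled_wave.wave a b \<tau> y G i)" for E' \<mu>
      proof (rule C(2)[OF sw _ that(2,3) D(1)])
        show "finite E'" using that E finite_subset by blast
        fix i assume "i \<in> E'"
        have "(\<Sum>j\<in>E'. exp (- norm (y i - y j))) \<le> (\<Sum>j\<in>E. exp (- norm (y i - y j)))"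
          using that E by (intro sum_mono2) auto
        also have "\<dots> \<le> D" using \<open>i \<in> E'\<close> that by (intro D) auto
        finally show "(\<Sum>j\<in>E'. exp (- norm (y i - y j))) \<le> D" .
      qed
    qed (use p q C D in auto)
    also have "\<dots> \<le> (C * D) powr (p / q) * (Z + 1)"
    proof (intro mult_left_mono)
      have "(\<Sum>m=1..card E. real m powr (- p / q)) \<le> Z"
        unfolding Z_def by (intro sum_le_suminf sumZ) auto
      then show "(\<Sum>m=1..card E. real m powr (- p / q)) \<le> Z + 1" by simp
    qed simp
    also have "\<dots> = (C powr (p / q) * (Z + 1)) * D powr (p / q)"
      using C D by (simp add: powr_mult mult_ac)
    finally show ?thesis .
  qed
  moreover have "0 < C powr (p / q) * (Z + 1)" using C Z0 by (simp add: add_nonneg_pos)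
  ultimately show thesis using that by blast
qed

section \<open>Plancherel theory\<close>

text \<open>The squared L2 norm. Squares keep everything inside one nonnegative integral; the
  triangle inequality is replaced by a weighted version with a free parameter.\<close>

definition sqnorm :: "('a::euclidean_space \<Rightarrow> complex) \<Rightarrow> ennreal" where
  "sqnorm f = (\<integral>\<^sup>+x. ennreal ((norm (f x))\<^sup>2) \<partial>lborel)"

section \<open>Squared norms and their calculus\<close>

lemma enn_powr_half_square: "(enn_powr x (1/2))\<^sup>2 = x"
proof (cases x rule: ennreal_cases)
  case (real r)
  then show ?thesis
    by (simp add: enn_powr_def powr_half_sqrt ennreal_power)
qed (simp add: enn_powr_def)

lemma L2norm_square: "(L2norm f)\<^sup>2 = sqnorm f"
  unfolding L2norm_def sqnorm_def by (rule enn_powr_half_square)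

lemma enn_powr_mono: "x \<le> y \<Longrightarrow> 0 \<le> r \<Longrightarrow> enn_powr x r \<le> enn_powr y r"
  unfolding enn_powr_def
  by (auto simp: top.extremum_unique less_top intro!: ennreal_leI powr_mono2 enn2real_mono)

lemma enn_powr_ennreal: "0 \<le> x \<Longrightarrow> enn_powr (ennreal x) r = ennreal (x powr r)"
  by (simp add: enn_powr_def)

lemma L2norm_cong_sqnorm: "sqnorm f = sqnorm g \<Longrightarrow> L2norm f = L2norm g"
  unfolding L2norm_def sqnorm_def by simp

lemma L2norm_finite_iff: "L2norm f < \<infinity> \<longleftrightarrow> sqnorm f < \<infinity>"
  unfolding L2norm_square[symmetric] by (simp add: power_less_top_ennreal)

lemma ennreal_square_tendsto_0_iff:
  fixes f :: "'b \<Rightarrow> ennreal"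
  shows "((\<lambda>k. (f k)\<^sup>2) \<longlongrightarrow> 0) F \<longleftrightarrow> (f \<longlongrightarrow> 0) F"
proof
  assume A: "((\<lambda>k. (f k)\<^sup>2) \<longlongrightarrow> 0) F"
  show "(f \<longlongrightarrow> 0) F"
  proof (rule order_tendstoI)
    fix e :: ennreal assume "0 < e"
    then have "0 < e\<^sup>2" by (simp add: zero_less_iff_neq_zero)
    then have "\<forall>\<^sub>F k in F. (f k)\<^sup>2 < e\<^sup>2" using A by (rule order_tendstoD(2)[rotated])
    then show "\<forall>\<^sub>F k in F. f k < e"
      by eventually_elim (metis not_le power_mono zero_le)
  qed simp
next
  assume A: "(f \<longlongrightarrow> 0) F"
  have "((\<lambda>k. f k * f k) \<longlongrightarrow> 0 * 0) F" by (rule tendsto_mult_ennreal[OF A A]) auto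
  then show "((\<lambda>k. (f k)\<^sup>2) \<longlongrightarrow> 0) F" by (simp add: power2_eq_square)
qed

lemma L2norm_tendsto_0_iff: "((\<lambda>k. L2norm (f k)) \<longlongrightarrow> 0) F \<longleftrightarrow> ((\<lambda>k. sqnorm (f k)) \<longlongrightarrow> 0) F"
  unfolding L2norm_square[symmetric] ennreal_square_tendsto_0_iff ..

lemma norm_square_add_le:
  fixes u v :: complex and t :: real
  assumes "0 < t"
  shows "(norm (u + v))\<^sup>2 \<le> (1 + t) * (norm u)\<^sup>2 + (1 + 1 / t) * (norm v)\<^sup>2"
proof -
  have "(norm (u + v))\<^sup>2 \<le> (norm u + norm v)\<^sup>2"
    by (intro power_mono norm_triangle_ineq) auto
  also have "\<dots> = (norm u)\<^sup>2 + 2 * (norm v * norm u) + (norm v)\<^sup>2" by (simp add: power2_sum)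
  also have "norm v * norm u \<le> 1 / (2 * t) * (norm v)\<^sup>2 + t / 2 * (norm u)\<^sup>2"
    by (rule mult_le_weighted_squares[OF assms])
  finally show ?thesis by (simp add: algebra_simps)
qed

text \<open>Stands in for Minkowski's inequality. When the second term tends to zero for fixed
  \<open>t\<close>, only the factor \<open>1 + t\<close> is left, and \<open>t\<close> may then tend
  to 0 without loss.\<close>

lemma sqnorm_add_le:
  fixes f g :: "'a::euclidean_space \<Rightarrow> complex" and t :: real
  assumes t: "0 < t" and [measurable]: "f \<in> borel_measurable borel" "g \<in> borel_measurable borel"
  shows "sqnorm (\<lambda>x. f x + g x) \<le> ennreal (1 + t) * sqnorm f + ennreal (1 + 1 / t) * sqnorm g"
proof -
  have "sqnorm (\<lambda>x. f x + g x) \<le> (\<integral>\<^sup>+x. ennreal (1 + t) * ennreal ((norm (f x))\<^sup>2) + ennreal (1 + 1 / t) * ennreal ((norm (g x))\<^sup>2) \<partial>lborel)"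
    unfolding sqnorm_def using t norm_square_add_le[OF t]
    by (intro nn_integral_mono) (simp add: ennreal_mult'[symmetric] ennreal_plus[symmetric] del: ennreal_plus)
  also have "\<dots> = ennreal (1 + t) * sqnorm f + ennreal (1 + 1 / t) * sqnorm g"
    unfolding sqnorm_def by (subst nn_integral_add) (auto simp: nn_integral_cmult)
  finally show ?thesis .
qed

lemma sqnorm_cong_AE: "AE x in lborel. f x = g x \<Longrightarrow> sqnorm f = sqnorm g"
  unfolding sqnorm_def by (rule nn_integral_cong_AE) auto

lemma sqnorm_mono: "(\<And>x. norm (f x) \<le> norm (g x)) \<Longrightarrow> sqnorm f \<le> sqnorm g"
  unfolding sqnorm_def by (intro nn_integral_mono ennreal_leI power_mono) auto

lemma sqnorm_minus_commute: "sqnorm (\<lambda>x. f x - g x) = sqnorm (\<lambda>x. g x - f x)"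
  unfolding sqnorm_def by (simp add: norm_minus_commute)

lemma sqnorm_eq_0_iff:
  assumes [measurable]: "f \<in> borel_measurable borel"
  shows "sqnorm f = 0 \<longleftrightarrow> (AE x in lborel. f x = 0)"
  unfolding sqnorm_def by (subst nn_integral_0_iff_AE) auto

lemma sqnorm_finite_iff_integrable:
  assumes [measurable]: "f \<in> borel_measurable borel"
  shows "sqnorm f < \<infinity> \<longleftrightarrow> integrable lborel (\<lambda>x. (norm (f x))\<^sup>2)"
proof
  assume "sqnorm f < \<infinity>"
  then show "integrable lborel (\<lambda>x. (norm (f x))\<^sup>2)"
    unfolding sqnorm_def by (intro integrableI_bounded) auto
next
  assume "integrable lborel (\<lambda>x. (norm (f x))\<^sup>2)"
  then show "sqnorm f < \<infinity>"
    unfolding sqnorm_def integrable_iff_bounded by simp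
qed

lemma sqnorm_eq_integral:
  assumes [measurable]: "f \<in> borel_measurable borel" and "sqnorm f < \<infinity>"
  shows "sqnorm f = ennreal (LINT x|lborel. (norm (f x))\<^sup>2)"
proof -
  have "integrable lborel (\<lambda>x. (norm (f x))\<^sup>2)"
    using assms sqnorm_finite_iff_integrable by blast
  then show ?thesis unfolding sqnorm_def by (intro nn_integral_eq_integral) auto
qed

lemma sqnorm_tendsto_0_dominated:
  fixes f :: "nat \<Rightarrow> 'a::euclidean_space \<Rightarrow> complex"
  assumes [measurable]: "\<And>k. f k \<in> borel_measurable borel" "g \<in> borel_measurable borel"
    and g: "sqnorm g < \<infinity>" and dom: "\<And>k. AE x in lborel. norm (f k x) \<le> norm (g x)"
    and lim: "AE x in lborel. (\<lambda>k. f k x) \<longlonglongrightarrow> 0"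
  shows "(\<lambda>k. sqnorm (f k)) \<longlonglongrightarrow> 0"
proof -
  have "(\<lambda>k. \<integral>\<^sup>+x. ennreal ((norm (f k x))\<^sup>2) \<partial>lborel) \<longlonglongrightarrow> (\<integral>\<^sup>+(x::'a). 0 \<partial>lborel)"
  proof (rule nn_integral_dominated_convergence[where w="\<lambda>x. ennreal ((norm (g x))\<^sup>2)"])
    show "AE x in lborel. ennreal ((norm (f k x))\<^sup>2) \<le> ennreal ((norm (g x))\<^sup>2)" for k
      using dom[of k] by eventually_elim (auto intro!: ennreal_leI power_mono)
    show "AE x in lborel. (\<lambda>k. ennreal ((norm (f k x))\<^sup>2)) \<longlonglongrightarrow> 0"
      using lim
    proof eventually_elim
      case (elim x)
      then have "(\<lambda>k. (norm (f k x))\<^sup>2) \<longlonglongrightarrow> (norm (0::complex))\<^sup>2" by (intro tendsto_intros)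
      then show ?case by (simp add: ennreal_tendsto_0_iff)
    qed
  qed (use g in \<open>auto simp: sqnorm_def\<close>)
  then show ?thesis by (simp add: sqnorm_def)
qed

section \<open>Affine substitution, product integrals and the transform of the Gaussian\<close>

lemma nn_integral_lborel_affine:
  fixes f :: "'a::euclidean_space \<Rightarrow> ennreal"
  assumes [measurable]: "f \<in> borel_measurable borel" and c: "c \<noteq> 0"
  shows "(\<integral>\<^sup>+x. f x \<partial>lborel) = ennreal (\<bar>c\<bar> ^ DIM('a)) * (\<integral>\<^sup>+x. f (t + c *\<^sub>R x) \<partial>lborel)"
  by (subst lborel_affine[OF c, of t])
     (simp add: nn_integral_density nn_integral_distr nn_integral_cmult)

lemma integral_lborel_affine:
  fixes f :: "'a::euclidean_space \<Rightarrow> 'b::{banach, second_countable_topology}"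
  assumes [measurable]: "f \<in> borel_measurable borel" and c: "c \<noteq> 0"
  shows "(LINT x|lborel. f x) = (\<bar>c\<bar> ^ DIM('a)) *\<^sub>R (LINT x|lborel. f (t + c *\<^sub>R x))"
  by (subst lborel_affine[OF c, of t])
     (simp add: integral_density integral_distr)

lemma integral_lborel_prod:
  fixes f :: "'a::euclidean_space \<Rightarrow> real \<Rightarrow> complex"
  assumes "\<And>b. b \<in> Basis \<Longrightarrow> integrable lborel (f b)"
  shows "(LINT x|lborel. (\<Prod>b\<in>Basis. f b (x \<bullet> b))) = (\<Prod>b\<in>Basis. LINT x|lborel. f b x)"
proof -
  interpret product_sigma_finite "\<lambda>_::'a. lborel :: real measure" by standard
  have [measurable]: "b \<in> Basis \<Longrightarrow> f b \<in> borel_measurable borel" for b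
    using borel_measurable_integrable[OF assms] by simp
  have "(LINT x|lborel. (\<Prod>b\<in>Basis. f b (x \<bullet> b)))
      = (LINT x|distr (\<Pi>\<^sub>M b\<in>Basis. lborel) borel (\<lambda>f. \<Sum>b\<in>Basis. f b *\<^sub>R b). (\<Prod>b\<in>Basis. f b (x \<bullet> b)))"
    by (subst lborel_eq) simp
  also have "\<dots> = (LINT x|(\<Pi>\<^sub>M b\<in>Basis. lborel). (\<Prod>b\<in>Basis. f b ((\<Sum>b'\<in>Basis. x b' *\<^sub>R b') \<bullet> b)))"
    by (rule integral_distr) measurable
  also have "\<dots> = (LINT x|(\<Pi>\<^sub>M b\<in>Basis. lborel). (\<Prod>b\<in>Basis. f b (x b)))"
    by (intro Bochner_Integration.integral_cong prod.cong refl) simp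
  also have "\<dots> = (\<Prod>b\<in>Basis. LINT x|lborel. f b x)"
    by (rule product_integral_prod) (auto simp: assms)
  finally show ?thesis .
qed

text \<open>The characteristic function of the standard normal distribution, freed of the
  normalising factor of its density.\<close>

lemma integral_gaussian_cis_line:
  "(LINT s|lborel. cis (t * s) * of_real (exp (- s\<^sup>2 / 2))) = complex_of_real (sqrt (2 * pi) * exp (- t\<^sup>2 / 2))"
proof -
  have "(LINT s|lborel. cis (t * s) * of_real (exp (- s\<^sup>2 / 2))) = (LINT s|lborel. of_real (sqrt (2 * pi)) * (std_normal_density s *\<^sub>R cis (t * s)))"
    by (intro Bochner_Integration.integral_cong refl) (simp add: std_normal_density_def scaleR_conv_of_real mult_ac)
  also have "\<dots> = of_real (sqrt (2 * pi)) * (LINT s|lborel. std_normal_density s *\<^sub>R cis (t * s))"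
    by (simp only: integral_mult_right_zero)
  also have "(LINT s|lborel. std_normal_density s *\<^sub>R cis (t * s)) = char std_normal_distribution t"
    unfolding char_def cis_conv_exp by (subst integral_density) (auto simp: normal_density_nonneg)
  also have "\<dots> = of_real (exp (- t\<^sup>2 / 2))" unfolding char_std_normal_distribution by simp
  finally show ?thesis by simp
qed

lemma integral_gaussian_cis:
  fixes x :: "'a::euclidean_space"
  shows "(LINT \<xi>|lborel. cis (x \<bullet> \<xi>) * of_real (exp (- (norm \<xi>)\<^sup>2 / 2))) = complex_of_real (sqrt (2 * pi) ^ DIM('a) * exp (- (norm x)\<^sup>2 / 2))"
proof -
  have cis_prod: "cis (x \<bullet> \<xi>) = (\<Prod>b\<in>Basis. cis ((x \<bullet> b) * (\<xi> \<bullet> b)))" for \<xi>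
    unfolding cis_conv_exp by (subst euclidean_inner) (simp add: sum_distrib_left exp_sum)
  have gauss_prod: "exp (- (norm \<xi>)\<^sup>2 / 2) = (\<Prod>b\<in>Basis. exp (- (\<xi> \<bullet> b)\<^sup>2 / 2))" for \<xi> :: 'a
    using exp_neg_norm_square_prod[of "1/2" \<xi>] by simp
  have "(LINT \<xi>|lborel. cis (x \<bullet> \<xi>) * of_real (exp (- (norm \<xi>)\<^sup>2 / 2)))
      = (LINT \<xi>|lborel. (\<Prod>b\<in>Basis. cis ((x \<bullet> b) * (\<xi> \<bullet> b)) * of_real (exp (- (\<xi> \<bullet> b)\<^sup>2 / 2))))"
    unfolding cis_prod gauss_prod by (simp add: prod.distrib)
  also have "\<dots> = (\<Prod>b\<in>Basis. LINT s|lborel. cis ((x \<bullet> b) * s) * of_real (exp (- s\<^sup>2 / 2)))"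
  proof (rule integral_lborel_prod)
    show "integrable lborel (\<lambda>s. cis ((x \<bullet> b) * s) * of_real (exp (- s\<^sup>2 / 2)))" for b
      by (rule Bochner_Integration.integrable_bound[OF integrable_gaussian[of "1/2", where 'a=real]]) (auto simp: norm_mult)
  qed
  also have "\<dots> = complex_of_real (sqrt (2 * pi) ^ DIM('a) * exp (- (norm x)\<^sup>2 / 2))"
    unfolding integral_gaussian_cis_line gauss_prod by (simp add: prod.distrib)
  finally show ?thesis .
qed

section \<open>Fourier integrals of integrable functions\<close>

lemma fourier_integral_measurable[measurable]:
  assumes [measurable]: "f \<in> borel_measurable borel"
  shows "fourier_integral \<sigma> f \<in> borel_measurable borel"
proof -
  have "(\<lambda>\<xi>. LINT x|lborel. cis (\<sigma> * (x \<bullet> \<xi>)) * f x) \<in> borel_measurable borel"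
    by (rule lborel.borel_measurable_lebesgue_integral) measurable
  then show ?thesis unfolding fourier_integral_def by measurable
qed

lemma integrable_cis_mult:
  assumes "integrable M f" and [measurable]: "g \<in> borel_measurable M"
  shows "integrable M (\<lambda>x. cis (g x) * f x)"
proof -
  have [measurable]: "f \<in> borel_measurable M" using assms by simp
  show ?thesis
    by (rule Bochner_Integration.integrable_bound[OF assms(1)]) (auto simp: norm_mult)
qed

lemma fourier_integral_add:
  assumes f: "integrable lborel f" and g: "integrable lborel (g :: real ^ 'n \<Rightarrow> complex)"
  shows "fourier_integral \<sigma> (\<lambda>x. f x + g x) \<xi> = fourier_integral \<sigma> f \<xi> + fourier_integral \<sigma> g \<xi>"
proof -
  have "(LINT x|lborel. cis (\<sigma> * (x \<bullet> \<xi>)) * f x + cis (\<sigma> * (x \<bullet> \<xi>)) * g x)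
      = (LINT x|lborel. cis (\<sigma> * (x \<bullet> \<xi>)) * f x) + (LINT x|lborel. cis (\<sigma> * (x \<bullet> \<xi>)) * g x)"
    by (intro Bochner_Integration.integral_add integrable_cis_mult f g) measurable
  then show ?thesis unfolding fourier_integral_def by (simp add: distrib_left)
qed

lemma fourier_integral_uminus: "fourier_integral \<sigma> (\<lambda>x. - f x) \<xi> = - fourier_integral \<sigma> f \<xi>"
  unfolding fourier_integral_def by simp

lemma fourier_integral_diff:
  assumes f: "integrable lborel f" and g: "integrable lborel (g :: real ^ 'n \<Rightarrow> complex)"
  shows "fourier_integral \<sigma> (\<lambda>x. f x - g x) \<xi> = fourier_integral \<sigma> f \<xi> - fourier_integral \<sigma> g \<xi>"
  using fourier_integral_add[OF f Bochner_Integration.integrable_minus[OF g]] by (simp add: fourier_integral_uminus)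

lemma fourier_integral_cong_AE:
  assumes "AE x in lborel. f x = g x" "f \<in> borel_measurable borel" "g \<in> borel_measurable borel"
  shows "fourier_integral \<sigma> f = fourier_integral \<sigma> g"
proof
  fix \<xi>
  have [measurable]: "f \<in> borel_measurable borel" "g \<in> borel_measurable borel" using assms by auto
  have "(LINT x|lborel. cis (\<sigma> * (x \<bullet> \<xi>)) * f x) = (LINT x|lborel. cis (\<sigma> * (x \<bullet> \<xi>)) * g x)"
    by (rule integral_cong_AE) (use assms(1) in auto)
  then show "fourier_integral \<sigma> f \<xi> = fourier_integral \<sigma> g \<xi>"
    by (simp add: fourier_integral_def)
qed

definition fourier_const :: "'n::finite itself \<Rightarrow> real" where
  "fourier_const _ = (2 * pi) powr (- real CARD('n) / 2)"

lemma fourier_integral_alt: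
  fixes f :: "real ^ 'n \<Rightarrow> complex"
  shows "fourier_integral \<sigma> f \<xi> = of_real (fourier_const TYPE('n)) * (LINT x|lborel. cis (\<sigma> * (x \<bullet> \<xi>)) * f x)"
  by (simp add: fourier_integral_def fourier_const_def)

lemma fourier_const_pos: "0 < fourier_const TYPE('n::finite)"
  by (simp add: fourier_const_def)

lemma fourier_const_square: "(fourier_const TYPE('n::finite))\<^sup>2 * sqrt (2 * pi) ^ CARD('n) * sqrt (2 * pi) ^ CARD('n) = 1"
proof -
  have "(fourier_const TYPE('n))\<^sup>2 = (2 * pi) powr (- real CARD('n))"
    unfolding fourier_const_def by (simp add: power2_eq_square powr_add[symmetric])
  moreover have "sqrt (2 * pi) ^ CARD('n) * sqrt (2 * pi) ^ CARD('n) = (2 * pi) powr real CARD('n)"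
  proof -
    have "sqrt (2 * pi) ^ CARD('n) * sqrt (2 * pi) ^ CARD('n) = (sqrt (2 * pi) * sqrt (2 * pi)) ^ CARD('n)"
      by (rule power_mult_distrib[symmetric])
    also have "sqrt (2 * pi) * sqrt (2 * pi) = 2 * pi" by (rule real_sqrt_mult_self[THEN trans]) simp
    also have "(2 * pi) ^ CARD('n) = (2 * pi) powr real CARD('n)" by (rule powr_realpow[symmetric]) simp
    finally show ?thesis .
  qed
  moreover have "(2 * pi) powr (- real CARD('n)) * (2 * pi) powr real CARD('n) = 1"
    by (simp add: powr_add[symmetric])
  ultimately show ?thesis by (simp only: mult.assoc)
qed

lemma fourier_integral_bounded:
  fixes f :: "real ^ 'n \<Rightarrow> complex"
  assumes "integrable lborel f"
  shows "norm (fourier_integral \<sigma> f \<xi>) \<le> fourier_const TYPE('n) * (LINT x|lborel. norm (f x))"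
proof -
  have "norm (LINT x|lborel. cis (\<sigma> * (x \<bullet> \<xi>)) * f x) \<le> (LINT x|lborel. norm (cis (\<sigma> * (x \<bullet> \<xi>)) * f x))"
    by (rule integral_norm_bound)
  then show ?thesis
    unfolding fourier_integral_alt norm_mult
    using fourier_const_pos[where 'n='n] by simp
qed

text \<open>The Fourier kernel is symmetric in its two variables, so Fubini moves the transform from
  one factor to the other. This formula is the source of every energy identity below.\<close>

lemma fourier_integral_multiplication:
  fixes f g :: "real ^ 'n \<Rightarrow> complex"
  assumes f: "integrable lborel f" and g: "integrable lborel g"
  shows "(LINT \<xi>|lborel. fourier_integral \<sigma> f \<xi> * g \<xi>) = (LINT x|lborel. f x * fourier_integral \<sigma> g x)"
proof -
  have [measurable]: "f \<in> borel_measurable borel" "g \<in> borel_measurable borel"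
    using f g borel_measurable_integrable by auto
  have int: "integrable (lborel \<Otimes>\<^sub>M lborel) (\<lambda>(x, \<xi>). cis (\<sigma> * (x \<bullet> \<xi>)) * f x * g \<xi>)"
  proof (rule integrableI_bounded)
    have "(\<integral>\<^sup>+p. ennreal (norm (case p of (x, \<xi>) \<Rightarrow> cis (\<sigma> * (x \<bullet> \<xi>)) * f x * g \<xi>)) \<partial>(lborel \<Otimes>\<^sub>M lborel))
       = (\<integral>\<^sup>+x. \<integral>\<^sup>+\<xi>. ennreal (norm (f x)) * ennreal (norm (g \<xi>)) \<partial>lborel \<partial>lborel)"
      by (subst lborel.nn_integral_fst[symmetric]) (simp_all add: case_prod_beta norm_mult ennreal_mult)
    also have "\<dots> = (\<integral>\<^sup>+x. ennreal (norm (f x)) \<partial>lborel) * (\<integral>\<^sup>+\<xi>. ennreal (norm (g \<xi>)) \<partial>lborel)"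
      by (simp add: nn_integral_cmult nn_integral_multc)
    also have "\<dots> < \<infinity>"
      using f g unfolding integrable_iff_bounded by (simp add: ennreal_mult_less_top)
    finally show "(\<integral>\<^sup>+p. ennreal (norm (case p of (x, \<xi>) \<Rightarrow> cis (\<sigma> * (x \<bullet> \<xi>)) * f x * g \<xi>)) \<partial>(lborel \<Otimes>\<^sub>M lborel)) < \<infinity>" .
  qed measurable
  let ?c = "complex_of_real (fourier_const TYPE('n))"
  have "(LINT \<xi>|lborel. fourier_integral \<sigma> f \<xi> * g \<xi>) = ?c * (LINT \<xi>|lborel. LINT x|lborel. cis (\<sigma> * (x \<bullet> \<xi>)) * f x * g \<xi>)"
    unfolding fourier_integral_alt integral_mult_left_zero by (simp only: mult.assoc integral_mult_right_zero)
  also have "(LINT \<xi>|lborel. LINT x|lborel. cis (\<sigma> * (x \<bullet> \<xi>)) * f x * g \<xi>) = (LINT x|lborel. LINT \<xi>|lborel. cis (\<sigma> * (x \<bullet> \<xi>)) * f x * g \<xi>)"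
    by (rule lborel_pair.Fubini_integral[OF int])
  also have "\<dots> = (LINT x|lborel. f x * (LINT \<xi>|lborel. cis (\<sigma> * (x \<bullet> \<xi>)) * g \<xi>))"
  proof (rule Bochner_Integration.integral_cong[OF refl])
    fix x
    have "(LINT \<xi>|lborel. cis (\<sigma> * (x \<bullet> \<xi>)) * f x * g \<xi>) = (LINT \<xi>|lborel. f x * (cis (\<sigma> * (x \<bullet> \<xi>)) * g \<xi>))"
      by (simp add: mult_ac)
    then show "(LINT \<xi>|lborel. cis (\<sigma> * (x \<bullet> \<xi>)) * f x * g \<xi>) = f x * (LINT \<xi>|lborel. cis (\<sigma> * (x \<bullet> \<xi>)) * g \<xi>)"
      by (simp only: integral_mult_right_zero)
  qed
  also have "?c * \<dots> = (LINT x|lborel. f x * fourier_integral \<sigma> g x)"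
    unfolding fourier_integral_alt integral_mult_right_zero[symmetric]
    by (simp only: mult_ac inner_commute)
  finally show ?thesis .
qed

lemma cnj_fourier_integral: "cnj (fourier_integral \<sigma> f \<xi>) = fourier_integral (- \<sigma>) (\<lambda>x. cnj (f x)) \<xi>"
proof -
  have "cnj (LINT x|lborel. cis (\<sigma> * (x \<bullet> \<xi>)) * f x) = (LINT x|lborel. cnj (cis (\<sigma> * (x \<bullet> \<xi>)) * f x))"
    by (simp only: Bochner_Integration.integral_cnj)
  then show ?thesis unfolding fourier_integral_def by (simp add: cis_cnj)
qed

definition gauss_density :: "real ^ 'n \<Rightarrow> real" where
  "gauss_density w = exp (- (norm w)\<^sup>2 / 2) / sqrt (2 * pi) ^ CARD('n)"

lemma gauss_density_measurable[measurable]: "gauss_density \<in> borel_measurable borel"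
  unfolding gauss_density_def by measurable

lemma gauss_density_nonneg: "0 \<le> gauss_density w"
  unfolding gauss_density_def by simp

lemma has_bochner_integral_gauss_density: "has_bochner_integral lborel (gauss_density :: real ^ 'n \<Rightarrow> real) 1"
proof -
  have "has_bochner_integral lborel (\<lambda>w::real ^ 'n. exp (- (1/2) * (norm w)\<^sup>2) / sqrt (2 * pi) ^ CARD('n)) (sqrt (pi / (1/2)) ^ DIM(real ^ 'n) / sqrt (2 * pi) ^ CARD('n))"
    by (intro has_bochner_integral_divide_zero has_bochner_integral_gaussian) auto
  then show ?thesis by (simp add: gauss_density_def[abs_def] mult.commute)
qed

lemma integrable_gauss_density: "integrable lborel gauss_density"
  and integral_gauss_density: "(LINT w|lborel. gauss_density w) = 1"
  using has_bochner_integral_gauss_density by (auto simp: has_bochner_integral_iff)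

lemma nn_integral_gauss_density: "(\<integral>\<^sup>+w. ennreal (gauss_density w) \<partial>lborel) = 1"
  by (subst nn_integral_eq_integral) (auto simp: integrable_gauss_density integral_gauss_density gauss_density_nonneg)

text \<open>Gaussian summation of the inversion formula. Conjugation turns the transform with sign
  \<open>\<sigma>\<close> into the one with sign \<open>- \<sigma>\<close>, so transforming once
  more with the same \<open>\<sigma>\<close> inverts it; the cut-off replaces the conjugate of
  \<open>f\<close> by its Gaussian average at scale \<open>\<epsilon>\<close>.\<close>

lemma fourier_integral_gaussian_regularised:
  fixes f :: "real ^ 'n \<Rightarrow> complex"
  assumes f: "integrable lborel f" and \<epsilon>: "0 < \<epsilon>" and \<sigma>: "\<bar>\<sigma>\<bar> = 1"
  shows "fourier_integral \<sigma> (\<lambda>\<xi>. cnj (fourier_integral \<sigma> f \<xi>) * of_real (exp (- (norm (\<epsilon> *\<^sub>R \<xi>))\<^sup>2 / 2))) x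
       = (LINT w|lborel. cnj (f (x + \<epsilon> *\<^sub>R w)) * of_real (gauss_density w))"
proof -
  let ?n = "CARD('n)" and ?c = "complex_of_real (fourier_const TYPE('n))"
  have [measurable]: "f \<in> borel_measurable borel"
    using f borel_measurable_integrable by auto
  define g where "g \<xi> = complex_of_real (exp (- (norm (\<epsilon> *\<^sub>R \<xi>))\<^sup>2 / 2))" for \<xi> :: "real ^ 'n"
  have [measurable]: "g \<in> borel_measurable borel" unfolding g_def by measurable
  have gint: "integrable lborel g"
  proof (rule Bochner_Integration.integrable_bound)
    show "integrable lborel (\<lambda>\<xi>::real ^ 'n. exp (- (\<epsilon>\<^sup>2 / 2) * (norm \<xi>)\<^sup>2))"
      using \<epsilon> by (intro integrable_gaussian) auto
  qed (auto simp: g_def power_mult_distrib)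
  have gh: "(LINT \<xi>|lborel. cis (z \<bullet> \<xi>) * g \<xi>) = of_real ((1 / \<epsilon>) ^ ?n * (sqrt (2 * pi) ^ ?n * exp (- (norm (z /\<^sub>R \<epsilon>))\<^sup>2 / 2)))" for z
  proof -
    have "(LINT \<xi>|lborel. cis (z \<bullet> \<xi>) * g \<xi>) = (\<bar>1 / \<epsilon>\<bar> ^ DIM(real ^ 'n)) *\<^sub>R (LINT \<xi>|lborel. cis (z \<bullet> (0 + (1 / \<epsilon>) *\<^sub>R \<xi>)) * g (0 + (1 / \<epsilon>) *\<^sub>R \<xi>))"
      using \<epsilon> by (intro integral_lborel_affine) auto
    also have "(LINT \<xi>|lborel. cis (z \<bullet> (0 + (1 / \<epsilon>) *\<^sub>R \<xi>)) * g (0 + (1 / \<epsilon>) *\<^sub>R \<xi>))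
        = (LINT \<xi>|lborel. cis ((z /\<^sub>R \<epsilon>) \<bullet> \<xi>) * of_real (exp (- (norm \<xi>)\<^sup>2 / 2)))"
    proof (intro Bochner_Integration.integral_cong refl)
      fix \<xi> :: "real ^ 'n"
      have "z \<bullet> (0 + (1 / \<epsilon>) *\<^sub>R \<xi>) = (z /\<^sub>R \<epsilon>) \<bullet> \<xi>" by (simp add: inverse_eq_divide)
      moreover have "\<epsilon> *\<^sub>R (0 + (1 / \<epsilon>) *\<^sub>R \<xi>) = \<xi>" using \<epsilon> by simp
      ultimately show "cis (z \<bullet> (0 + (1 / \<epsilon>) *\<^sub>R \<xi>)) * g (0 + (1 / \<epsilon>) *\<^sub>R \<xi>) = cis ((z /\<^sub>R \<epsilon>) \<bullet> \<xi>) * of_real (exp (- (norm \<xi>)\<^sup>2 / 2))"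
        unfolding g_def by (simp only:)
    qed
    finally show ?thesis using \<epsilon> unfolding integral_gaussian_cis scaleR_conv_of_real of_real_mult[symmetric] by simp
  qed
  have "fourier_integral \<sigma> (\<lambda>\<xi>. cnj (fourier_integral \<sigma> f \<xi>) * g \<xi>) x
      = ?c * (LINT \<xi>|lborel. cis (\<sigma> * (\<xi> \<bullet> x)) * (fourier_integral (- \<sigma>) (\<lambda>x. cnj (f x)) \<xi> * g \<xi>))"
    unfolding fourier_integral_alt[of \<sigma> _ x] cnj_fourier_integral ..
  also have "\<dots> = ?c * (LINT \<xi>|lborel. fourier_integral (- \<sigma>) (\<lambda>x. cnj (f x)) \<xi> * (cis (\<sigma> * (\<xi> \<bullet> x)) * g \<xi>))"
    by (simp only: mult_ac)
  also have "(LINT \<xi>|lborel. fourier_integral (- \<sigma>) (\<lambda>x. cnj (f x)) \<xi> * (cis (\<sigma> * (\<xi> \<bullet> x)) * g \<xi>))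
      = (LINT y|lborel. cnj (f y) * fourier_integral (- \<sigma>) (\<lambda>\<xi>. cis (\<sigma> * (\<xi> \<bullet> x)) * g \<xi>) y)"
    by (intro fourier_integral_multiplication integrable_cis_mult gint) (use f in auto)
  also have "\<dots> = (LINT y|lborel. cnj (f y) * (?c * of_real ((1 / \<epsilon>) ^ ?n * (sqrt (2 * pi) ^ ?n * exp (- (norm ((y - x) /\<^sub>R \<epsilon>))\<^sup>2 / 2)))))"
  proof (intro Bochner_Integration.integral_cong refl arg_cong2[where f=times])
    fix y
    have "cis (- \<sigma> * (\<xi> \<bullet> y)) * (cis (\<sigma> * (\<xi> \<bullet> x)) * g \<xi>) = cis ((\<sigma> *\<^sub>R (x - y)) \<bullet> \<xi>) * g \<xi>" for \<xi>
    proof -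
      have "cis (- \<sigma> * (\<xi> \<bullet> y)) * cis (\<sigma> * (\<xi> \<bullet> x)) = cis ((\<sigma> *\<^sub>R (x - y)) \<bullet> \<xi>)"
        unfolding cis_mult by (rule arg_cong[where f=cis]) (simp add: inner_diff_left inner_commute algebra_simps)
      then show ?thesis by (simp only: mult.assoc[symmetric])
    qed
    then have "fourier_integral (- \<sigma>) (\<lambda>\<xi>. cis (\<sigma> * (\<xi> \<bullet> x)) * g \<xi>) y = ?c * (LINT \<xi>|lborel. cis ((\<sigma> *\<^sub>R (x - y)) \<bullet> \<xi>) * g \<xi>)"
      unfolding fourier_integral_alt by presburger
    moreover have "norm ((\<sigma> *\<^sub>R (x - y)) /\<^sub>R \<epsilon>) = norm ((y - x) /\<^sub>R \<epsilon>)"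
      using \<sigma> by (simp add: norm_minus_commute abs_mult)
    ultimately show "fourier_integral (- \<sigma>) (\<lambda>\<xi>. cis (\<sigma> * (\<xi> \<bullet> x)) * g \<xi>) y = ?c * of_real ((1 / \<epsilon>) ^ ?n * (sqrt (2 * pi) ^ ?n * exp (- (norm ((y - x) /\<^sub>R \<epsilon>))\<^sup>2 / 2)))"
      unfolding gh by presburger
  qed
  \<comment> \<open>Substitution y = x + \<open>\<epsilon>\<close> w; its Jacobian cancels the power
    of \<open>1 / \<epsilon>\<close> from the transform of the cut-off.\<close>
  also have "\<dots> = (\<bar>\<epsilon>\<bar> ^ DIM(real ^ 'n)) *\<^sub>R (LINT w|lborel. cnj (f (x + \<epsilon> *\<^sub>R w)) * (?c * of_real ((1 / \<epsilon>) ^ ?n * (sqrt (2 * pi) ^ ?n * exp (- (norm (((x + \<epsilon> *\<^sub>R w) - x) /\<^sub>R \<epsilon>))\<^sup>2 / 2)))))"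
    using \<epsilon> by (intro integral_lborel_affine) auto
  also have "\<dots> = (LINT w|lborel. of_real (\<epsilon> ^ ?n) * (cnj (f (x + \<epsilon> *\<^sub>R w)) * (?c * of_real ((1 / \<epsilon>) ^ ?n * (sqrt (2 * pi) ^ ?n * exp (- (norm w)\<^sup>2 / 2))))))"
  proof -
    have "((x + \<epsilon> *\<^sub>R w) - x) /\<^sub>R \<epsilon> = w" for w using \<epsilon> by simp
    then show ?thesis using \<epsilon> unfolding scaleR_conv_of_real[where 'a=complex] integral_mult_right_zero by simp
  qed
  also have "?c * \<dots> = (LINT w|lborel. ?c * (of_real (\<epsilon> ^ ?n) * (cnj (f (x + \<epsilon> *\<^sub>R w)) * (?c * of_real ((1 / \<epsilon>) ^ ?n * (sqrt (2 * pi) ^ ?n * exp (- (norm w)\<^sup>2 / 2)))))))"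
    by (simp only: integral_mult_right_zero)
  also have "\<dots> = (LINT w|lborel. cnj (f (x + \<epsilon> *\<^sub>R w)) * of_real (gauss_density w))"
  proof (intro Bochner_Integration.integral_cong refl)
    fix w :: "real ^ 'n"
    let ?r = "sqrt (2 * pi) ^ ?n"
    have r: "?r \<noteq> 0" by simp
    have 1: "(fourier_const TYPE('n))\<^sup>2 * ?r = 1 / ?r"
      by (rule eq_divide_imp[OF r fourier_const_square])
    have 2: "\<epsilon> ^ ?n * (1 / \<epsilon>) ^ ?n = 1" using \<epsilon> by (simp add: power_one_over)
    have "fourier_const TYPE('n) * fourier_const TYPE('n) * (\<epsilon> ^ ?n * (1 / \<epsilon>) ^ ?n) * ?r * exp (- (norm w)\<^sup>2 / 2)
        = ((fourier_const TYPE('n))\<^sup>2 * ?r) * (\<epsilon> ^ ?n * (1 / \<epsilon>) ^ ?n) * exp (- (norm w)\<^sup>2 / 2)"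
      by (simp only: power2_eq_square mult_ac)
    also have "\<dots> = gauss_density w"
      unfolding gauss_density_def 1 2 by (simp only: mult_1_right times_divide_eq_left mult_1)
    finally have e: "fourier_const TYPE('n) * fourier_const TYPE('n) * (\<epsilon> ^ ?n * (1 / \<epsilon>) ^ ?n) * ?r * exp (- (norm w)\<^sup>2 / 2) = gauss_density w" .
    show "?c * (of_real (\<epsilon> ^ ?n) * (cnj (f (x + \<epsilon> *\<^sub>R w)) * (?c * of_real ((1 / \<epsilon>) ^ ?n * (?r * exp (- (norm w)\<^sup>2 / 2))))))
        = cnj (f (x + \<epsilon> *\<^sub>R w)) * of_real (gauss_density w)"
    proof -
      have "?c * (u * (v * (?c * of_real (A * (?r * B))))) = v * (u * of_real (fourier_const TYPE('n) * fourier_const TYPE('n) * A * ?r * B))" for u v :: complex and A B :: real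
        by simp
      from this[of "of_real (\<epsilon> ^ ?n)"] show ?thesis
        unfolding e[symmetric] by simp
    qed
  qed
  finally show ?thesis unfolding g_def .
qed

section \<open>Energy of the transform under a Gaussian cut-off\<close>

lemma integrable_gaussian_cutoff:
  assumes "0 < \<epsilon>"
  shows "integrable lborel (\<lambda>\<xi>::real ^ 'n. exp (- (norm (\<epsilon> *\<^sub>R \<xi>))\<^sup>2 / 2))"
proof -
  have "integrable lborel (\<lambda>\<xi>::real ^ 'n. exp (- (\<epsilon>\<^sup>2 / 2) * (norm \<xi>)\<^sup>2))"
    using assms by (intro integrable_gaussian) auto
  then show ?thesis by (simp add: power_mult_distrib)
qed

text \<open>The transform of an integrable function is bounded, so with the cut-off its conjugate is
  integrable and the multiplication formula applies to \<open>f\<close> and this conjugate.\<close>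

lemma regularised_energy:
  fixes f :: "real ^ 'n \<Rightarrow> complex"
  assumes f: "integrable lborel f" and \<epsilon>: "0 < \<epsilon>" and \<sigma>: "\<bar>\<sigma>\<bar> = 1"
  shows "complex_of_real (LINT \<xi>|lborel. (norm (fourier_integral \<sigma> f \<xi>))\<^sup>2 * exp (- (norm (\<epsilon> *\<^sub>R \<xi>))\<^sup>2 / 2))
       = (LINT x|lborel. f x * (LINT w|lborel. cnj (f (x + \<epsilon> *\<^sub>R w)) * of_real (gauss_density w)))"
    and "integrable lborel (\<lambda>\<xi>. (norm (fourier_integral \<sigma> f \<xi>))\<^sup>2 * exp (- (norm (\<epsilon> *\<^sub>R \<xi>))\<^sup>2 / 2))"
proof -
  have [measurable]: "f \<in> borel_measurable borel"
    using f borel_measurable_integrable by auto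
  define B where "B = fourier_const TYPE('n) * (LINT x|lborel. norm (f x))"
  have B: "norm (fourier_integral \<sigma> f \<xi>) \<le> B" for \<xi>
    unfolding B_def by (rule fourier_integral_bounded[OF f])
  have B0: "0 \<le> B" using B[of 0] norm_ge_zero order_trans by blast
  have int1: "integrable lborel (\<lambda>\<xi>. cnj (fourier_integral \<sigma> f \<xi>) * of_real (exp (- (norm (\<epsilon> *\<^sub>R \<xi>))\<^sup>2 / 2)))"
  proof (rule Bochner_Integration.integrable_bound)
    show "integrable lborel (\<lambda>\<xi>::real ^ 'n. B * exp (- (norm (\<epsilon> *\<^sub>R \<xi>))\<^sup>2 / 2))"
      by (intro integrable_mult_right integrable_gaussian_cutoff \<epsilon>)
    show "AE \<xi> in lborel. norm (cnj (fourier_integral \<sigma> f \<xi>) * of_real (exp (- (norm (\<epsilon> *\<^sub>R \<xi>))\<^sup>2 / 2))) \<le> norm (B * exp (- (norm (\<epsilon> *\<^sub>R \<xi>))\<^sup>2 / 2))"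
      using B B0 by (intro AE_I2) (auto simp: norm_mult intro!: mult_right_mono)
  qed measurable
  show "integrable lborel (\<lambda>\<xi>. (norm (fourier_integral \<sigma> f \<xi>))\<^sup>2 * exp (- (norm (\<epsilon> *\<^sub>R \<xi>))\<^sup>2 / 2))"
  proof (rule Bochner_Integration.integrable_bound)
    show "integrable lborel (\<lambda>\<xi>::real ^ 'n. B\<^sup>2 * exp (- (norm (\<epsilon> *\<^sub>R \<xi>))\<^sup>2 / 2))"
      by (intro integrable_mult_right integrable_gaussian_cutoff \<epsilon>)
    show "AE \<xi> in lborel. norm ((norm (fourier_integral \<sigma> f \<xi>))\<^sup>2 * exp (- (norm (\<epsilon> *\<^sub>R \<xi>))\<^sup>2 / 2)) \<le> norm (B\<^sup>2 * exp (- (norm (\<epsilon> *\<^sub>R \<xi>))\<^sup>2 / 2))"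
      using B by (intro AE_I2) (auto simp: norm_mult intro!: mult_right_mono power_mono)
  qed measurable
  have "complex_of_real (LINT \<xi>|lborel. (norm (fourier_integral \<sigma> f \<xi>))\<^sup>2 * exp (- (norm (\<epsilon> *\<^sub>R \<xi>))\<^sup>2 / 2))
      = (LINT \<xi>|lborel. fourier_integral \<sigma> f \<xi> * (cnj (fourier_integral \<sigma> f \<xi>) * of_real (exp (- (norm (\<epsilon> *\<^sub>R \<xi>))\<^sup>2 / 2))))"
    unfolding integral_complex_of_real[symmetric] of_real_mult complex_norm_square by (simp only: mult.assoc)
  also have "\<dots> = (LINT x|lborel. f x * fourier_integral \<sigma> (\<lambda>\<xi>. cnj (fourier_integral \<sigma> f \<xi>) * of_real (exp (- (norm (\<epsilon> *\<^sub>R \<xi>))\<^sup>2 / 2))) x)"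
    by (rule fourier_integral_multiplication[OF f int1])
  also have "\<dots> = (LINT x|lborel. f x * (LINT w|lborel. cnj (f (x + \<epsilon> *\<^sub>R w)) * of_real (gauss_density w)))"
    unfolding fourier_integral_gaussian_regularised[OF f \<epsilon> \<sigma>] ..
  finally show "complex_of_real (LINT \<xi>|lborel. (norm (fourier_integral \<sigma> f \<xi>))\<^sup>2 * exp (- (norm (\<epsilon> *\<^sub>R \<xi>))\<^sup>2 / 2))
       = (LINT x|lborel. f x * (LINT w|lborel. cnj (f (x + \<epsilon> *\<^sub>R w)) * of_real (gauss_density w)))" .
qed

text \<open>AM-GM inside the Gaussian average: the product of the values at x and at x +
  \<open>\<epsilon>\<close> w is at most half the sum of the squares, and both squares integrate to
  \<open>sqnorm f\<close>, the second by translation invariance.\<close>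

lemma regularised_energy_le:
  fixes f :: "real ^ 'n \<Rightarrow> complex"
  assumes f: "integrable lborel f" and \<epsilon>: "0 < \<epsilon>" and \<sigma>: "\<bar>\<sigma>\<bar> = 1"
  shows "ennreal (LINT \<xi>|lborel. (norm (fourier_integral \<sigma> f \<xi>))\<^sup>2 * exp (- (norm (\<epsilon> *\<^sub>R \<xi>))\<^sup>2 / 2)) \<le> sqnorm f"
proof -
  have [measurable]: "f \<in> borel_measurable borel"
    using f borel_measurable_integrable by auto
  let ?E = "LINT \<xi>|lborel. (norm (fourier_integral \<sigma> f \<xi>))\<^sup>2 * exp (- (norm (\<epsilon> *\<^sub>R \<xi>))\<^sup>2 / 2)"
  have "0 \<le> ?E" by (intro integral_nonneg_AE) auto
  then have "ennreal ?E = ennreal (norm (complex_of_real ?E))" by simp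
  also have "\<dots> \<le> (\<integral>\<^sup>+x. ennreal (norm (f x * (LINT w|lborel. cnj (f (x + \<epsilon> *\<^sub>R w)) * of_real (gauss_density w)))) \<partial>lborel)"
    unfolding regularised_energy(1)[OF f \<epsilon> \<sigma>] by (rule integral_norm_bound_ennreal')
  also have "\<dots> \<le> (\<integral>\<^sup>+x. \<integral>\<^sup>+w. ennreal (1/2) * (ennreal ((norm (f x))\<^sup>2) * ennreal (gauss_density w) + ennreal ((norm (f (x + \<epsilon> *\<^sub>R w)))\<^sup>2) * ennreal (gauss_density w)) \<partial>lborel \<partial>lborel)"
  proof (rule nn_integral_mono)
    fix x
    have "ennreal (norm (f x * (LINT w|lborel. cnj (f (x + \<epsilon> *\<^sub>R w)) * of_real (gauss_density w))))
        \<le> ennreal (norm (f x)) * (\<integral>\<^sup>+w. ennreal (norm (cnj (f (x + \<epsilon> *\<^sub>R w)) * of_real (gauss_density w))) \<partial>lborel)"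
      unfolding norm_mult[of "f x"] ennreal_mult'[OF norm_ge_zero]
      by (intro mult_left_mono integral_norm_bound_ennreal') auto
    also have "\<dots> = (\<integral>\<^sup>+w. ennreal (norm (f x)) * ennreal (norm (cnj (f (x + \<epsilon> *\<^sub>R w)) * of_real (gauss_density w))) \<partial>lborel)"
      by (rule nn_integral_cmult[symmetric]) measurable
    also have "\<dots> \<le> (\<integral>\<^sup>+w. ennreal (1/2) * (ennreal ((norm (f x))\<^sup>2) * ennreal (gauss_density w) + ennreal ((norm (f (x + \<epsilon> *\<^sub>R w)))\<^sup>2) * ennreal (gauss_density w)) \<partial>lborel)"
    proof (rule nn_integral_mono)
      fix w
      let ?a = "norm (f x)" and ?b = "norm (f (x + \<epsilon> *\<^sub>R w))" and ?g = "gauss_density w"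
      have "?a * ?b \<le> 1/2 * (?a\<^sup>2 + ?b\<^sup>2)"
        using zero_le_power2[of "?a - ?b"] by (simp add: power2_diff)
      then have "(?a * ?b) * ?g \<le> (1/2 * (?a\<^sup>2 + ?b\<^sup>2)) * ?g"
        by (intro mult_right_mono gauss_density_nonneg)
      then have "?a * (?b * ?g) \<le> 1/2 * (?a\<^sup>2 * ?g + ?b\<^sup>2 * ?g)" by (simp add: algebra_simps)
      then have "ennreal (?a * (?b * ?g)) \<le> ennreal (1/2 * (?a\<^sup>2 * ?g + ?b\<^sup>2 * ?g))" by (rule ennreal_leI)
      then show "ennreal ?a * ennreal (norm (cnj (f (x + \<epsilon> *\<^sub>R w)) * of_real ?g)) \<le> ennreal (1/2) * (ennreal (?a\<^sup>2) * ennreal ?g + ennreal (?b\<^sup>2) * ennreal ?g)"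
      proof -
        have g: "0 \<le> ?g" by (rule gauss_density_nonneg)
        have "ennreal (1/2 * (?a\<^sup>2 * ?g + ?b\<^sup>2 * ?g)) = ennreal (1/2) * ennreal (?a\<^sup>2 * ?g + ?b\<^sup>2 * ?g)"
          by (rule ennreal_mult') simp
        also have "ennreal (?a\<^sup>2 * ?g + ?b\<^sup>2 * ?g) = ennreal (?a\<^sup>2 * ?g) + ennreal (?b\<^sup>2 * ?g)"
          using g by (intro ennreal_plus) auto
        also have "ennreal (?a\<^sup>2 * ?g) = ennreal (?a\<^sup>2) * ennreal ?g" by (rule ennreal_mult') simp
        also have "ennreal (?b\<^sup>2 * ?g) = ennreal (?b\<^sup>2) * ennreal ?g" by (rule ennreal_mult') simp
        finally have "ennreal (?a * (?b * ?g)) \<le> ennreal (1/2) * (ennreal (?a\<^sup>2) * ennreal ?g + ennreal (?b\<^sup>2) * ennreal ?g)"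
          using \<open>ennreal (?a * (?b * ?g)) \<le> _\<close> by (simp only:)
        then show ?thesis using g by (simp add: norm_mult ennreal_mult')
      qed
    qed
    finally show "ennreal (norm (f x * (LINT w|lborel. cnj (f (x + \<epsilon> *\<^sub>R w)) * of_real (gauss_density w))))
        \<le> (\<integral>\<^sup>+w. ennreal (1/2) * (ennreal ((norm (f x))\<^sup>2) * ennreal (gauss_density w) + ennreal ((norm (f (x + \<epsilon> *\<^sub>R w)))\<^sup>2) * ennreal (gauss_density w)) \<partial>lborel)" .
  qed
  also have "\<dots> = ennreal (1/2) * ((\<integral>\<^sup>+x. \<integral>\<^sup>+(w::real ^ 'n). ennreal ((norm (f x))\<^sup>2) * ennreal (gauss_density w) \<partial>lborel \<partial>lborel)
      + (\<integral>\<^sup>+x. \<integral>\<^sup>+w. ennreal ((norm (f (x + \<epsilon> *\<^sub>R w)))\<^sup>2) * ennreal (gauss_density w) \<partial>lborel \<partial>lborel))"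
    by (simp add: nn_integral_cmult nn_integral_add)
  also have "(\<integral>\<^sup>+x. \<integral>\<^sup>+(w::real ^ 'n). ennreal ((norm (f x))\<^sup>2) * ennreal (gauss_density w) \<partial>lborel \<partial>lborel) = sqnorm f"
    by (simp add: nn_integral_cmult nn_integral_gauss_density sqnorm_def)
  also have "(\<integral>\<^sup>+x. \<integral>\<^sup>+w. ennreal ((norm (f (x + \<epsilon> *\<^sub>R w)))\<^sup>2) * ennreal (gauss_density w) \<partial>lborel \<partial>lborel)
      = (\<integral>\<^sup>+w. \<integral>\<^sup>+x. ennreal ((norm (f (x + \<epsilon> *\<^sub>R w)))\<^sup>2) * ennreal (gauss_density w) \<partial>lborel \<partial>lborel)"
    by (rule lborel_pair.Fubini'[symmetric]) measurable
  also have "\<dots> = (\<integral>\<^sup>+w. sqnorm f * ennreal (gauss_density (w :: real ^ 'n)) \<partial>lborel)"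
  proof (rule nn_integral_cong)
    fix w
    have "(\<integral>\<^sup>+x. ennreal ((norm (f (\<epsilon> *\<^sub>R w + x)))\<^sup>2) \<partial>lborel) = sqnorm f"
      unfolding sqnorm_def by (rule nn_integral_lborel_translate) measurable
    then show "(\<integral>\<^sup>+x. ennreal ((norm (f (x + \<epsilon> *\<^sub>R w)))\<^sup>2) * ennreal (gauss_density w) \<partial>lborel) = sqnorm f * ennreal (gauss_density w)"
      by (subst nn_integral_multc) (auto simp: add.commute)
  qed
  also have "\<dots> = sqnorm f" by (simp add: nn_integral_cmult nn_integral_gauss_density)
  also have "ennreal (1/2) * (sqnorm f + sqnorm f) = sqnorm f"
  proof -
    have "ennreal (1/2) * 2 = 1" using ennreal_mult[of "1/2" 2] by simp
    then show ?thesis by (simp only: mult_2[symmetric] mult.assoc[symmetric] mult_1)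
  qed
  finally show ?thesis .
qed

text \<open>Monotone convergence as the cut-off widens. The contraction is the tool by which
  everything later passes from a dense class to all of L2.\<close>

lemma sqnorm_fourier_integral_le:
  fixes f :: "real ^ 'n \<Rightarrow> complex"
  assumes f: "integrable lborel f" and \<sigma>: "\<bar>\<sigma>\<bar> = 1"
  shows "sqnorm (fourier_integral \<sigma> f) \<le> sqnorm f"
proof -
  have [measurable]: "f \<in> borel_measurable borel"
    using f borel_measurable_integrable by auto
  let ?F = "\<lambda>k \<xi>. ennreal ((norm (fourier_integral \<sigma> f \<xi>))\<^sup>2 * exp (- (norm ((1 / real (Suc k)) *\<^sub>R \<xi>))\<^sup>2 / 2))"
  have "(\<lambda>k. \<integral>\<^sup>+\<xi>. ?F k \<xi> \<partial>lborel) \<longlonglongrightarrow> (\<integral>\<^sup>+\<xi>. ennreal ((norm (fourier_integral \<sigma> f \<xi>))\<^sup>2) \<partial>lborel)"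
  proof (rule nn_integral_LIMSEQ)
    show "incseq ?F"
    proof (intro incseq_SucI le_funI ennreal_leI mult_left_mono)
      fix k and \<xi> :: "real ^ 'n"
      have "norm ((1 / real (Suc (Suc k))) *\<^sub>R \<xi>) \<le> norm ((1 / real (Suc k)) *\<^sub>R \<xi>)"
        unfolding norm_scaleR by (intro mult_right_mono) (auto simp: field_simps)
      then have "(norm ((1 / real (Suc (Suc k))) *\<^sub>R \<xi>))\<^sup>2 \<le> (norm ((1 / real (Suc k)) *\<^sub>R \<xi>))\<^sup>2"
        by (intro power_mono) auto
      then show "exp (- (norm ((1 / real (Suc k)) *\<^sub>R \<xi>))\<^sup>2 / 2) \<le> exp (- (norm ((1 / real (Suc (Suc k))) *\<^sub>R \<xi>))\<^sup>2 / 2)"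
        unfolding exp_le_cancel_iff by linarith
    qed auto
    fix \<xi> :: "real ^ 'n"
    have "(\<lambda>k. 1 / real (Suc k)) \<longlonglongrightarrow> 0" by (rule lim_1_over_n[THEN LIMSEQ_Suc])
    then have "(\<lambda>k. (norm (fourier_integral \<sigma> f \<xi>))\<^sup>2 * exp (- (norm ((1 / real (Suc k)) *\<^sub>R \<xi>))\<^sup>2 / 2))
        \<longlonglongrightarrow> (norm (fourier_integral \<sigma> f \<xi>))\<^sup>2 * exp (- (norm (0 *\<^sub>R \<xi>))\<^sup>2 / 2)"
      by (intro tendsto_intros) auto
    then show "(\<lambda>k. ?F k \<xi>) \<longlonglongrightarrow> ennreal ((norm (fourier_integral \<sigma> f \<xi>))\<^sup>2)"
      by (intro tendsto_ennrealI) simp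
  qed measurable
  moreover have "(\<integral>\<^sup>+\<xi>. ?F k \<xi> \<partial>lborel) \<le> sqnorm f" for k
    using regularised_energy(2)[OF f _ \<sigma>, of "1 / real (Suc k)"] regularised_energy_le[OF f _ \<sigma>, of "1 / real (Suc k)"]
    by (subst nn_integral_eq_integral) auto
  ultimately show ?thesis unfolding sqnorm_def[of "fourier_integral _ _"] by (intro LIMSEQ_le_const2) auto
qed

text \<open>Continuity makes the Gaussian averages converge to the conjugate of \<open>f\<close> at
  every point, so the regularised energies tend to the full squared norm of \<open>f\<close>; each
  of them is at most the energy of the transform, because the cut-off is at most 1.\<close>

lemma sqnorm_fourier_integral_ge_continuous:
  fixes f :: "real ^ 'n \<Rightarrow> complex"
  assumes f: "integrable lborel f" and \<sigma>: "\<bar>\<sigma>\<bar> = 1" and cont: "continuous_on UNIV f" and B: "\<And>x. norm (f x) \<le> B"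
    and fin: "sqnorm f < \<infinity>"
  shows "sqnorm f \<le> sqnorm (fourier_integral \<sigma> f)"
proof -
  have [measurable]: "f \<in> borel_measurable borel"
    using f borel_measurable_integrable by auto
  have B0: "0 \<le> B" using B[of 0] norm_ge_zero order_trans by blast
  define \<epsilon> where "\<epsilon> k = 1 / real (Suc k)" for k
  have \<epsilon>: "0 < \<epsilon> k" for k by (simp add: \<epsilon>_def)
  have \<epsilon>0: "\<epsilon> \<longlonglongrightarrow> 0" unfolding \<epsilon>_def by (rule lim_1_over_n[THEN LIMSEQ_Suc])
  define P where "P k x = (LINT w|lborel. cnj (f (x + \<epsilon> k *\<^sub>R w)) * of_real (gauss_density w))" for k x
  have Bg: "integrable lborel (\<lambda>w::real ^ 'n. B * gauss_density w)" by (intro integrable_mult_right integrable_gauss_density)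
  have dom: "norm (cnj (f (x + \<epsilon> k *\<^sub>R w)) * of_real (gauss_density w)) \<le> B * gauss_density w" for x k w
    using B[of "x + \<epsilon> k *\<^sub>R w"] gauss_density_nonneg[of w] by (auto simp: norm_mult intro!: mult_right_mono)
  have P_bound: "norm (P k x) \<le> B" for k x
  proof -
    have "norm (P k x) \<le> (LINT w|lborel. B * gauss_density (w :: real ^ 'n))"
      unfolding P_def
    proof (rule order_trans[OF integral_norm_bound integral_mono])
      show "integrable lborel (\<lambda>w. norm (cnj (f (x + \<epsilon> k *\<^sub>R w)) * complex_of_real (gauss_density w)))"
        by (rule Bochner_Integration.integrable_bound[OF Bg])
           (auto simp del: norm_mult intro!: AE_I2 order_trans[OF dom abs_ge_self])
    qed (use Bg dom in auto)
    then show ?thesis by (simp add: integral_gauss_density)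
  qed
  have P_lim: "(\<lambda>k. P k x) \<longlonglongrightarrow> cnj (f x)" for x
  proof -
    have "(\<lambda>k. P k x) \<longlonglongrightarrow> (LINT w|lborel. cnj (f x) * of_real (gauss_density (w :: real ^ 'n)))"
      unfolding P_def
    proof (rule integral_dominated_convergence[OF _ _ Bg])
      show "AE w in lborel. (\<lambda>k. cnj (f (x + \<epsilon> k *\<^sub>R w)) * complex_of_real (gauss_density w)) \<longlonglongrightarrow> cnj (f x) * complex_of_real (gauss_density w)"
      proof (intro AE_I2 tendsto_intros)
        fix w
        have "(\<lambda>k. x + \<epsilon> k *\<^sub>R w) \<longlonglongrightarrow> x + 0 *\<^sub>R w" by (intro tendsto_intros \<epsilon>0)
        then show "(\<lambda>k. f (x + \<epsilon> k *\<^sub>R w)) \<longlonglongrightarrow> f x"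
          using cont by (intro isCont_tendsto_compose[where g=f]) (auto simp: continuous_on_eq_continuous_at)
      qed
    qed (use dom in auto)
    also have "(LINT w|lborel. cnj (f x) * complex_of_real (gauss_density (w :: real ^ 'n))) = cnj (f x)"
      by (simp add: integral_gauss_density)
    finally show ?thesis .
  qed
  have P_meas[measurable]: "P k \<in> borel_measurable borel" for k
  proof -
    have "(\<lambda>x. LINT w|lborel. cnj (f (x + \<epsilon> k *\<^sub>R w)) * of_real (gauss_density w)) \<in> borel_measurable borel"
      by (rule lborel.borel_measurable_lebesgue_integral) measurable
    then show ?thesis unfolding P_def[abs_def] .
  qed
  define I where "I k = (LINT \<xi>|lborel. (norm (fourier_integral \<sigma> f \<xi>))\<^sup>2 * exp (- (norm (\<epsilon> k *\<^sub>R \<xi>))\<^sup>2 / 2))" for k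
  have I: "complex_of_real (I k) = (LINT x|lborel. f x * P k x)" for k
    unfolding I_def P_def by (rule regularised_energy(1)[OF f \<epsilon> \<sigma>])
  have "(\<lambda>k. complex_of_real (I k)) \<longlonglongrightarrow> (LINT x|lborel. f x * cnj (f x))"
    unfolding I
  proof (rule integral_dominated_convergence)
    show "integrable lborel (\<lambda>x. B * norm (f x))" using f by auto
    show "AE x in lborel. norm (f x * P k x) \<le> B * norm (f x)" for k
      using P_bound[of k] by (auto simp: norm_mult mult.commute[of _ "norm (P _ _)"] intro!: mult_right_mono)
    show "AE x in lborel. (\<lambda>k. f x * P k x) \<longlonglongrightarrow> f x * cnj (f x)"
      by (intro AE_I2 tendsto_intros P_lim)
  qed measurable
  also have "(LINT x|lborel. f x * cnj (f x)) = complex_of_real (LINT x|lborel. (norm (f x))\<^sup>2)"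
    unfolding complex_norm_square[symmetric] by (rule integral_complex_of_real)
  finally have lim: "I \<longlonglongrightarrow> (LINT x|lborel. (norm (f x))\<^sup>2)" unfolding tendsto_of_real_iff .
  have fin': "sqnorm (fourier_integral \<sigma> f) < \<infinity>"
    using sqnorm_fourier_integral_le[OF f \<sigma>] fin by (rule order.strict_trans1)
  have "I k \<le> (LINT \<xi>|lborel. (norm (fourier_integral \<sigma> f \<xi>))\<^sup>2)" for k
    unfolding I_def
  proof (rule integral_mono)
    show "integrable lborel (\<lambda>\<xi>. (norm (fourier_integral \<sigma> f \<xi>))\<^sup>2 * exp (- (norm (\<epsilon> k *\<^sub>R \<xi>))\<^sup>2 / 2))"
      by (rule regularised_energy(2)[OF f \<epsilon> \<sigma>])
    show "integrable lborel (\<lambda>\<xi>. (norm (fourier_integral \<sigma> f \<xi>))\<^sup>2)"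
      using fin' by (subst sqnorm_finite_iff_integrable[symmetric]) auto
  qed (auto intro!: mult_left_le)
  then have "(LINT x|lborel. (norm (f x))\<^sup>2) \<le> (LINT \<xi>|lborel. (norm (fourier_integral \<sigma> f \<xi>))\<^sup>2)"
    by (intro LIMSEQ_le_const2[OF lim]) auto
  then show ?thesis
    using fin fin' by (subst (1 2) sqnorm_eq_integral) (auto intro: ennreal_leI)
qed

section \<open>The Plancherel identity by approximation\<close>

lemma sqnorm_bounded_support_finite:
  fixes f :: "'a::euclidean_space \<Rightarrow> complex"
  assumes [measurable]: "f \<in> borel_measurable borel"
    and B: "\<And>x. norm (f x) \<le> B" and R: "\<And>x. R < norm x \<Longrightarrow> f x = 0"
  shows "sqnorm f < \<infinity>" "integrable lborel f"
proof -
  have B0: "0 \<le> B" using B[of 0] norm_ge_zero order_trans by blast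
  have ind: "norm (f x) \<le> B * indicator (cball 0 R) x" for x
    using B R[of x] by (auto simp: indicator_def)
  have fin: "emeasure lborel (cball (0::'a) R) < \<infinity>" by (rule emeasure_bounded_finite) simp
  have int: "integrable lborel (\<lambda>x::'a. B * indicator (cball 0 R) x)"
    by (intro integrable_mult_right integrable_real_indicator fin) auto
  show "integrable lborel f"
    by (rule Bochner_Integration.integrable_bound[OF int]) (auto intro!: AE_I2 order_trans[OF ind abs_ge_self])
  have "sqnorm f \<le> (\<integral>\<^sup>+(x::'a). ennreal (B\<^sup>2) * indicator (cball 0 R) x \<partial>lborel)"
    unfolding sqnorm_def
  proof (rule nn_integral_mono)
    fix x
    show "ennreal ((norm (f x))\<^sup>2) \<le> ennreal (B\<^sup>2) * indicator (cball 0 R) x"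
      using B R[of x] by (auto simp: indicator_def intro!: ennreal_leI power_mono)
  qed
  also have "\<dots> < \<infinity>" using fin by (simp add: nn_integral_cmult_indicator ennreal_mult_less_top)
  finally show "sqnorm f < \<infinity>" .
qed

text \<open>A measurable function is an almost everywhere limit of continuous ones. Clamping and
  cutting off these makes dominated convergence applicable; a single \<open>m\<close> bounds both
  the values and the support.\<close>

lemma bounded_function_approx_continuous:
  fixes f :: "'a::euclidean_space \<Rightarrow> complex" and m :: real
  assumes f[measurable]: "f \<in> borel_measurable borel" and m: "0 < m"
    and B: "\<And>x. norm (f x) \<le> m" and R: "\<And>x. m < norm x \<Longrightarrow> f x = 0"
  obtains h where "\<And>j. continuous_on UNIV (h j)" "\<And>j x. norm (h j x) \<le> m"
    "\<And>j x. m + 1 < norm x \<Longrightarrow> h j x = 0" "(\<lambda>j. sqnorm (\<lambda>x. f x - h j x)) \<longlonglongrightarrow> 0"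
proof -
  have "f \<in> borel_measurable lebesgue" using f by (intro measurable_completion) simp
  then have "f measurable_on UNIV" by (intro lebesgue_measurable_imp_measurable_on) auto
  then obtain N G where N: "negligible N" and G: "\<And>j. continuous_on UNIV (G j)"
    and lim: "\<And>x. x \<notin> N \<Longrightarrow> (\<lambda>j. G j x) \<longlonglongrightarrow> f x"
    unfolding measurable_on_def by auto
  \<comment> \<open>Division by the maximum clamps values radially to norm \<open>m\<close> and
    leaves smaller ones alone; the outer factor is 1 up to radius \<open>m\<close> and vanishes from
    radius \<open>m + 1\<close> on.\<close>
  define h where "h j x = (max 0 (min 1 (m + 1 - norm x))) *\<^sub>R (G j x /\<^sub>R max 1 (norm (G j x) / m))" for j x
  have cont: "continuous_on UNIV (h j)" for j
    unfolding h_def by (intro continuous_intros G) (use m in auto)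
  have hb: "norm (h j x) \<le> m" for j x
  proof -
    have "norm (G j x) \<le> m * max 1 (norm (G j x) / m)"
      using m by (cases "norm (G j x) \<le> m") (auto simp: max_def field_simps)
    moreover have "0 < max 1 (norm (G j x) / m)" by (rule less_le_trans[OF zero_less_one max.cobounded1])
    ultimately have "norm (G j x /\<^sub>R max 1 (norm (G j x) / m)) \<le> m"
      by (simp add: field_simps)
    moreover have "\<bar>max 0 (min 1 (m + 1 - norm x))\<bar> \<le> 1" by simp
    ultimately have "\<bar>max 0 (min 1 (m + 1 - norm x))\<bar> * norm (G j x /\<^sub>R max 1 (norm (G j x) / m)) \<le> 1 * m"
      by (intro mult_mono) auto
    then show ?thesis unfolding h_def norm_scaleR[of "max 0 _"] by simp
  qed
  have h0: "h j x = 0" if "m + 1 < norm x" for j x using that by (simp add: h_def)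
  have hlim: "(\<lambda>j. h j x) \<longlonglongrightarrow> f x" if "x \<notin> N" for x
  proof -
    have "(\<lambda>j. h j x) \<longlonglongrightarrow> (max 0 (min 1 (m + 1 - norm x))) *\<^sub>R (f x /\<^sub>R max 1 (norm (f x) / m))"
      unfolding h_def by (intro tendsto_intros lim that) (use m in auto)
    moreover have "max 1 (norm (f x) / m) = 1" using B[of x] m by (simp add: max_def field_simps)
    moreover have "(max 0 (min 1 (m + 1 - norm x))) *\<^sub>R f x = f x"
      using R[of x] by (cases "m < norm x") auto
    ultimately show ?thesis by simp
  qed
  have [measurable]: "h j \<in> borel_measurable borel" for j
    by (rule borel_measurable_continuous_onI[OF cont])
  have [measurable]: "cball (0::'a) r \<in> sets borel" for r by simp
  have "(\<lambda>j. sqnorm (\<lambda>x. f x - h j x)) \<longlonglongrightarrow> 0"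
  proof (rule sqnorm_tendsto_0_dominated[where g="\<lambda>x. complex_of_real (2 * m * indicator (cball 0 (m + 1)) x)"])
    show "sqnorm (\<lambda>x::'a. complex_of_real (2 * m * indicator (cball 0 (m + 1)) x)) < \<infinity>"
      using m by (intro sqnorm_bounded_support_finite(1)[where B="2 * m" and R="m + 1"]) (auto simp: indicator_def)
    show "AE x in lborel. norm (f x - h j x) \<le> norm (complex_of_real (2 * m * indicator (cball 0 (m + 1)) x))" for j
    proof (rule AE_I2)
      fix x
      have "norm (f x - h j x) \<le> m + m" by (rule order_trans[OF norm_triangle_ineq4 add_mono[OF B hb]])
      moreover have "f x - h j x = 0" if "m + 1 < norm x" using that R[of x] h0 by simp
      ultimately show "norm (f x - h j x) \<le> norm (complex_of_real (2 * m * indicator (cball 0 (m + 1)) x))"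
        using m by (cases "norm x \<le> m + 1") auto
    qed
    have "N \<in> null_sets lebesgue" using N by (simp add: negligible_iff_null_sets)
    then obtain N' where N': "N' \<in> null_sets lborel" "N \<subseteq> N'"
      by (auto simp: null_sets_completion_iff2)
    show "AE x in lborel. (\<lambda>j. f x - h j x) \<longlonglongrightarrow> 0"
    proof (rule AE_I'[OF N'(1)])
      show "{x \<in> space lborel. \<not> (\<lambda>j. f x - h j x) \<longlonglongrightarrow> 0} \<subseteq> N'"
      proof
        fix x assume x: "x \<in> {x \<in> space lborel. \<not> (\<lambda>j. f x - h j x) \<longlonglongrightarrow> 0}"
        show "x \<in> N'"
        proof (rule ccontr)
          assume "x \<notin> N'"
          then have "(\<lambda>j. f x - h j x) \<longlonglongrightarrow> f x - f x" using N' by (intro tendsto_intros hlim) auto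
          then show False using x by simp
        qed
      qed
    qed
  qed measurable
  then show thesis using that cont hb h0 by blast
qed

text \<open>Two applications of the weighted triangle inequality give \<open>sqnorm f\<close> at
  most \<open>(1 + t)\<^sup>2\<close> times \<open>sqnorm g\<close> plus errors that vanish with k;
  afterwards \<open>t\<close> tends to 0.\<close>

lemma sqnorm_le_of_approx:
  fixes f g :: "'a::euclidean_space \<Rightarrow> complex"
  assumes [measurable]: "f \<in> borel_measurable borel" "g \<in> borel_measurable borel"
      "\<And>k. u k \<in> borel_measurable borel" "\<And>k. v k \<in> borel_measurable borel"
    and le: "\<And>k. sqnorm (u k) \<le> sqnorm (v k)"
    and u: "(\<lambda>k. sqnorm (\<lambda>x. f x - u k x)) \<longlonglongrightarrow> 0"
    and v: "(\<lambda>k::nat. sqnorm (\<lambda>x. g x - v k x)) \<longlonglongrightarrow> 0"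
  shows "sqnorm f \<le> sqnorm g"
proof (cases "sqnorm g = \<infinity>")
  case False
  have t: "sqnorm f \<le> sqnorm g * ennreal ((1 + t) * (1 + t))" if "0 < t" for t :: real
  proof -
    let ?r = "\<lambda>k. ennreal (1 + t) * (ennreal (1 + t) * sqnorm g + ennreal (1 + 1 / t) * sqnorm (\<lambda>x. g x - v k x)) + ennreal (1 + 1 / t) * sqnorm (\<lambda>x. f x - u k x)"
    have "sqnorm f \<le> ?r k" for k
    proof -
      have "sqnorm f = sqnorm (\<lambda>x. u k x + (f x - u k x))" by simp
      also have "\<dots> \<le> ennreal (1 + t) * sqnorm (u k) + ennreal (1 + 1 / t) * sqnorm (\<lambda>x. f x - u k x)"
        by (rule sqnorm_add_le[OF that]) measurable
      also have "sqnorm (u k) \<le> sqnorm (\<lambda>x. g x + (v k x - g x))" using le[of k] by simp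
      also have "\<dots> \<le> ennreal (1 + t) * sqnorm g + ennreal (1 + 1 / t) * sqnorm (\<lambda>x. v k x - g x)"
        by (rule sqnorm_add_le[OF that]) measurable
      also have "sqnorm (\<lambda>x. v k x - g x) = sqnorm (\<lambda>x. g x - v k x)" by (rule sqnorm_minus_commute)
      finally show ?thesis by (simp add: add_mono mult_left_mono)
    qed
    moreover have "?r \<longlonglongrightarrow> ennreal (1 + t) * (ennreal (1 + t) * sqnorm g + ennreal (1 + 1 / t) * 0) + ennreal (1 + 1 / t) * 0"
      by (intro tendsto_add ennreal_tendsto_cmult tendsto_const u v) auto
    ultimately have "sqnorm f \<le> ennreal (1 + t) * (ennreal (1 + t) * sqnorm g + ennreal (1 + 1 / t) * 0) + ennreal (1 + 1 / t) * 0"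
      by (intro LIMSEQ_le_const) auto
    also have "\<dots> = sqnorm g * ennreal ((1 + t) * (1 + t))"
      using that by (subst ennreal_mult) (auto simp: mult_ac)
    finally show ?thesis .
  qed
  have "(\<lambda>k. (1 + 1 / real (Suc k)) * (1 + 1 / real (Suc k))) \<longlonglongrightarrow> (1 + 0) * (1 + 0)"
    by (intro tendsto_intros lim_1_over_n[THEN LIMSEQ_Suc])
  then have "(\<lambda>k. sqnorm g * ennreal ((1 + 1 / real (Suc k)) * (1 + 1 / real (Suc k)))) \<longlonglongrightarrow> sqnorm g * ennreal ((1 + 0) * (1 + 0))"
    using False by (intro ennreal_tendsto_cmult tendsto_ennrealI) (auto simp: less_top)
  then have "sqnorm f \<le> sqnorm g * ennreal ((1 + 0) * (1 + 0))"
    by (rule LIMSEQ_le_const) (use t in auto)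
  then show ?thesis by simp
qed simp

text \<open>The lower bound holds for the continuous approximants and survives in the limit, since
  by contraction their transforms converge to the transform of \<open>f\<close> in L2.\<close>

lemma sqnorm_fourier_integral_bounded:
  fixes f :: "real ^ 'n \<Rightarrow> complex"
  assumes [measurable]: "f \<in> borel_measurable borel" and \<sigma>: "\<bar>\<sigma>\<bar> = 1" and m: "0 < m"
    and B: "\<And>x. norm (f x) \<le> m" and R: "\<And>x. m < norm x \<Longrightarrow> f x = 0"
  shows "sqnorm f \<le> sqnorm (fourier_integral \<sigma> f)"
proof -
  obtain h where h: "\<And>j. continuous_on UNIV (h j)" "\<And>j x. norm (h j x) \<le> m"
    "\<And>j x. m + 1 < norm x \<Longrightarrow> h j x = 0" "(\<lambda>j. sqnorm (\<lambda>x. f x - h j x)) \<longlonglongrightarrow> 0"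
    using bounded_function_approx_continuous[OF assms(1) m B R] by blast
  have [measurable]: "h j \<in> borel_measurable borel" for j
    by (rule borel_measurable_continuous_onI[OF h(1)])
  have fint: "integrable lborel f" by (rule sqnorm_bounded_support_finite(2)[OF _ B R]) auto
  have hint: "integrable lborel (h j)" "sqnorm (h j) < \<infinity>" for j
    by (rule sqnorm_bounded_support_finite[OF _ h(2) h(3)]; simp)+
  show ?thesis
  proof (rule sqnorm_le_of_approx[where u=h and v="\<lambda>j. fourier_integral \<sigma> (h j)"])
    show "sqnorm (h k) \<le> sqnorm (fourier_integral \<sigma> (h k))" for k
      by (rule sqnorm_fourier_integral_ge_continuous[OF hint(1) \<sigma> h(1) h(2) hint(2)])
    show "(\<lambda>k. sqnorm (\<lambda>x. fourier_integral \<sigma> f x - fourier_integral \<sigma> (h k) x)) \<longlonglongrightarrow> 0"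
    proof (rule tendsto_sandwich[OF _ _ tendsto_const h(4)])
      show "\<forall>\<^sub>F k in sequentially. sqnorm (\<lambda>x. fourier_integral \<sigma> f x - fourier_integral \<sigma> (h k) x) \<le> sqnorm (\<lambda>x. f x - h k x)"
        unfolding fourier_integral_diff[OF fint hint(1), symmetric]
        by (intro always_eventually allI sqnorm_fourier_integral_le Bochner_Integration.integrable_diff fint hint \<sigma>)
    qed simp
  qed (use h(4) in measurable)
qed

lemma sqnorm_fourier_integral:
  fixes f :: "real ^ 'n \<Rightarrow> complex"
  assumes f: "integrable lborel f" and fin: "sqnorm f < \<infinity>" and \<sigma>: "\<bar>\<sigma>\<bar> = 1"
  shows "sqnorm (fourier_integral \<sigma> f) = sqnorm f"
proof (rule antisym)
  show "sqnorm (fourier_integral \<sigma> f) \<le> sqnorm f" by (rule sqnorm_fourier_integral_le[OF f \<sigma>])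
  have [measurable]: "f \<in> borel_measurable borel"
    using f borel_measurable_integrable by auto
  \<comment> \<open>Truncation both in space and in size, so that one index serves as the bound
    \<open>m\<close> of the preceding case.\<close>
  define h where "h k x = (if norm x \<le> real (Suc k) \<and> norm (f x) \<le> real (Suc k) then f x else 0)" for k x
  have [measurable]: "h k \<in> borel_measurable borel" for k unfolding h_def by measurable
  have hint: "integrable lborel (h k)" for k
    by (rule sqnorm_bounded_support_finite(2)[where B="real (Suc k)" and R="real (Suc k)"]) (auto simp: h_def)
  have hlim: "(\<lambda>k. sqnorm (\<lambda>x. f x - h k x)) \<longlonglongrightarrow> 0"
  proof (rule sqnorm_tendsto_0_dominated[OF _ _ fin])
    show "AE x in lborel. (\<lambda>k. f x - h k x) \<longlonglongrightarrow> 0"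
    proof (rule AE_I2)
      fix x
      obtain N :: nat where N: "max (norm x) (norm (f x)) \<le> real N" using real_arch_simple by blast
      have "f x - h k x = 0" if "k \<ge> N" for k using N that by (auto simp: h_def)
      then show "(\<lambda>k. f x - h k x) \<longlonglongrightarrow> 0"
        by (intro tendsto_eventually) (auto simp: eventually_sequentially)
    qed
  qed (auto simp: h_def)
  show "sqnorm f \<le> sqnorm (fourier_integral \<sigma> f)"
  proof (rule sqnorm_le_of_approx[where u=h and v="\<lambda>j. fourier_integral \<sigma> (h j)"])
    show "sqnorm (h k) \<le> sqnorm (fourier_integral \<sigma> (h k))" for k
      by (rule sqnorm_fourier_integral_bounded[where m="real (Suc k)"]) (auto simp: h_def \<sigma>)
    show "(\<lambda>k. sqnorm (\<lambda>x. fourier_integral \<sigma> f x - fourier_integral \<sigma> (h k) x)) \<longlonglongrightarrow> 0"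
    proof (rule tendsto_sandwich[OF _ _ tendsto_const hlim])
      show "\<forall>\<^sub>F k in sequentially. sqnorm (\<lambda>x. fourier_integral \<sigma> f x - fourier_integral \<sigma> (h k) x) \<le> sqnorm (\<lambda>x. f x - h k x)"
        unfolding fourier_integral_diff[OF f hint, symmetric]
        by (intro always_eventually allI sqnorm_fourier_integral_le Bochner_Integration.integrable_diff f hint \<sigma>)
    qed simp
  qed (use hlim in measurable)
qed

section \<open>Completeness of L2\<close>

lemma tendsto_0_ennreal_le:
  fixes f :: "'b \<Rightarrow> ennreal"
  assumes "\<And>e::real. 0 < e \<Longrightarrow> \<forall>\<^sub>F k in F. f k \<le> ennreal e"
  shows "(f \<longlongrightarrow> 0) F"
proof (rule order_tendstoI)
  fix a :: ennreal assume "0 < a"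
  then obtain b where "0 < b" "b < a" using dense by blast
  moreover have "b < top" using \<open>b < a\<close> by (rule less_le_trans) simp
  ultimately have "b = ennreal (enn2real b)" "0 < enn2real b"
    by (auto simp: enn2real_positive_iff)
  with \<open>b < a\<close> show "\<forall>\<^sub>F k in F. f k < a"
    using assms[of "enn2real b"] by (auto elim: eventually_mono)
qed simp

text \<open>Riesz-Fischer. Along a subsequence whose consecutive differences have squared norm at
  most 4^(-m), the factors 2^m keep the sum of the squares integrable; where it is finite the
  differences decay geometrically and the telescoping series converges. Fatou's lemma then
  identifies the limit in the mean.\<close>

lemma sqnorm_complete:
  fixes g :: "nat \<Rightarrow> 'a::euclidean_space \<Rightarrow> complex"
  assumes g[measurable]: "\<And>k. g k \<in> borel_measurable borel"
    and Cauchy: "\<And>e::real. 0 < e \<Longrightarrow> \<exists>N. \<forall>k\<ge>N. \<forall>l\<ge>N. sqnorm (\<lambda>x. g k x - g l x) \<le> ennreal e"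
  obtains G where "G \<in> borel_measurable borel" "(\<lambda>k. sqnorm (\<lambda>x. g k x - G x)) \<longlonglongrightarrow> 0"
proof -
  have "\<exists>N. \<forall>m. \<forall>k\<ge>N m. \<forall>l\<ge>N m. sqnorm (\<lambda>x. g k x - g l x) \<le> ennreal ((1/4)^m)"
    using Cauchy by (intro choice allI) simp
  then obtain N where N: "\<And>m k l. N m \<le> k \<Longrightarrow> N m \<le> l \<Longrightarrow> sqnorm (\<lambda>x. g k x - g l x) \<le> ennreal ((1/4)^m)"
    by blast
  \<comment> \<open>Summing the thresholds gives a nondecreasing sequence of indices that lies above
    \<open>N m\<close> from position m on.\<close>
  define r where "r m = (\<Sum>i\<le>m. N i)" for m
  have rN: "N m \<le> r m'" if "m \<le> m'" for m m'
    unfolding r_def using that by (intro member_le_sum) auto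
  define d where "d m x = g (r (Suc m)) x - g (r m) x" for m x
  have [measurable]: "d m \<in> borel_measurable borel" for m unfolding d_def by measurable
  have "(\<integral>\<^sup>+x. (\<Sum>m. ennreal (2 ^ m * (norm (d m x))\<^sup>2)) \<partial>lborel) = (\<Sum>m. \<integral>\<^sup>+x. ennreal (2 ^ m * (norm (d m x))\<^sup>2) \<partial>lborel)"
    by (rule nn_integral_suminf) measurable
  also have "\<dots> \<le> (\<Sum>m. ennreal ((1/2) ^ m))"
  proof (rule suminf_le)
    fix m
    have "(\<integral>\<^sup>+x. ennreal (2 ^ m * (norm (d m x))\<^sup>2) \<partial>lborel) = ennreal (2 ^ m) * sqnorm (d m)"
      unfolding sqnorm_def by (simp add: ennreal_mult nn_integral_cmult)
    also have "\<dots> \<le> ennreal (2 ^ m) * ennreal ((1/4) ^ m)"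
      unfolding d_def by (intro mult_left_mono N rN) auto
    also have "\<dots> = ennreal (2 ^ m * (1/4) ^ m)" by (rule ennreal_mult[symmetric]) auto
    also have "2 ^ m * (1/4) ^ m = ((1/2) ^ m :: real)" unfolding power_mult_distrib[symmetric] by simp
    finally show "(\<integral>\<^sup>+x. ennreal (2 ^ m * (norm (d m x))\<^sup>2) \<partial>lborel) \<le> ennreal ((1/2) ^ m)" .
  qed auto
  also have "\<dots> = ennreal (\<Sum>m. (1/2) ^ m)"
    by (rule suminf_ennreal2) (auto simp: summable_geometric)
  finally have fin: "(\<integral>\<^sup>+x. (\<Sum>m. ennreal (2 ^ m * (norm (d m x))\<^sup>2)) \<partial>lborel) \<noteq> \<infinity>"
    by (metis ennreal_neq_top infinity_ennreal_def top.extremum_uniqueI)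
  have "AE x in lborel. (\<Sum>m. ennreal (2 ^ m * (norm (d m x))\<^sup>2)) \<noteq> \<infinity>"
    by (rule nn_integral_PInf_AE[OF _ fin]) simp
  then have conv: "AE x in lborel. convergent (\<lambda>m. g (r m) x)"
  proof (rule eventually_mono)
    fix x assume elim: "(\<Sum>m. ennreal (2 ^ m * (norm (d m x))\<^sup>2)) \<noteq> \<infinity>"
    define Z where "Z = (\<Sum>m. ennreal (2 ^ m * (norm (d m x))\<^sup>2))"
    have "Z \<noteq> \<infinity>" unfolding Z_def by (rule elim)
    then obtain S where S: "0 \<le> S" "Z = ennreal S" by (cases Z rule: ennreal_cases) auto
    have "norm (d m x) \<le> sqrt S * (sqrt (1/2)) ^ m" for m
    proof -
      have "sum (\<lambda>m. ennreal (2 ^ m * (norm (d m x))\<^sup>2)) {m} \<le> (\<Sum>m. ennreal (2 ^ m * (norm (d m x))\<^sup>2))"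
        by (intro sum_le_suminf) auto
      then have "ennreal (2 ^ m * (norm (d m x))\<^sup>2) \<le> ennreal S" unfolding S(2)[unfolded Z_def] by simp
      then have "2 ^ m * (norm (d m x))\<^sup>2 \<le> S" using S(1) by simp
      then have "(1/2) ^ m * (2 ^ m * (norm (d m x))\<^sup>2) \<le> (1/2) ^ m * S" by (intro mult_left_mono) auto
      then have "(norm (d m x))\<^sup>2 \<le> S * (1/2) ^ m" by (simp add: power_one_over mult.commute)
      also have "\<dots> = (sqrt S * (sqrt (1/2)) ^ m)\<^sup>2"
      proof -
        have "((sqrt (1/2)) ^ m)\<^sup>2 = ((sqrt (1/2))\<^sup>2) ^ m" by (metis power_mult mult.commute)
        also have "(sqrt (1/2))\<^sup>2 = (1/2 :: real)" by (rule real_sqrt_pow2) simp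
        finally show ?thesis unfolding power_mult_distrib using S(1) by (simp only: real_sqrt_pow2)
      qed
      finally show ?thesis by (rule power2_le_imp_le) (use S(1) in simp)
    qed
    then have dS: "norm (d m x) \<le> sqrt S * (sqrt (1/2)) ^ m" for m .
    have "norm (sqrt (1/2)) < 1" by (simp add: real_sqrt_divide)
    then have "summable (\<lambda>m. sqrt S * (sqrt (1/2)) ^ m)"
      by (rule summable_mult[OF summable_geometric])
    then have "summable (\<lambda>m. d m x)"
      by (rule summable_comparison_test'[where N=0]) (rule dS)
    then have "convergent (\<lambda>n. \<Sum>m<n. d m x)" by (simp add: summable_iff_convergent)
    moreover have "(\<Sum>m<n. d m x) = g (r n) x - g (r 0) x" for n
      unfolding d_def by (rule sum_lessThan_telescope)
    ultimately have "convergent (\<lambda>n. (g (r n) x - g (r 0) x) + g (r 0) x)"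
      by (intro convergent_add convergent_const) (simp only:)
    then show "convergent (\<lambda>m. g (r m) x)" by simp
  qed
  define G where "G x = lim (\<lambda>m. g (r m) x)" for x
  have [measurable]: "G \<in> borel_measurable borel" unfolding G_def by measurable
  have lim: "AE x in lborel. (\<lambda>m. g (r m) x) \<longlonglongrightarrow> G x"
    using conv by eventually_elim (simp add: G_def convergent_LIMSEQ_iff)
  \<comment> \<open>The pointwise limit is taken in the second index only, so the Cauchy bound for
    the pair passes to \<open>G\<close> by Fatou.\<close>
  have bd: "sqnorm (\<lambda>x. g k x - G x) \<le> ennreal ((1/4) ^ m)" if k: "r m \<le> k" for k m
  proof -
    have "sqnorm (\<lambda>x. g k x - G x) = (\<integral>\<^sup>+x. liminf (\<lambda>m'. ennreal ((norm (g k x - g (r m') x))\<^sup>2)) \<partial>lborel)"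
      unfolding sqnorm_def
    proof (rule nn_integral_cong_AE)
      show "AE x in lborel. ennreal ((norm (g k x - G x))\<^sup>2) = liminf (\<lambda>m'. ennreal ((norm (g k x - g (r m') x))\<^sup>2))"
        using lim
      proof eventually_elim
        case (elim x)
        then have "(\<lambda>m'. ennreal ((norm (g k x - g (r m') x))\<^sup>2)) \<longlonglongrightarrow> ennreal ((norm (g k x - G x))\<^sup>2)"
          by (intro tendsto_intros)
        then show ?case by (rule lim_imp_Liminf[OF trivial_limit_sequentially, symmetric])
      qed
    qed
    also have "\<dots> \<le> liminf (\<lambda>m'. sqnorm (\<lambda>x. g k x - g (r m') x))"
      unfolding sqnorm_def by (rule nn_integral_liminf) measurable
    also have "\<dots> \<le> ennreal ((1/4) ^ m)"
    proof (rule Liminf_le)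
      show "\<forall>\<^sub>F m' in sequentially. sqnorm (\<lambda>x. g k x - g (r m') x) \<le> ennreal ((1/4) ^ m)"
        using eventually_ge_at_top[of m]
      proof eventually_elim
        case (elim m')
        then show ?case using k rN[of m m] by (intro N rN) auto
      qed
    qed simp
    finally show ?thesis .
  qed
  have "(\<lambda>k. sqnorm (\<lambda>x. g k x - G x)) \<longlonglongrightarrow> 0"
  proof (rule tendsto_0_ennreal_le)
    fix e :: real assume "0 < e"
    then obtain m where m: "(1/4) ^ m < e" using real_arch_pow_inv[of e "1/4"] by auto
    show "\<forall>\<^sub>F k in sequentially. sqnorm (\<lambda>x. g k x - G x) \<le> ennreal e"
      using eventually_ge_at_top[of "r m"]
      by eventually_elim (rule order_trans[OF bd ennreal_leI[OF less_imp_le[OF m]]])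
  qed
  then show thesis using that \<open>G \<in> borel_measurable borel\<close> by blast
qed

section \<open>Truncations and the transform as a limit in mean\<close>

abbreviation truncate :: "nat \<Rightarrow> (real ^ 'n \<Rightarrow> complex) \<Rightarrow> real ^ 'n \<Rightarrow> complex" where
  "truncate k f \<equiv> (\<lambda>x. indicator (cball 0 (real k)) x * f x)"

lemma truncate_measurable:
  assumes [measurable]: "f \<in> borel_measurable borel"
  shows "truncate k f \<in> borel_measurable borel"
proof -
  have [measurable]: "cball (0::real ^ 'b) (real k) \<in> sets borel" by simp
  show ?thesis by measurable
qed

lemma norm_truncate_le: "norm (truncate k f x) \<le> norm (f x)"
  by (auto simp: indicator_def)

lemma sqnorm_truncate_le: "sqnorm (truncate k f) \<le> sqnorm f"
  by (rule sqnorm_mono) (rule norm_truncate_le)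

lemma integrable_truncate:
  assumes [measurable]: "f \<in> borel_measurable borel" and fin: "sqnorm f < \<infinity>"
  shows "integrable lborel (truncate k f)"
proof -
  have "integrable lborel (\<lambda>x. indicator (cball 0 (real k)) x + (norm (f x))\<^sup>2)"
    by (intro Bochner_Integration.integrable_add integrable_real_indicator emeasure_bounded_finite
        iffD1[OF sqnorm_finite_iff_integrable] fin) auto
  then show ?thesis
  proof (rule Bochner_Integration.integrable_bound)
    show "AE x in lborel. norm (truncate k f x) \<le> norm (indicator (cball 0 (real k)) x + (norm (f x))\<^sup>2)"
    proof (rule AE_I2)
      fix x
      have "2 * norm (f x) \<le> 1 + (norm (f x))\<^sup>2"
        using zero_le_power2[of "norm (f x) - 1"] by (simp add: power2_diff)
      then have "norm (f x) \<le> 1 + (norm (f x))\<^sup>2" using norm_ge_zero[of "f x"] by linarith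
      then show "norm (truncate k f x) \<le> norm (indicator (cball 0 (real k)) x + (norm (f x))\<^sup>2)"
        by (auto simp: indicator_def)
    qed
  qed (simp add: truncate_measurable)
qed

lemma sqnorm_truncate_tendsto:
  fixes f :: "real ^ 'n \<Rightarrow> complex"
  assumes [measurable]: "f \<in> borel_measurable borel" and fin: "sqnorm f < \<infinity>"
  shows "(\<lambda>k. sqnorm (\<lambda>x. f x - truncate k f x)) \<longlonglongrightarrow> 0"
proof (rule sqnorm_tendsto_0_dominated[OF _ _ fin])
  note truncate_measurable[measurable]
  show "(\<lambda>x. f x - truncate k f x) \<in> borel_measurable borel" for k by measurable
  show "AE x in lborel. (\<lambda>k. f x - truncate k f x) \<longlonglongrightarrow> 0"
  proof (rule AE_I2)
    fix x :: "real ^ 'n"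
    obtain N :: nat where N: "norm x \<le> real N" using real_arch_simple by blast
    have "f x - truncate k f x = 0" if "k \<ge> N" for k using N that by (auto simp: indicator_def)
    then show "(\<lambda>k. f x - truncate k f x) \<longlonglongrightarrow> 0"
      by (intro tendsto_eventually) (auto simp: eventually_sequentially)
  qed
  show "AE x in lborel. norm (f x - truncate k f x) \<le> norm (f x)" for k
    by (rule AE_I2) (auto simp: indicator_def)
qed simp

lemma is_plancherel_iff:
  "is_plancherel \<sigma> f g \<longleftrightarrow> g \<in> borel_measurable borel \<and> sqnorm g < \<infinity> \<and>
    (\<lambda>k. sqnorm (\<lambda>\<xi>. g \<xi> - fourier_integral \<sigma> (truncate k f) \<xi>)) \<longlonglongrightarrow> 0"
  unfolding is_plancherel_def L2_functions_def L2norm_tendsto_0_iff L2norm_finite_iff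
  by (subst sqnorm_minus_commute) auto

lemma is_plancherel_unique:
  assumes f: "f \<in> borel_measurable borel" and g: "is_plancherel \<sigma> f g" and h: "is_plancherel \<sigma> f h"
  shows "AE x in lborel. g x = h x"
proof -
  note truncate_measurable[OF f, measurable]
  have [measurable]: "g \<in> borel_measurable borel" "h \<in> borel_measurable borel"
    using g h by (auto simp: is_plancherel_iff)
  let ?a = "\<lambda>k. fourier_integral \<sigma> (truncate k f)"
  have le: "sqnorm (\<lambda>x. g x - h x) \<le> 2 * sqnorm (\<lambda>x. g x - ?a k x) + 2 * sqnorm (\<lambda>x. h x - ?a k x)" for k
  proof -
    have "sqnorm (\<lambda>x. (g x - ?a k x) + (?a k x - h x)) \<le> ennreal (1 + 1) * sqnorm (\<lambda>x. g x - ?a k x) + ennreal (1 + 1 / 1) * sqnorm (\<lambda>x. ?a k x - h x)"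
      by (rule sqnorm_add_le) auto
    then show ?thesis by (simp add: sqnorm_minus_commute[of h])
  qed
  have "(\<lambda>k. 2 * sqnorm (\<lambda>x. g x - ?a k x) + 2 * sqnorm (\<lambda>x. h x - ?a k x)) \<longlonglongrightarrow> 2 * 0 + 2 * 0"
    using g h by (intro tendsto_add ennreal_tendsto_cmult) (auto simp: is_plancherel_iff)
  then have "sqnorm (\<lambda>x. g x - h x) \<le> 2 * 0 + 2 * 0"
    by (rule LIMSEQ_le_const) (use le in auto)
  then have "sqnorm (\<lambda>x. g x - h x) = 0" by simp
  then show ?thesis by (subst (asm) sqnorm_eq_0_iff) auto
qed

lemma is_plancherel_cong_AE:
  assumes "AE x in lborel. f x = f' x" "f \<in> borel_measurable borel" "f' \<in> borel_measurable borel"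
    and "is_plancherel \<sigma> f g"
  shows "is_plancherel \<sigma> f' g"
proof -
  have "fourier_integral \<sigma> (truncate k f) = fourier_integral \<sigma> (truncate k f')" for k
    by (rule fourier_integral_cong_AE) (use assms truncate_measurable in auto)
  then show ?thesis using assms(4) unfolding is_plancherel_iff by simp
qed

text \<open>Truncations of an L2 function are integrable and Cauchy; contraction carries the Cauchy
  property to their transforms, and completeness supplies the limit.\<close>

lemma is_plancherel_exists:
  fixes f :: "real ^ 'n \<Rightarrow> complex"
  assumes f[measurable]: "f \<in> borel_measurable borel" and fin: "sqnorm f < \<infinity>" and \<sigma>: "\<bar>\<sigma>\<bar> = 1"
  shows "\<exists>g. is_plancherel \<sigma> f g"
proof -
  note truncate_measurable[OF f, measurable]
  let ?a = "\<lambda>k. fourier_integral \<sigma> (truncate k f)"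
  have Cauchy: "\<exists>N. \<forall>k\<ge>N. \<forall>l\<ge>N. sqnorm (\<lambda>x. ?a k x - ?a l x) \<le> ennreal e" if "0 < e" for e :: real
  proof -
    \<comment> \<open>The tolerance \<open>e / 4\<close> is dictated by \<open>sqnorm_add_le\<close>
      with \<open>t = 1\<close>, which doubles each of the two errors.\<close>
    have "\<forall>\<^sub>F k in sequentially. sqnorm (\<lambda>x. f x - truncate k f x) < ennreal (e / 4)"
      using sqnorm_truncate_tendsto[OF f fin] that by (intro order_tendstoD(2)) auto
    then obtain N where N: "\<And>k. N \<le> k \<Longrightarrow> sqnorm (\<lambda>x. f x - truncate k f x) < ennreal (e / 4)"
      by (auto simp: eventually_sequentially)
    have "sqnorm (\<lambda>x. ?a k x - ?a l x) \<le> ennreal e" if kl: "N \<le> k" "N \<le> l" for k l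
    proof -
      have "sqnorm (\<lambda>x. ?a k x - ?a l x) \<le> sqnorm (\<lambda>x. truncate k f x - truncate l f x)"
        unfolding fourier_integral_diff[OF integrable_truncate[OF f fin] integrable_truncate[OF f fin], symmetric]
        by (intro sqnorm_fourier_integral_le Bochner_Integration.integrable_diff integrable_truncate f fin \<sigma>)
      also have "\<dots> = sqnorm (\<lambda>x. (truncate k f x - f x) + (f x - truncate l f x))" by simp
      also have "\<dots> \<le> ennreal (1 + 1) * sqnorm (\<lambda>x. truncate k f x - f x) + ennreal (1 + 1 / 1) * sqnorm (\<lambda>x. f x - truncate l f x)"
        by (rule sqnorm_add_le) auto
      also have "\<dots> \<le> ennreal (1 + 1) * ennreal (e / 4) + ennreal (1 + 1 / 1) * ennreal (e / 4)"
        unfolding sqnorm_minus_commute[of "truncate k f"]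
        by (intro add_mono mult_left_mono order.strict_implies_order[OF N] kl) auto
      also have "\<dots> = ennreal ((1 + 1) * (e / 4) + (1 + 1 / 1) * (e / 4))"
      proof -
        have "ennreal (1 + 1) * ennreal (e / 4) = ennreal ((1 + 1) * (e / 4))"
          "ennreal (1 + 1 / 1) * ennreal (e / 4) = ennreal ((1 + 1 / 1) * (e / 4))"
          by (rule ennreal_mult'[symmetric]; simp)+
        then show ?thesis using \<open>0 < e\<close> by (subst ennreal_plus) (simp_all only:, simp_all)
      qed
      also have "(1 + 1) * (e / 4) + (1 + 1 / 1) * (e / 4) = e" by simp
      finally show ?thesis .
    qed
    then show ?thesis by blast
  qed
  obtain g where [measurable]: "g \<in> borel_measurable borel" and g: "(\<lambda>k. sqnorm (\<lambda>x. ?a k x - g x)) \<longlonglongrightarrow> 0"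
    using sqnorm_complete[of ?a] Cauchy by auto
  have "sqnorm g \<le> sqnorm f"
  proof (rule sqnorm_le_of_approx[where u="?a" and v="\<lambda>k. truncate k f"])
    show "sqnorm (?a k) \<le> sqnorm (truncate k f)" for k
      by (intro sqnorm_fourier_integral_le integrable_truncate f fin \<sigma>)
    show "(\<lambda>k. sqnorm (\<lambda>x. g x - ?a k x)) \<longlonglongrightarrow> 0"
      using g by (subst sqnorm_minus_commute)
  qed (use sqnorm_truncate_tendsto[OF f fin] in auto)
  then have "sqnorm g < \<infinity>" using fin by (rule order.strict_trans1)
  moreover have "(\<lambda>k. sqnorm (\<lambda>x. g x - ?a k x)) \<longlonglongrightarrow> 0"
    using g by (subst sqnorm_minus_commute)
  ultimately show ?thesis
    using \<open>g \<in> borel_measurable borel\<close> unfolding is_plancherel_iff by blast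
qed

lemma is_plancherel_plancherel:
  fixes f :: "real ^ 'n \<Rightarrow> complex"
  assumes "f \<in> borel_measurable borel" "sqnorm f < \<infinity>" "\<bar>\<sigma>\<bar> = 1"
  shows "is_plancherel \<sigma> f (plancherel \<sigma> f)"
  unfolding plancherel_def using is_plancherel_exists[OF assms] by (rule someI_ex)

text \<open>Each truncation has the same norm as its transform, and both families converge, so the
  limit may be taken in either direction.\<close>

lemma sqnorm_is_plancherel:
  fixes f :: "real ^ 'n \<Rightarrow> complex"
  assumes f[measurable]: "f \<in> borel_measurable borel" and fin: "sqnorm f < \<infinity>" and \<sigma>: "\<bar>\<sigma>\<bar> = 1"
    and g: "is_plancherel \<sigma> f g"
  shows "sqnorm g = sqnorm f"
proof -
  note truncate_measurable[OF f, measurable]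
  let ?a = "\<lambda>k. fourier_integral \<sigma> (truncate k f)"
  have [measurable]: "g \<in> borel_measurable borel" and lim: "(\<lambda>k. sqnorm (\<lambda>x. g x - ?a k x)) \<longlonglongrightarrow> 0"
    using g by (auto simp: is_plancherel_iff)
  have eq: "sqnorm (?a k) = sqnorm (truncate k f)" for k
    by (intro sqnorm_fourier_integral integrable_truncate f fin \<sigma>) (rule order.strict_trans1[OF sqnorm_truncate_le fin])
  show ?thesis
  proof (rule antisym)
    show "sqnorm g \<le> sqnorm f"
      by (rule sqnorm_le_of_approx[where u="?a" and v="\<lambda>k. truncate k f"])
         (use lim eq sqnorm_truncate_tendsto[OF f fin] in auto)
    show "sqnorm f \<le> sqnorm g"
      by (rule sqnorm_le_of_approx[where v="?a" and u="\<lambda>k. truncate k f"])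
         (use lim eq sqnorm_truncate_tendsto[OF f fin] in auto)
  qed
qed

text \<open>On integrable L2 functions the limit in mean is the plain integral, which later provides
  a representative defined at every point.\<close>

lemma is_plancherel_fourier_integral:
  fixes f :: "real ^ 'n \<Rightarrow> complex"
  assumes f: "integrable lborel f" and fin: "sqnorm f < \<infinity>" and \<sigma>: "\<bar>\<sigma>\<bar> = 1"
  shows "is_plancherel \<sigma> f (fourier_integral \<sigma> f)"
proof -
  have [measurable]: "f \<in> borel_measurable borel"
    using f borel_measurable_integrable by auto
  have "(\<lambda>k. sqnorm (\<lambda>\<xi>. fourier_integral \<sigma> f \<xi> - fourier_integral \<sigma> (truncate k f) \<xi>)) \<longlonglongrightarrow> 0"
  proof (rule tendsto_sandwich[OF _ _ tendsto_const sqnorm_truncate_tendsto[OF _ fin]])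
    show "\<forall>\<^sub>F k in sequentially. sqnorm (\<lambda>\<xi>. fourier_integral \<sigma> f \<xi> - fourier_integral \<sigma> (truncate k f) \<xi>) \<le> sqnorm (\<lambda>x. f x - truncate k f x)"
      unfolding fourier_integral_diff[OF f integrable_truncate[OF \<open>f \<in> borel_measurable borel\<close> fin], symmetric]
      by (intro always_eventually allI sqnorm_fourier_integral_le Bochner_Integration.integrable_diff integrable_truncate f fin \<sigma>) simp
  qed auto
  then show ?thesis
    unfolding is_plancherel_iff using sqnorm_fourier_integral[OF f fin \<sigma>] fin by simp
qed

text \<open>Fourier inversion on \<open>L\<^sup>1 \<inter> L\<^sup>2\<close>: writing \<open>u\<close> for the transform of \<open>f\<close> and \<open>a\<^sub>k\<close> for the inverse
  transform of \<open>u 1\<^bsub>B(k)\<^esub>\<close>, the multiplication formula gives \<open>\<langle>a\<^sub>k, f\<rangle> = \<parallel>u 1\<^bsub>B(k)\<^esub>\<parallel>\<^sup>2 = \<parallel>a\<^sub>k\<parallel>\<^sup>2\<close>,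
  so that \<open>\<parallel>a\<^sub>k - f\<parallel>\<^sup>2 = \<parallel>u - u 1\<^bsub>B(k)\<^esub>\<parallel>\<^sup>2\<close>.\<close>

lemma is_plancherel_inverse:
  fixes f :: "real ^ 'n \<Rightarrow> complex"
  assumes f: "integrable lborel f" and fin: "sqnorm f < \<infinity>" and \<sigma>: "\<bar>\<sigma>\<bar> = 1"
  shows "is_plancherel (- \<sigma>) (fourier_integral \<sigma> f) f"
proof -
  have f_meas[measurable]: "f \<in> borel_measurable borel"
    using f borel_measurable_integrable by auto
  have \<sigma>': "\<bar>- \<sigma>\<bar> = 1" using \<sigma> by simp
  define u where "u = fourier_integral \<sigma> f"
  have u[measurable]: "u \<in> borel_measurable borel" unfolding u_def by measurable
  have su: "sqnorm u = sqnorm f" unfolding u_def by (rule sqnorm_fourier_integral[OF f fin \<sigma>])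
  then have ufin: "sqnorm u < \<infinity>" using fin by simp
  note truncate_measurable[OF u, measurable]
  define a where "a k = fourier_integral (- \<sigma>) (truncate k u)" for k
  have [measurable]: "a k \<in> borel_measurable borel" for k unfolding a_def by measurable
  have tint: "integrable lborel (truncate k u)" for k by (rule integrable_truncate[OF u ufin])
  have tfin: "sqnorm (truncate k u) < \<infinity>" for k by (rule order.strict_trans1[OF sqnorm_truncate_le ufin])
  have sa: "sqnorm (a k) = sqnorm (truncate k u)" for k
    unfolding a_def by (rule sqnorm_fourier_integral[OF tint tfin \<sigma>'])
  have afin: "sqnorm (a k) < \<infinity>" for k using sa tfin by simp
  have i_f: "integrable lborel (\<lambda>x. (norm (f x))\<^sup>2)" and i_u: "integrable lborel (\<lambda>x. (norm (u x))\<^sup>2)"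
    and i_a: "integrable lborel (\<lambda>x. (norm (a k x))\<^sup>2)" and i_t: "integrable lborel (\<lambda>x. (norm (truncate k u x))\<^sup>2)" for k
    by (intro iffD1[OF sqnorm_finite_iff_integrable] fin ufin afin tfin; simp)+
  define T where "T k = (LINT x|lborel. (norm (truncate k u x))\<^sup>2)" for k
  define U where "U = (LINT x|lborel. (norm (u x))\<^sup>2)"
  have nn: "0 \<le> (LINT x|lborel. (norm (g x))\<^sup>2)" for g :: "real ^ 'n \<Rightarrow> complex"
    by (intro integral_nonneg_AE) auto
  have U: "(LINT x|lborel. (norm (f x))\<^sup>2) = U"
  proof -
    have "ennreal (LINT x|lborel. (norm (f x))\<^sup>2) = ennreal U"
      unfolding U_def using su by (simp add: sqnorm_eq_integral[OF _ fin, symmetric] sqnorm_eq_integral[OF _ ufin, symmetric])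
    then show ?thesis unfolding U_def by (subst (asm) ennreal_inj) (auto intro: nn)
  qed
  have A: "(LINT x|lborel. (norm (a k x))\<^sup>2) = T k" for k
  proof -
    have "ennreal (LINT x|lborel. (norm (a k x))\<^sup>2) = ennreal (T k)"
      unfolding T_def using sa[of k] by (simp add: sqnorm_eq_integral[OF _ afin, symmetric] sqnorm_eq_integral[OF _ tfin, symmetric])
    then show ?thesis unfolding T_def by (subst (asm) ennreal_inj) (auto intro: nn)
  qed
  have cross_int: "integrable lborel (\<lambda>x. a k x * cnj (f x))" for k
  proof (rule Bochner_Integration.integrable_bound[OF Bochner_Integration.integrable_add[OF i_a[of k] i_f]])
    have "norm (a k x) * norm (f x) \<le> (norm (a k x))\<^sup>2 + (norm (f x))\<^sup>2" for x
      using zero_le_power2[of "norm (a k x) - norm (f x)"] zero_le_power2[of "norm (a k x)"] zero_le_power2[of "norm (f x)"]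
      unfolding power2_diff by linarith
    then show "AE x in lborel. norm (a k x * cnj (f x)) \<le> norm ((norm (a k x))\<^sup>2 + (norm (f x))\<^sup>2)"
      by (intro AE_I2) (simp add: norm_mult)
  qed measurable
  \<comment> \<open>The inverse transform falls on the conjugate of \<open>f\<close>, where it is
    the conjugate of \<open>u\<close>; on the ball this pairs \<open>u\<close> with itself. The
    expanded square thus has cross term \<open>- 2 * T k\<close> against
    \<open>U + T k\<close>.\<close>
  have cross: "(LINT x|lborel. a k x * cnj (f x)) = of_real (T k)" for k
  proof -
    have "(LINT x|lborel. a k x * cnj (f x)) = (LINT x|lborel. truncate k u x * fourier_integral (- \<sigma>) (\<lambda>x. cnj (f x)) x)"
      unfolding a_def using f by (intro fourier_integral_multiplication tint) auto
    also have "\<dots> = (LINT x|lborel. truncate k u x * cnj (u x))"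
      unfolding u_def cnj_fourier_integral ..
    also have "\<dots> = (LINT x|lborel. complex_of_real ((norm (truncate k u x))\<^sup>2))"
      unfolding complex_norm_square by (intro Bochner_Integration.integral_cong refl) (auto simp: indicator_def)
    finally show ?thesis unfolding T_def integral_complex_of_real .
  qed
  have key: "sqnorm (\<lambda>x. f x - a k x) = sqnorm (\<lambda>x. u x - truncate k u x)" for k
  proof -
    have e1: "(norm (f x - a k x))\<^sup>2 = (norm (f x))\<^sup>2 + (norm (a k x))\<^sup>2 - 2 * Re (a k x * cnj (f x))" for x
      unfolding cmod_power2 by (simp add: power2_eq_square algebra_simps)
    have i1: "integrable lborel (\<lambda>x. (norm (f x - a k x))\<^sup>2)"
      unfolding e1 by (intro Bochner_Integration.integrable_diff Bochner_Integration.integrable_add i_f i_a integrable_mult_right integrable_Re cross_int)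
    have "(LINT x|lborel. (norm (f x - a k x))\<^sup>2) = U + T k - 2 * Re (of_real (T k))"
    proof -
      have "(LINT x|lborel. F1 x + F2 x - 2 * R x) = (LINT x|lborel. F1 x) + (LINT x|lborel. F2 x) - 2 * (LINT x|lborel. R x)"
        if "integrable lborel F1" "integrable lborel F2" "integrable lborel R" for F1 F2 R :: "real ^ 'n \<Rightarrow> real"
        using that by simp
      from this[OF i_f i_a integrable_Re[OF cross_int]] show ?thesis
        unfolding e1 U A integral_Re[OF cross_int] cross .
    qed
    then have I1: "(LINT x|lborel. (norm (f x - a k x))\<^sup>2) = U - T k" by simp
    have e2: "(norm (u x - truncate k u x))\<^sup>2 = (norm (u x))\<^sup>2 - (norm (truncate k u x))\<^sup>2" for x
      by (auto simp: indicator_def)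
    have i2: "integrable lborel (\<lambda>x. (norm (u x - truncate k u x))\<^sup>2)"
      unfolding e2 by (intro Bochner_Integration.integrable_diff i_u i_t)
    have I2: "(LINT x|lborel. (norm (u x - truncate k u x))\<^sup>2) = U - T k"
      unfolding e2 U_def T_def by (rule Bochner_Integration.integral_diff[OF i_u i_t])
    have "sqnorm (\<lambda>x. f x - a k x) = ennreal (U - T k)"
      unfolding I1[symmetric] by (intro sqnorm_eq_integral iffD2[OF sqnorm_finite_iff_integrable] i1) auto
    moreover have "sqnorm (\<lambda>x. u x - truncate k u x) = ennreal (U - T k)"
      unfolding I2[symmetric] by (intro sqnorm_eq_integral iffD2[OF sqnorm_finite_iff_integrable] i2) auto
    ultimately show ?thesis by simp
  qed
  have "(\<lambda>k. sqnorm (\<lambda>x. f x - a k x)) \<longlonglongrightarrow> 0"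
    unfolding key by (rule sqnorm_truncate_tendsto[OF u ufin])
  then show ?thesis
    unfolding is_plancherel_iff a_def u_def using fin by simp
qed

section \<open>Sobolev functions\<close>

lemma square_powr: "0 < x \<Longrightarrow> (x\<^sup>2) powr a = x powr (2 * a)" for x :: real
proof -
  assume "0 < x"
  then have "x\<^sup>2 = x powr 2" by simp
  then show ?thesis by (simp only: powr_powr)
qed

lemma nn_integral_bessel_weight_line_finite:
  fixes a :: real
  assumes "a > 1/2"
  shows "(\<integral>\<^sup>+x. ennreal ((1 + x\<^sup>2) powr (- a)) \<partial>lborel) < \<infinity>"
proof -
  let ?f = "\<lambda>x::real. indicator {1..} x * ennreal (x powr (- 2 * a))"
  have 1: "(\<integral>\<^sup>+x. ?f x \<partial>lborel) < \<infinity>"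
  proof -
    have "((\<lambda>x::real. x powr (- 2 * a)) has_integral (- (1 powr (- 2 * a + 1)) / (- 2 * a + 1))) {1..}"
      using assms by (intro has_integral_powr_to_inf) auto
    then have "((\<lambda>x::real. if x \<in> {1..} then x powr (- 2 * a) else 0) has_integral (- (1 powr (- 2 * a + 1)) / (- 2 * a + 1))) UNIV"
      by (simp only: has_integral_restrict_UNIV)
    then have e: "(\<integral>\<^sup>+x. ennreal (if x \<in> {1..} then x powr (- 2 * a) else 0) \<partial>lborel) = ennreal (- (1 powr (- 2 * a + 1)) / (- 2 * a + 1))"
      by (rule nn_integral_has_integral_lborel[rotated 2]) auto
    have e': "(\<integral>\<^sup>+x. ennreal (if x \<in> {1..} then x powr (- 2 * a) else 0) \<partial>lborel) = (\<integral>\<^sup>+x. ?f x \<partial>lborel)"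
      by (intro nn_integral_cong) (auto simp: indicator_def)
    show ?thesis unfolding e'[symmetric] e by simp
  qed
  have 2: "(\<integral>\<^sup>+x. ?f (- x) \<partial>lborel) = (\<integral>\<^sup>+x. ?f x \<partial>lborel)"
    using nn_integral_real_affine[of ?f "-1" 0] by simp
  have "(\<integral>\<^sup>+x. ennreal ((1 + x\<^sup>2) powr (- a)) \<partial>lborel) \<le> (\<integral>\<^sup>+x. indicator {-1..1} x + (?f x + ?f (- x)) \<partial>lborel)"
  proof (rule nn_integral_mono)
    fix x :: real
    consider "\<bar>x\<bar> \<le> 1" | "1 < x" | "x < -1" by linarith
    then show "ennreal ((1 + x\<^sup>2) powr (- a)) \<le> indicator {-1..1} x + (?f x + ?f (- x))"
    proof cases
      case 1
      have "(1 + x\<^sup>2) powr (- a) \<le> 1 powr (- a)" using assms by (intro powr_mono2') auto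
      then have "ennreal ((1 + x\<^sup>2) powr (- a)) \<le> indicator {-1..1} x" using 1 by (simp add: indicator_def abs_le_iff)
      then show ?thesis by (rule order_trans) simp
    next
      case 2
      have "(1 + x\<^sup>2) powr (- a) \<le> (x\<^sup>2) powr (- a)" using assms 2 by (intro powr_mono2') auto
      also have "(x\<^sup>2) powr (- a) = x powr (- 2 * a)" using square_powr[of x "- a"] 2 by simp
      finally have "ennreal ((1 + x\<^sup>2) powr (- a)) \<le> ?f x" using 2 by (auto intro: ennreal_leI)
      also have "\<dots> \<le> ?f x + ?f (- x)" by simp
      also have "\<dots> \<le> indicator {-1..1} x + (?f x + ?f (- x))" by simp
      finally show ?thesis .
    next
      case 3
      have "(1 + x\<^sup>2) powr (- a) \<le> ((- x)\<^sup>2) powr (- a)" using assms 3 by (intro powr_mono2') auto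
      also have "((- x)\<^sup>2) powr (- a) = (- x) powr (- 2 * a)" using square_powr[of "- x" "- a"] 3 by simp
      finally have "ennreal ((1 + x\<^sup>2) powr (- a)) \<le> ?f (- x)" using 3 by (auto intro: ennreal_leI)
      also have "\<dots> \<le> ?f x + ?f (- x)" by simp
      also have "\<dots> \<le> indicator {-1..1} x + (?f x + ?f (- x))" by simp
      finally show ?thesis .
    qed
  qed
  also have "\<dots> = (\<integral>\<^sup>+(x::real). indicator {-1..1} x \<partial>lborel) + ((\<integral>\<^sup>+x. ?f x \<partial>lborel) + (\<integral>\<^sup>+x. ?f (- x) \<partial>lborel))"
  proof -
    have "(\<lambda>x::real. indicator {-1..1} x :: ennreal) \<in> borel_measurable lborel" by simp
    moreover have "?f \<in> borel_measurable lborel" "(\<lambda>x. ?f (- x)) \<in> borel_measurable lborel" by measurable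
    ultimately show ?thesis by (simp only: nn_integral_add borel_measurable_add)
  qed
  also have "\<dots> < \<infinity>" unfolding 2 using 1 by simp
  finally show ?thesis .
qed

text \<open>Distribute the exponent evenly, \<open>s = a * DIM('a)\<close> with
  \<open>a > 1/2\<close>: replacing the norm by one coordinate in each factor only increases it, and
  a product of convergent line integrals remains.\<close>

lemma integrable_bessel_weight:
  fixes s :: real
  assumes s: "s > real DIM('a::euclidean_space) / 2"
  shows "integrable lborel (\<lambda>\<xi>::'a. (1 + (norm \<xi>)\<^sup>2) powr (- s))"
proof (rule integrableI_bounded)
  define a where "a = s / real DIM('a)"
  have a: "a > 1/2" unfolding a_def using s by (simp add: field_simps)
  have "(\<integral>\<^sup>+(\<xi>::'a). ennreal (norm ((1 + (norm \<xi>)\<^sup>2) powr (- s))) \<partial>lborel) \<le> (\<integral>\<^sup>+(\<xi>::'a). (\<Prod>b\<in>Basis. ennreal ((1 + (\<xi> \<bullet> b)\<^sup>2) powr (- a))) \<partial>lborel)"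
  proof (rule nn_integral_mono)
    fix \<xi> :: 'a
    have "(1 + (norm \<xi>)\<^sup>2) powr (- s) = ((1 + (norm \<xi>)\<^sup>2) powr (- a)) ^ DIM('a)"
    proof -
      have "- s = - a * real DIM('a)" by (simp add: a_def)
      moreover have "(1 + (norm \<xi>)\<^sup>2) powr (- a) > 0"
        using add_pos_nonneg[of 1 "(norm \<xi>)\<^sup>2"] by simp
      ultimately show ?thesis by (simp only: powr_powr[symmetric] powr_realpow)
    qed
    also have "\<dots> = (\<Prod>b\<in>(Basis::'a set). (1 + (norm \<xi>)\<^sup>2) powr (- a))" by simp
    also have "\<dots> \<le> (\<Prod>b\<in>Basis. (1 + (\<xi> \<bullet> b)\<^sup>2) powr (- a))"
    proof (intro prod_mono conjI)
      fix b :: 'a assume "b \<in> Basis"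
      then have "(\<xi> \<bullet> b)\<^sup>2 \<le> (norm \<xi>)\<^sup>2" using Basis_le_norm[of b \<xi>] power_mono[of "\<bar>\<xi> \<bullet> b\<bar>" "norm \<xi>" 2] by simp
      then show "(1 + (norm \<xi>)\<^sup>2) powr (- a) \<le> (1 + (\<xi> \<bullet> b)\<^sup>2) powr (- a)"
        using a by (intro powr_mono2') (auto simp: add_pos_nonneg)
    qed simp
    finally have "ennreal ((1 + (norm \<xi>)\<^sup>2) powr (- s)) \<le> ennreal (\<Prod>b\<in>Basis. (1 + (\<xi> \<bullet> b)\<^sup>2) powr (- a))"
      by (rule ennreal_leI)
    then show "ennreal (norm ((1 + (norm \<xi>)\<^sup>2) powr (- s))) \<le> (\<Prod>b\<in>Basis. ennreal ((1 + (\<xi> \<bullet> b)\<^sup>2) powr (- a)))"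
      by (simp add: prod_ennreal)
  qed
  also have "\<dots> = (\<Prod>b\<in>(Basis::'a set). \<integral>\<^sup>+x. ennreal ((1 + x\<^sup>2) powr (- a)) \<partial>lborel)"
    by (rule nn_integral_lborel_prod) auto
  also have "\<dots> < \<infinity>"
    using nn_integral_bessel_weight_line_finite[OF a] by (simp add: power_less_top_ennreal)
  finally show "(\<integral>\<^sup>+(\<xi>::'a). ennreal (norm ((1 + (norm \<xi>)\<^sup>2) powr (- s))) \<partial>lborel) < \<infinity>" .
qed simp

text \<open>\<open>g\<close> plays the role of the Fourier transform of the initial value. Unlike
  \<open>propagator\<close> this is an integral defined at every point of space-time, hence a
  candidate for the jointly measurable version.\<close>

definition free_solution :: "real \<Rightarrow> (real ^ 'n \<Rightarrow> complex) \<Rightarrow> real \<times> (real ^ 'n) \<Rightarrow> complex" where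
  "free_solution \<epsilon> g z = fourier_integral 1 (\<lambda>\<xi>. cis (fst z * ((norm \<xi>) ^ 4 + \<epsilon> * (norm \<xi>)\<^sup>2)) * g \<xi>) (snd z)"

text \<open>\<open>F\<close> is the Fourier transform of the L2 function whose Bessel potential is
  \<open>u\<close>. As \<open>s > n/2\<close>, the weighted \<open>F\<close> is integrable, being a
  product of two L2 functions, so all inverse transforms become integrals. This is the one place
  where the arbitrary representatives chosen by \<open>plancherel\<close> are compared, always up to
  null sets.\<close>

lemma Sobolev_representation:
  fixes u :: "real ^ 'n \<Rightarrow> complex"
  assumes u: "u \<in> Sobolev s" and s: "s > real CARD('n) / 2"
  obtains F where "F \<in> borel_measurable borel" "sqnorm F < \<infinity>" "Sobolev_norm s u = L2norm F"
    "integrable lborel (\<lambda>\<xi>. complex_of_real ((1 + (norm \<xi>)\<^sup>2) powr (- s / 2)) * F \<xi>)"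
    "\<And>\<epsilon> t. AE x in lborel. free_solution \<epsilon> (\<lambda>\<xi>. complex_of_real ((1 + (norm \<xi>)\<^sup>2) powr (- s / 2)) * F \<xi>) (t, x) = propagator \<epsilon> t u x"
proof -
  have one: "\<bar>1\<bar> = (1::real)" "\<bar>- 1\<bar> = (1::real)" by simp_all
  let ?w = "\<lambda>r (\<xi> :: real ^ 'n). complex_of_real ((1 + (norm \<xi>)\<^sup>2) powr (r / 2))"
  from u obtain f where u_meas: "u \<in> borel_measurable borel" and f: "f \<in> L2_functions" and uf: "AE x in lborel. u x = bessel (- s) f x"
    by (auto simp: Sobolev_def)
  have f': "f \<in> borel_measurable borel" "sqnorm f < \<infinity>"
    using f iffD1[OF L2norm_finite_iff[of f]] by (auto simp: L2_functions_def)
  define F where "F = fourier f"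
  have FP: "is_plancherel (-1) f F" unfolding F_def by (rule is_plancherel_plancherel[OF f' one(2)])
  then have F[measurable]: "F \<in> borel_measurable borel" and Ffin: "sqnorm F < \<infinity>"
    by (auto simp: is_plancherel_iff)
  define G where "G \<xi> = ?w (- s) \<xi> * F \<xi>" for \<xi>
  have [measurable]: "G \<in> borel_measurable borel" unfolding G_def by measurable
  have w1: "norm (?w (- s) \<xi>) \<le> 1" for \<xi>
  proof -
    have "(1 + (norm \<xi>)\<^sup>2) powr (- s / 2) \<le> 1 powr (- s / 2)" using s by (intro powr_mono2') auto
    then show ?thesis by simp
  qed
  have Gfin: "sqnorm G < \<infinity>"
    using w1 by (intro order.strict_trans1[OF sqnorm_mono Ffin]) (auto simp: G_def norm_mult intro: mult_left_le_one_le)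
  have Gint: "integrable lborel G"
  proof (rule Bochner_Integration.integrable_bound)
    show "integrable lborel (\<lambda>\<xi>::real ^ 'n. (1 + (norm \<xi>)\<^sup>2) powr (- s) + (norm (F \<xi>))\<^sup>2)"
      using s by (intro Bochner_Integration.integrable_add integrable_bessel_weight iffD1[OF sqnorm_finite_iff_integrable] Ffin) auto
    show "AE \<xi> in lborel. norm (G \<xi>) \<le> norm ((1 + (norm \<xi>)\<^sup>2) powr (- s) + (norm (F \<xi>))\<^sup>2)"
    proof (rule AE_I2)
      fix \<xi>
      let ?a = "(1 + (norm \<xi>)\<^sup>2) powr (- s / 2)" and ?b = "norm (F \<xi>)"
      have "?a * ?b \<le> ?a\<^sup>2 + ?b\<^sup>2"
        using zero_le_power2[of "?a - ?b"] zero_le_power2[of ?a] zero_le_power2[of ?b] unfolding power2_diff by linarith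
      also have "?a\<^sup>2 = (1 + (norm \<xi>)\<^sup>2) powr (- s)" by (simp add: power2_eq_square powr_add[symmetric])
      finally show "norm (G \<xi>) \<le> norm ((1 + (norm \<xi>)\<^sup>2) powr (- s) + (norm (F \<xi>))\<^sup>2)"
        by (simp add: G_def norm_mult)
    qed
  qed measurable
  have b: "bessel (- s) f = inv_fourier G"
    unfolding bessel_def fourier_multiplier_def G_def F_def ..
  have "is_plancherel 1 G (inv_fourier G)" by (rule is_plancherel_plancherel[OF _ Gfin one(1)]) measurable
  then have "AE x in lborel. inv_fourier G x = fourier_integral 1 G x"
    using is_plancherel_fourier_integral[OF Gint Gfin one(1)] by (rule is_plancherel_unique[rotated]) measurable
  then have uG: "AE x in lborel. fourier_integral 1 G x = u x" using uf unfolding b by eventually_elim simp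
  \<comment> \<open>Fourier inversion: it identifies the transform of \<open>u\<close> itself, from
    which both the Sobolev norm and the propagator are computed.\<close>
  have "is_plancherel (-1) (fourier_integral 1 G) G" by (rule is_plancherel_inverse[OF Gint Gfin one(1)])
  then have uG': "is_plancherel (-1) u G"
    by (rule is_plancherel_cong_AE[OF uG _ u_meas, rotated]) measurable
  then have "is_plancherel (-1) u (fourier u)" unfolding plancherel_def by (rule someI[of "is_plancherel (-1) u"])
  then have [measurable]: "fourier u \<in> borel_measurable borel" by (simp add: is_plancherel_iff)
  have fu: "AE \<xi> in lborel. fourier u \<xi> = G \<xi>"
    by (rule is_plancherel_unique[OF u_meas \<open>is_plancherel (-1) u (fourier u)\<close> uG'])
  have norm: "Sobolev_norm s u = L2norm F"
    unfolding Sobolev_norm_def bessel_def fourier_multiplier_def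
  proof (rule L2norm_cong_sqnorm)
    let ?H = "\<lambda>\<xi>. ?w s \<xi> * fourier u \<xi>"
    have "AE \<xi> in lborel. ?H \<xi> = F \<xi>"
      using fu
    proof eventually_elim
      case (elim \<xi>)
      have "(1 + (norm \<xi>)\<^sup>2) powr (s / 2) * (1 + (norm \<xi>)\<^sup>2) powr (- s / 2) = 1"
        by (simp add: powr_add[symmetric] add_nonneg_eq_0_iff)
      then have "?w s \<xi> * ?w (- s) \<xi> = 1" unfolding of_real_mult[symmetric] by simp
      then show ?case unfolding elim G_def mult.assoc[symmetric] by simp
    qed
    then have sH: "sqnorm ?H = sqnorm F" by (rule sqnorm_cong_AE)
    have "sqnorm (inv_fourier ?H) = sqnorm ?H"
      by (rule sqnorm_is_plancherel[OF _ _ one(1) is_plancherel_plancherel[OF _ _ one(1)]]) (use sH Ffin in auto)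
    then show "sqnorm (inv_fourier ?H) = sqnorm F" using sH by simp
  qed
  have sol: "AE x in lborel. free_solution \<epsilon> G (t, x) = propagator \<epsilon> t u x" for \<epsilon> t
  proof -
    let ?m = "\<lambda>\<xi> :: real ^ 'n. cis (t * ((norm \<xi>) ^ 4 + \<epsilon> * (norm \<xi>)\<^sup>2))"
    let ?H = "\<lambda>\<xi>. ?m \<xi> * fourier u \<xi>" and ?K = "\<lambda>\<xi>. ?m \<xi> * G \<xi>"
    have eq: "AE \<xi> in lborel. ?H \<xi> = ?K \<xi>" using fu by eventually_elim simp
    have Kint: "integrable lborel ?K" by (intro integrable_cis_mult Gint) measurable
    have sK: "sqnorm ?K = sqnorm G" unfolding sqnorm_def by (simp add: norm_mult)
    have sH: "sqnorm ?H = sqnorm G" using sqnorm_cong_AE[OF eq] sK by simp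
    have "is_plancherel 1 ?K (fourier_integral 1 ?K)"
      by (rule is_plancherel_fourier_integral[OF Kint _ one(1)]) (use sK Gfin in simp)
    then have "is_plancherel 1 ?H (fourier_integral 1 ?K)"
      by (rule is_plancherel_cong_AE[rotated 3]) (use eq in auto)
    moreover have "is_plancherel 1 ?H (inv_fourier ?H)"
      by (rule is_plancherel_plancherel[OF _ _ one(1)]) (use sH Gfin in auto)
    ultimately have "AE x in lborel. fourier_integral 1 ?K x = inv_fourier ?H x"
      by (rule is_plancherel_unique[rotated]) measurable
    then show ?thesis unfolding free_solution_def propagator_def fourier_multiplier_def by simp
  qed
  show thesis
    by (rule that[OF F Ffin norm]) (use Gint sol in \<open>auto simp: G_def[abs_def]\<close>)
qed

lemma free_solution_measurable:
  fixes g :: "real ^ 'n \<Rightarrow> complex"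
  assumes [measurable]: "g \<in> borel_measurable borel"
  shows "free_solution \<epsilon> g \<in> borel_measurable borel"
proof -
  have "(\<lambda>z::real \<times> (real ^ 'n). LINT \<xi>|lborel. cis (1 * (\<xi> \<bullet> snd z)) * (cis (fst z * ((norm \<xi>) ^ 4 + \<epsilon> * (norm \<xi>)\<^sup>2)) * g \<xi>)) \<in> borel_measurable (borel \<Otimes>\<^sub>M borel)"
    by (rule lborel.borel_measurable_lebesgue_integral) measurable
  then show ?thesis
    unfolding free_solution_def[abs_def] fourier_integral_alt borel_prod by measurable
qed

text \<open>Any single version bounds the infimum from above, and a pointwise bound on the cylinder
  over \<open>A\<close> bounds its essential supremum.\<close>

lemma Linf_spacetime_norm_le:
  fixes v :: "real \<times> (real ^ 'n) \<Rightarrow> complex"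
  assumes v: "v \<in> borel_measurable borel" and ae: "\<And>t. AE x in lborel. v (t, x) = U t x"
    and bound: "\<And>t x. x \<in> A \<Longrightarrow> norm (v (t, x)) \<le> S"
  shows "Linf_spacetime_norm U A \<le> ennreal S"
proof -
  have "spacetime_version U v" unfolding spacetime_version_def using v ae by simp
  then have "Linf_spacetime_norm U A \<le> esssup (restrict_space lborel (UNIV \<times> A)) (\<lambda>z. ennreal (norm (v z)))"
    unfolding Linf_spacetime_norm_def by (intro INF_lower) simp
  also have "\<dots> \<le> ennreal S"
  proof (rule esssup_I)
    show "(\<lambda>z. ennreal (norm (v z))) \<in> borel_measurable (restrict_space lborel (UNIV \<times> A))"
      using v by (intro measurable_restrict_space1) simp
    show "AE z in restrict_space lborel (UNIV \<times> A). ennreal (norm (v z)) \<le> ennreal S"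
      by (rule AE_I2) (auto simp: space_restrict_space intro!: ennreal_leI bound)
  qed
  finally show ?thesis .
qed

text \<open>Minkowski's inequality from Jensen: with \<open>S\<close> the sum of the
  \<open>A j\<close>, the inner sum is the average with weights \<open>A j / S\<close> of the
  numbers \<open>S * a j i / A j\<close>. Convexity of the power moves the exponent inside, and the
  hypothesis sums out \<open>i\<close>.\<close>

lemma sum_powr_sum_le:
  fixes a :: "'j \<Rightarrow> 'i \<Rightarrow> real" and A :: "'j \<Rightarrow> real"
  assumes J: "finite J" and E: "finite E" and p: "1 \<le> p"
    and a: "\<And>j i. j \<in> J \<Longrightarrow> i \<in> E \<Longrightarrow> 0 \<le> a j i" and A: "\<And>j. j \<in> J \<Longrightarrow> 0 < A j"
    and le: "\<And>j. j \<in> J \<Longrightarrow> (\<Sum>i\<in>E. a j i powr p) \<le> A j powr p"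
  shows "(\<Sum>i\<in>E. (\<Sum>j\<in>J. a j i) powr p) \<le> (\<Sum>j\<in>J. A j) powr p"
proof (cases "J = {}")
  case False
  define S where "S = (\<Sum>j\<in>J. A j)"
  have S: "0 < S" unfolding S_def using J False A by (intro sum_pos) auto
  have convex: "(\<Sum>j\<in>J. A j / S * y j) powr p \<le> (\<Sum>j\<in>J. A j / S * y j powr p)" if y: "\<And>j. j \<in> J \<Longrightarrow> 0 \<le> y j" for y
  proof -
    \<comment> \<open>The shift by \<open>e\<close> keeps the arguments positive, where convexity of
      the power is applied; continuity afterwards removes it.\<close>
    have pos: "(\<Sum>j\<in>J. A j / S * y j) powr p \<le> (\<Sum>j\<in>J. A j / S * (y j + e) powr p)" if e: "0 < e" for e
    proof -
      have AS: "0 \<le> A j / S" if "j \<in> J" for j using S A[OF that] by simp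
      have "(\<Sum>j\<in>J. A j / S * y j) powr p \<le> (\<Sum>j\<in>J. (A j / S) *\<^sub>R (y j + e)) powr p"
        unfolding real_scaleR_def using AS y e p
        by (intro powr_mono2 sum_nonneg sum_mono mult_left_mono mult_nonneg_nonneg) auto
      also have "\<dots> \<le> (\<Sum>j\<in>J. A j / S * (y j + e) powr p)"
      proof (rule convex_on_sum[OF J False powr_convex[OF p]])
        show "(\<Sum>j\<in>J. A j / S) = 1" using S by (simp add: sum_divide_distrib[symmetric] S_def)
      qed (use S A y e in \<open>auto simp: less_imp_le add_nonneg_pos\<close>)
      finally show ?thesis .
    qed
    have "((\<lambda>n. \<Sum>j\<in>J. A j / S * (y j + 1 / real (Suc n)) powr p) \<longlonglongrightarrow> (\<Sum>j\<in>J. A j / S * (y j + 0) powr p))"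
      using p y by (intro tendsto_sum tendsto_mult tendsto_const tendsto_powr' tendsto_add lim_1_over_n[THEN LIMSEQ_Suc]) auto
    then have "(\<Sum>j\<in>J. A j / S * y j) powr p \<le> (\<Sum>j\<in>J. A j / S * (y j + 0) powr p)"
      by (rule LIMSEQ_le_const) (intro exI[of _ 0] allI impI pos, simp)
    then show ?thesis by simp
  qed
  have "(\<Sum>j\<in>J. a j i) powr p \<le> (\<Sum>j\<in>J. A j / S * (S powr p * (a j i powr p / A j powr p)))" if "i \<in> E" for i
  proof -
    have "(\<Sum>j\<in>J. a j i) = (\<Sum>j\<in>J. A j / S * (S * a j i / A j))"
      using S A by (intro sum.cong refl) (auto simp: less_imp_neq[symmetric])
    also have "\<dots> powr p \<le> (\<Sum>j\<in>J. A j / S * (S * a j i / A j) powr p)"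
      using S A a that by (intro convex) (auto simp: less_imp_le)
    finally show ?thesis by (simp add: powr_mult powr_divide)
  qed
  then have "(\<Sum>i\<in>E. (\<Sum>j\<in>J. a j i) powr p) \<le> (\<Sum>i\<in>E. \<Sum>j\<in>J. A j / S * (S powr p * (a j i powr p / A j powr p)))"
    by (rule sum_mono)
  also have "\<dots> = (\<Sum>j\<in>J. A j / S * (S powr p * ((\<Sum>i\<in>E. a j i powr p) / A j powr p)))"
    by (subst sum.swap) (simp add: sum_distrib_left sum_divide_distrib)
  also have "\<dots> \<le> (\<Sum>j\<in>J. A j / S * (S powr p * 1))"
  proof (intro sum_mono mult_left_mono)
    fix j assume j: "j \<in> J"
    show "(\<Sum>i\<in>E. a j i powr p) / A j powr p \<le> 1"
      using A[OF j] le[OF j] by (simp add: divide_le_eq)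
    show "0 \<le> A j / S" using S A[OF j] by simp
  qed simp
  also have "\<dots> = (\<Sum>j\<in>J. A j) / S * S powr p"
    by (simp add: sum_distrib_right[symmetric] sum_divide_distrib[symmetric])
  also have "\<dots> = S powr p" using S by (simp add: S_def)
  finally show ?thesis unfolding S_def .
qed (use p in simp)

text \<open>Nonnegative and nonpositive \<open>k\<close> contribute at most
  \<open>2 + 1 / \<rho>\<close> each: 1 from \<open>k = 0\<close>, and a geometric series started at
  \<open>\<bar>k\<bar> = 1\<close> with sum at most \<open>1 + 1 / \<rho>\<close>. The offset 1 is
  the possible loss between lattice indices and points of their cubes.\<close>

lemma sum_exp_int_le:
  fixes \<rho> :: real
  assumes \<rho>: "0 < \<rho>" and S: "finite S"
  shows "(\<Sum>k\<in>S. exp (- \<rho> * max 0 (real_of_int \<bar>k\<bar> - 1))) \<le> 4 + 2 / \<rho>"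
proof -
  let ?g = "\<lambda>k::int. exp (- \<rho> * max 0 (real_of_int \<bar>k\<bar> - 1))"
  obtain M where M: "S \<subseteq> {- int M..int M}"
  proof -
    obtain M where "\<And>k. k \<in> S \<Longrightarrow> \<bar>k\<bar> \<le> M"
      using Max_ge[OF finite_imageI[OF S, of abs]] by blast
    then have "S \<subseteq> {- int (nat M)..int (nat M)}" by (force simp: abs_le_iff)
    then show thesis by (rule that)
  qed
  have nat_sum: "(\<Sum>m\<le>M. ?g (int m)) \<le> 2 + 1 / \<rho>"
  proof -
    have "(\<Sum>m\<le>M. ?g (int m)) = ?g 0 + (\<Sum>m<M. exp (- \<rho>) ^ m)"
      by (subst sum.atMost_shift) (simp add: exp_of_nat_mult[symmetric] mult.commute)
    also have "(\<Sum>m<M. exp (- \<rho>) ^ m) \<le> 1 / (1 - exp (- \<rho>))"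
    proof -
      have "(\<Sum>m<M. exp (- \<rho>) ^ m) \<le> (\<Sum>m. exp (- \<rho>) ^ m)"
        using \<rho> by (intro sum_le_suminf summable_geometric) auto
      also have "\<dots> = 1 / (1 - exp (- \<rho>))" using \<rho> by (intro suminf_geometric) auto
      finally show ?thesis .
    qed
    also have "1 / (1 - exp (- \<rho>)) \<le> 1 + 1 / \<rho>"
    proof -
      have "1 + \<rho> \<le> exp \<rho>" by (rule exp_ge_add_one_self)
      then have "exp (- \<rho>) \<le> 1 / (1 + \<rho>)" using \<rho> by (simp add: exp_minus field_simps)
      then have "\<rho> / (1 + \<rho>) \<le> 1 - exp (- \<rho>)" using \<rho> by (simp add: field_simps)
      then have "1 / (1 - exp (- \<rho>)) \<le> 1 / (\<rho> / (1 + \<rho>))" using \<rho> by (intro divide_left_mono) auto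
      also have "\<dots> = 1 + 1 / \<rho>" using \<rho> by (simp add: field_simps)
      finally show ?thesis .
    qed
    finally show ?thesis by simp
  qed
  have "(\<Sum>k\<in>S. ?g k) \<le> (\<Sum>k\<in>(int ` {..M}) \<union> ((\<lambda>m. - int m) ` {..M}). ?g k)"
  proof (rule sum_mono2)
    show "S \<subseteq> (int ` {..M}) \<union> ((\<lambda>m. - int m) ` {..M})"
    proof
      fix k assume "k \<in> S"
      then have "k \<in> {- int M..int M}" using M by blast
      then have "nat \<bar>k\<bar> \<le> M" by auto
      moreover have "k = int (nat \<bar>k\<bar>) \<or> k = - int (nat \<bar>k\<bar>)" by auto
      ultimately show "k \<in> (int ` {..M}) \<union> ((\<lambda>m. - int m) ` {..M})" by blast
    qed
  qed auto
  also have "\<dots> \<le> (\<Sum>k\<in>int ` {..M}. ?g k) + (\<Sum>k\<in>(\<lambda>m. - int m) ` {..M}. ?g k)"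
  proof -
    have "sum ?g (int ` {..M} \<union> (\<lambda>m. - int m) ` {..M}) + sum ?g (int ` {..M} \<inter> (\<lambda>m. - int m) ` {..M})
        = sum ?g (int ` {..M}) + sum ?g ((\<lambda>m. - int m) ` {..M})"
      by (rule sum.union_inter) auto
    moreover have "0 \<le> sum ?g (int ` {..M} \<inter> (\<lambda>m. - int m) ` {..M})" by (intro sum_nonneg) auto
    ultimately show ?thesis by linarith
  qed
  also have "\<dots> = (\<Sum>m\<le>M. ?g (int m)) + (\<Sum>m\<le>M. ?g (int m))"
    by (simp add: sum.reindex inj_on_def)
  finally show ?thesis using nat_sum by simp
qed

text \<open>Each coordinate of \<open>x \<alpha> - x \<beta>\<close> is at least
  \<open>\<bar>\<alpha> $ i - \<beta> $ i\<bar> - 1\<close> in modulus. Averaging over the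
  coordinates, whence \<open>\<rho> = r / n\<close>, bounds the exponential by a product of
  one-dimensional ones. This is the crowding number \<open>D\<close> of points spread over cubes of
  side \<open>r\<close>.\<close>

lemma sum_exp_cubes_le:
  fixes x :: "int ^ 'n \<Rightarrow> real ^ 'n" and r :: real
  assumes r: "0 < r" and E: "finite E" and x: "\<And>\<beta>. \<beta> \<in> E \<Longrightarrow> x \<beta> \<in> cube \<beta>" and \<alpha>: "\<alpha> \<in> E"
  shows "(\<Sum>\<beta>\<in>E. exp (- r * norm (x \<alpha> - x \<beta>))) \<le> (4 + 2 * real CARD('n) / r) ^ CARD('n)"
proof -
  let ?n = "real CARD('n)"
  define \<rho> where "\<rho> = r / ?n"
  have \<rho>: "0 < \<rho>" using r by (simp add: \<rho>_def)
  let ?g = "\<lambda>k::int. exp (- \<rho> * max 0 (real_of_int \<bar>k\<bar> - 1))"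
  have "(\<Sum>\<beta>\<in>E. exp (- r * norm (x \<alpha> - x \<beta>))) \<le> (\<Sum>\<beta>\<in>E. \<Prod>i\<in>UNIV. ?g (\<alpha> $ i - \<beta> $ i))"
  proof (rule sum_mono)
    fix \<beta> assume \<beta>: "\<beta> \<in> E"
    have comp: "max 0 (real_of_int \<bar>\<alpha> $ i - \<beta> $ i\<bar> - 1) \<le> norm (x \<alpha> - x \<beta>)" for i
    proof -
      have "real_of_int (\<alpha> $ i) - 1/2 \<le> x \<alpha> $ i" "x \<alpha> $ i < real_of_int (\<alpha> $ i) + 1/2"
        "real_of_int (\<beta> $ i) - 1/2 \<le> x \<beta> $ i" "x \<beta> $ i < real_of_int (\<beta> $ i) + 1/2"
        using x[OF \<alpha>] x[OF \<beta>] by (auto simp: cube_def)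
      then have "real_of_int \<bar>\<alpha> $ i - \<beta> $ i\<bar> - 1 \<le> \<bar>(x \<alpha> - x \<beta>) $ i\<bar>" by (simp add: abs_real_def)
      also have "\<dots> \<le> norm (x \<alpha> - x \<beta>)" by (rule component_le_norm_cart)
      finally show ?thesis by simp
    qed
    have "(\<Sum>i\<in>(UNIV::'n set). \<rho> * max 0 (real_of_int \<bar>\<alpha> $ i - \<beta> $ i\<bar> - 1)) \<le> (\<Sum>i\<in>(UNIV::'n set). \<rho> * norm (x \<alpha> - x \<beta>))"
      using \<rho> by (intro sum_mono mult_left_mono comp) auto
    also have "\<dots> = r * norm (x \<alpha> - x \<beta>)" by (simp add: \<rho>_def)
    finally show "exp (- r * norm (x \<alpha> - x \<beta>)) \<le> (\<Prod>i\<in>UNIV. ?g (\<alpha> $ i - \<beta> $ i))"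
      by (simp add: exp_sum[symmetric] sum_negf)
  qed
  also have "\<dots> = (\<Sum>f\<in>(\<lambda>\<beta> i. \<beta> $ i) ` E. \<Prod>i\<in>UNIV. ?g (\<alpha> $ i - f i))"
    by (subst sum.reindex) (auto simp: inj_on_def vec_eq_iff fun_eq_iff)
  \<comment> \<open>Enlarging the index set to the product of its coordinate projections lets the
    sum of products factorise.\<close>
  also have "\<dots> \<le> (\<Sum>f\<in>PiE UNIV (\<lambda>i. (\<lambda>\<beta>. \<beta> $ i) ` E). \<Prod>i\<in>UNIV. ?g (\<alpha> $ i - f i))"
    using E by (intro sum_mono2 finite_PiE) (auto intro: prod_nonneg)
  also have "\<dots> = (\<Prod>i\<in>UNIV. \<Sum>k\<in>(\<lambda>\<beta>. \<beta> $ i) ` E. ?g (\<alpha> $ i - k))"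
    using E by (intro prod_sum_PiE[symmetric]) auto
  also have "\<dots> \<le> (\<Prod>i\<in>(UNIV::'n set). 4 + 2 / \<rho>)"
  proof (intro prod_mono conjI sum_nonneg)
    fix i
    have "(\<Sum>k\<in>(\<lambda>\<beta>. \<beta> $ i) ` E. ?g (\<alpha> $ i - k)) = (\<Sum>k\<in>(\<lambda>k. \<alpha> $ i - k) ` (\<lambda>\<beta>. \<beta> $ i) ` E. ?g k)"
      by (subst sum.reindex) (auto simp: inj_on_def)
    also have "\<dots> \<le> 4 + 2 / \<rho>" using E by (intro sum_exp_int_le \<rho>) auto
    finally show "(\<Sum>k\<in>(\<lambda>\<beta>. \<beta> $ i) ` E. ?g (\<alpha> $ i - k)) \<le> 4 + 2 / \<rho>" .
  qed auto
  also have "\<dots> = (4 + 2 * ?n / r) ^ CARD('n)" by (simp add: \<rho>_def)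
  finally show ?thesis .
qed

section \<open>Dyadic frequency decomposition\<close>

definition dyadic_annulus :: "int \<Rightarrow> 'a::real_normed_vector set" where
  "dyadic_annulus j = {\<xi>. 2 powr real_of_int j \<le> norm \<xi> \<and> norm \<xi> < 2 powr real_of_int (j + 1)}"

lemma dyadic_annulus_sets[measurable]: "dyadic_annulus j \<in> sets borel"
  unfolding dyadic_annulus_def by measurable

lemma indicator_dyadic_annulus:
  assumes "\<xi> \<noteq> 0"
  shows "indicator (dyadic_annulus j) \<xi> = of_bool (j = \<lfloor>log 2 (norm \<xi>)\<rfloor>)"
proof -
  have pos: "0 < norm \<xi>" using assms by simp
  have "2 powr real_of_int j \<le> norm \<xi> \<longleftrightarrow> real_of_int j \<le> log 2 (norm \<xi>)"
    using pos by (simp add: le_log_iff)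
  moreover have "norm \<xi> < 2 powr real_of_int (j + 1) \<longleftrightarrow> log 2 (norm \<xi>) < real_of_int (j + 1)"
    using pos by (simp add: log_less_iff)
  moreover have "j = \<lfloor>log 2 (norm \<xi>)\<rfloor> \<longleftrightarrow> real_of_int j \<le> log 2 (norm \<xi>) \<and> log 2 (norm \<xi>) < real_of_int (j + 1)"
    by (metis floor_eq_iff of_int_1 of_int_add)
  ultimately show ?thesis by (simp add: dyadic_annulus_def indicator_def)
qed

abbreviation bessel_weight :: "real \<Rightarrow> 'a::real_normed_vector \<Rightarrow> real" where
  "bessel_weight s \<xi> \<equiv> (1 + (norm \<xi>)\<^sup>2) powr (- s / 2)"

text \<open>The part of the free solution with frequencies in one annulus, without the constant of
  the Fourier transform, which is restored when the pieces are summed.\<close>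

definition annulus_wave ::
  "real \<Rightarrow> real \<Rightarrow> ('a::euclidean_space \<Rightarrow> complex) \<Rightarrow> int \<Rightarrow> real \<Rightarrow> 'a \<Rightarrow> complex" where
  "annulus_wave \<epsilon> s F j t x = (LINT \<xi>|lborel. cis (\<xi> \<bullet> x) * (cis (t * ((norm \<xi>) ^ 4 + \<epsilon> * (norm \<xi>)\<^sup>2)) *
     (indicator (dyadic_annulus j) \<xi> * (of_real (bessel_weight s \<xi>) * F \<xi>))))"

text \<open>The time factor \<open>\<kappa>\<close> is immaterial, as the sampling times are arbitrary. Hence for \<open>\<epsilon> = 1\<close> the Schroedinger
  regime \<open>r < 1\<close> and the fourth-order regime \<open>r \<ge> 1\<close> are treated uniformly.\<close>

lemma dispersion_rescale:
  assumes "\<epsilon> \<in> {0, 1}" and r: "0 < r"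
  obtains a b \<kappa> :: real where "0 \<le> a" "a \<le> 1" "0 \<le> b" "b \<le> 1" "a = 1 \<or> b = 1"
    "\<And>\<eta>::'a::euclidean_space. (norm (r *\<^sub>R \<eta>)) ^ 4 + \<epsilon> * (norm (r *\<^sub>R \<eta>))\<^sup>2 = \<kappa> * dispersion a b \<eta>"
proof (cases "\<epsilon> = 0 \<or> 1 \<le> r")
  case True
  show thesis
  proof (rule that[of 1 "\<epsilon> / r\<^sup>2" "r ^ 4"])
    show "\<epsilon> / r\<^sup>2 \<le> 1" using True assms by (auto simp: divide_le_eq one_le_power)
    show "(norm (r *\<^sub>R \<eta>)) ^ 4 + \<epsilon> * (norm (r *\<^sub>R \<eta>))\<^sup>2 = r ^ 4 * dispersion 1 (\<epsilon> / r\<^sup>2) \<eta>" for \<eta> :: 'a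
      using r by (simp add: dispersion_def power_mult_distrib field_simps power2_eq_square power4_eq_xxxx)
  qed (use assms in auto)
next
  case False
  then have \<epsilon>: "\<epsilon> = 1" using assms by auto
  show thesis
  proof (rule that[of "r\<^sup>2" 1 "r\<^sup>2"])
    show "r\<^sup>2 \<le> 1" using False r by (simp add: power_le_one)
    show "(norm (r *\<^sub>R \<eta>)) ^ 4 + \<epsilon> * (norm (r *\<^sub>R \<eta>))\<^sup>2 = r\<^sup>2 * dispersion (r\<^sup>2) 1 \<eta>" for \<eta> :: 'a
      unfolding \<epsilon> using r by (simp add: dispersion_def power_mult_distrib algebra_simps power2_eq_square power4_eq_xxxx)
  qed (use r in auto)
qed

text \<open>Substitute \<open>\<xi> = r *\<^sub>R \<eta>\<close>. The Jacobian is
  \<open>r ^ n\<close>, of which the L2 normalisation uses \<open>r powr (n / 2)\<close>; the rest,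
  times the bound \<open>(1 + r\<^sup>2) powr (- s / 2)\<close> of the Bessel weight on frequencies
  of size at least \<open>r\<close>, is \<open>B\<close>. Dividing by \<open>B\<close> makes
  \<open>G\<close> admissible.\<close>

lemma annulus_wave_rescale:
  fixes F :: "'a::euclidean_space \<Rightarrow> complex" and j :: int
  assumes \<epsilon>: "\<epsilon> \<in> {0, 1}" and s: "0 \<le> s" and F[measurable]: "F \<in> borel_measurable borel" and F1: "sqnorm F \<le> 1"
  defines "r \<equiv> 2 powr real_of_int j"
  defines "B \<equiv> (1 + r\<^sup>2) powr (- s / 2) * r powr (real DIM('a) / 2)"
  obtains a b \<kappa> G where "sampled_wave a b G"
    "\<And>t x. annulus_wave \<epsilon> s F j t x = of_real B * (LINT \<eta>|lborel. cis ((r *\<^sub>R x) \<bullet> \<eta> + (\<kappa> * t) * dispersion a b \<eta>) * G \<eta>)"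
proof -
  let ?n = "DIM('a)"
  have r: "0 < r" by (simp add: r_def)
  obtain a b \<kappa> where ab: "0 \<le> a" "a \<le> 1" "0 \<le> b" "b \<le> 1" "a = 1 \<or> b = 1"
    and resc: "\<And>\<eta>::'a. (norm (r *\<^sub>R \<eta>)) ^ 4 + \<epsilon> * (norm (r *\<^sub>R \<eta>))\<^sup>2 = \<kappa> * dispersion a b \<eta>"
    using dispersion_rescale[OF \<epsilon> r, where 'a='a] by blast
  have r1: "0 < 1 + r\<^sup>2" using r by (simp add: add_pos_pos)
  then have B: "0 < B" unfolding B_def using r by simp
  define G where "G \<eta> = of_real (r ^ ?n / B) * (indicator (dyadic_annulus 0) \<eta> * (of_real (bessel_weight s (r *\<^sub>R \<eta>)) * F (r *\<^sub>R \<eta>)))" for \<eta> :: 'a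
  have [measurable]: "G \<in> borel_measurable borel" unfolding G_def by measurable
  have ann: "r *\<^sub>R \<eta> \<in> dyadic_annulus j \<longleftrightarrow> \<eta> \<in> dyadic_annulus 0" for \<eta> :: 'a
  proof -
    have "2 powr real_of_int (j + 1) = r * 2" unfolding r_def by (simp add: powr_add)
    then show ?thesis using r unfolding dyadic_annulus_def r_def[symmetric] by (simp add: mult_less_cancel_left_pos)
  qed
  have Gb: "(norm (G \<eta>))\<^sup>2 \<le> r ^ ?n * (norm (F (0 + r *\<^sub>R \<eta>)))\<^sup>2" for \<eta>
  proof (cases "\<eta> \<in> dyadic_annulus 0")
    case True
    then have "1 \<le> norm \<eta>" by (simp add: dyadic_annulus_def)
    then have "r \<le> norm (r *\<^sub>R \<eta>)" using r by simp
    then have "r\<^sup>2 \<le> (norm (r *\<^sub>R \<eta>))\<^sup>2" using r by (intro power_mono) auto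
    then have w: "bessel_weight s (r *\<^sub>R \<eta>) \<le> (1 + r\<^sup>2) powr (- s / 2)"
      using s r1 by (intro powr_mono2') auto
    have rn: "r ^ ?n = (r powr (real ?n / 2))\<^sup>2"
      using r by (simp add: power2_eq_square powr_add[symmetric] powr_realpow)
    have "r ^ ?n / B * bessel_weight s (r *\<^sub>R \<eta>) \<le> r ^ ?n / B * (1 + r\<^sup>2) powr (- s / 2)"
      using r B by (intro mult_left_mono w) auto
    also have "\<dots> = r powr (real ?n / 2)"
      unfolding B_def rn using r r1 by (simp add: power2_eq_square)
    finally have "r ^ ?n / B * bessel_weight s (r *\<^sub>R \<eta>) \<le> r powr (real ?n / 2)" .
    then have "(r ^ ?n / B * bessel_weight s (r *\<^sub>R \<eta>)) * norm (F (r *\<^sub>R \<eta>)) \<le> r powr (real ?n / 2) * norm (F (r *\<^sub>R \<eta>))"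
      by (rule mult_right_mono) simp
    moreover have "norm (G \<eta>) = (r ^ ?n / B * bessel_weight s (r *\<^sub>R \<eta>)) * norm (F (r *\<^sub>R \<eta>))"
      unfolding G_def norm_mult norm_of_real using True r B by simp
    ultimately have "norm (G \<eta>) \<le> r powr (real ?n / 2) * norm (F (r *\<^sub>R \<eta>))" by (simp only:)
    then have "(norm (G \<eta>))\<^sup>2 \<le> (r powr (real ?n / 2) * norm (F (r *\<^sub>R \<eta>)))\<^sup>2"
      by (rule power_mono) simp
    then show ?thesis unfolding rn power_mult_distrib by simp
  qed (use r in \<open>simp add: G_def\<close>)
  have "sqnorm G \<le> (\<integral>\<^sup>+\<eta>. ennreal (\<bar>r\<bar> ^ ?n) * ennreal ((norm (F (0 + r *\<^sub>R \<eta>)))\<^sup>2) \<partial>lborel)"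
    unfolding sqnorm_def using r Gb by (intro nn_integral_mono) (simp add: ennreal_mult'[symmetric] ennreal_leI)
  also have "\<dots> = ennreal (\<bar>r\<bar> ^ ?n) * (\<integral>\<^sup>+\<eta>. ennreal ((norm (F (0 + r *\<^sub>R \<eta>)))\<^sup>2) \<partial>lborel)"
    by (rule nn_integral_cmult) measurable
  also have "\<dots> = sqnorm F"
    unfolding sqnorm_def by (rule nn_integral_lborel_affine[symmetric]) (use r in auto)
  finally have sG: "sqnorm G \<le> 1" using F1 by (rule order_trans)
  then have sG': "sqnorm G < \<infinity>" by (rule order.strict_trans1) simp
  have "sampled_wave a b G"
  proof
    show "1 \<le> norm \<xi> \<and> norm \<xi> \<le> 2" if "G \<xi> \<noteq> 0" for \<xi>
    proof -
      have "\<xi> \<in> dyadic_annulus 0" using that by (auto simp: G_def indicator_def split: if_splits)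
      then show ?thesis by (simp add: dyadic_annulus_def)
    qed
    show "integrable lborel (\<lambda>\<xi>. (norm (G \<xi>))\<^sup>2)"
      by (rule iffD1[OF sqnorm_finite_iff_integrable sG']) simp
    show "(LINT \<xi>|lborel. (norm (G \<xi>))\<^sup>2) \<le> 1"
      using sG unfolding sqnorm_eq_integral[OF \<open>G \<in> borel_measurable borel\<close> sG'] by simp
  qed (use ab in auto)
  moreover have "annulus_wave \<epsilon> s F j t x = of_real B * (LINT \<eta>|lborel. cis ((r *\<^sub>R x) \<bullet> \<eta> + (\<kappa> * t) * dispersion a b \<eta>) * G \<eta>)" for t x
  proof -
    let ?f = "\<lambda>\<xi>. cis (\<xi> \<bullet> x) * (cis (t * ((norm \<xi>) ^ 4 + \<epsilon> * (norm \<xi>)\<^sup>2)) *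
       (indicator (dyadic_annulus j) \<xi> * (of_real (bessel_weight s \<xi>) * F \<xi>)))"
    have "annulus_wave \<epsilon> s F j t x = (\<bar>r\<bar> ^ ?n) *\<^sub>R (LINT \<eta>|lborel. ?f (0 + r *\<^sub>R \<eta>))"
      unfolding annulus_wave_def using r by (intro integral_lborel_affine) auto
    also have "\<dots> = (LINT \<eta>|lborel. of_real (r ^ ?n) * ?f (0 + r *\<^sub>R \<eta>))"
      using r unfolding scaleR_conv_of_real by (simp only: integral_mult_right_zero abs_of_pos)
    also have "\<dots> = (LINT \<eta>|lborel. of_real B * (cis ((r *\<^sub>R x) \<bullet> \<eta> + (\<kappa> * t) * dispersion a b \<eta>) * G \<eta>))"
    proof (rule Bochner_Integration.integral_cong[OF refl])
      fix \<eta> :: 'a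
      have "t * ((norm (r *\<^sub>R \<eta>)) ^ 4 + \<epsilon> * (norm (r *\<^sub>R \<eta>))\<^sup>2) = \<kappa> * t * dispersion a b \<eta>"
        unfolding resc by simp
      moreover have "(r *\<^sub>R \<eta>) \<bullet> x = (r *\<^sub>R x) \<bullet> \<eta>" by (simp add: inner_commute)
      moreover have "indicator (dyadic_annulus j) (r *\<^sub>R \<eta>) = (indicator (dyadic_annulus 0) \<eta> :: complex)"
        using ann by (simp add: indicator_def)
      ultimately have "?f (0 + r *\<^sub>R \<eta>) = cis ((r *\<^sub>R x) \<bullet> \<eta> + (\<kappa> * t) * dispersion a b \<eta>) *
          (indicator (dyadic_annulus 0) \<eta> * (of_real (bessel_weight s (r *\<^sub>R \<eta>)) * F (r *\<^sub>R \<eta>)))"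
        unfolding cis_mult[symmetric] add_0_left mult.assoc by (simp only:)
      moreover have "of_real B * (u * (of_real (r ^ ?n / B) * v)) = of_real (r ^ ?n) * (u * v)" for u v :: complex
        using B by simp
      ultimately show "of_real (r ^ ?n) * ?f (0 + r *\<^sub>R \<eta>) = of_real B * (cis ((r *\<^sub>R x) \<bullet> \<eta> + (\<kappa> * t) * dispersion a b \<eta>) * G \<eta>)"
        unfolding G_def by simp
    qed
    finally show ?thesis by (simp only: integral_mult_right_zero)
  qed
  ultimately show thesis by (rule that)
qed

text \<open>The three factors are the Bessel weight, the L2 scaling and the crowding number to the
  power 1/q. For r >= 1 the last is bounded and r^(n/2 - s) remains; for r <= 1 the weight is at
  most 1 and r^(n/2 - n/q) remains. \<open>\<delta>\<close> is the smaller of the two rates.\<close>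

lemma dyadic_constant_bound:
  fixes n s q :: real
  assumes n: "0 < n" and s: "n / 2 < s" and q: "2 < q"
  obtains C \<delta> where "0 < C" "0 < \<delta>" "\<And>j. (1 + (2 powr real_of_int j)\<^sup>2) powr (- s / 2) * (2 powr real_of_int j) powr (n / 2) *
      (4 + 2 * n / 2 powr real_of_int j) powr (n / q) \<le> C * 2 powr (- \<delta> * \<bar>real_of_int j\<bar>)"
proof -
  define \<delta> where "\<delta> = min (s - n / 2) (n / 2 - n / q)"
  have nq: "n / q < n / 2" using n q by (intro divide_strict_left_mono) auto
  then have \<delta>: "0 < \<delta>" using s by (simp add: \<delta>_def)
  define C where "C = (2 * (4 + 2 * n)) powr (n / q)"
  have C: "0 < C" using n by (simp add: C_def)
  have "(1 + (2 powr real_of_int j)\<^sup>2) powr (- s / 2) * (2 powr real_of_int j) powr (n / 2) *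
      (4 + 2 * n / 2 powr real_of_int j) powr (n / q) \<le> C * 2 powr (- \<delta> * \<bar>real_of_int j\<bar>)" for j :: int
  proof -
    let ?r = "2 powr real_of_int j"
    have r: "0 < ?r" by simp
    show ?thesis
    proof (cases "0 \<le> j")
      case True
      then have r1: "1 \<le> ?r" by (simp add: ge_one_powr_ge_zero)
      have 1: "(1 + ?r\<^sup>2) powr (- s / 2) \<le> ?r powr (- s)"
      proof -
        have "(1 + ?r\<^sup>2) powr (- s / 2) \<le> (?r\<^sup>2) powr (- s / 2)" using s n by (intro powr_mono2') auto
        also have "\<dots> = ?r powr (2 * (- s / 2))" by (rule square_powr) simp
        finally show ?thesis by simp
      qed
      have 2: "(4 + 2 * n / ?r) powr (n / q) \<le> C"
        unfolding C_def
      proof (rule powr_mono2)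
        have "2 * n / ?r \<le> 2 * n" using r1 n by (simp add: divide_le_eq mult_left_mono)
        then show "4 + 2 * n / ?r \<le> 2 * (4 + 2 * n)" using n by simp
      qed (use n q in auto)
      have "(1 + ?r\<^sup>2) powr (- s / 2) * ?r powr (n / 2) * (4 + 2 * n / ?r) powr (n / q) \<le> ?r powr (- s) * ?r powr (n / 2) * C"
        by (intro mult_mono 1 2) auto
      also have "\<dots> = C * 2 powr (real_of_int j * (n / 2 - s))"
        unfolding powr_powr powr_add[symmetric] by (simp add: algebra_simps powr_add[symmetric])
      also have "\<dots> \<le> C * 2 powr (- \<delta> * \<bar>real_of_int j\<bar>)"
      proof (intro mult_left_mono powr_mono)
        have "\<delta> * real_of_int j \<le> (s - n / 2) * real_of_int j" using True by (intro mult_right_mono) (auto simp: \<delta>_def)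
        then show "real_of_int j * (n / 2 - s) \<le> - \<delta> * \<bar>real_of_int j\<bar>" using True by (simp add: algebra_simps)
      qed (use C in auto)
      finally show ?thesis .
    next
      case False
      then have "?r \<le> 2 powr 0" by (intro powr_mono) auto
      then have r1: "?r \<le> 1" by simp
      have 1: "(1 + ?r\<^sup>2) powr (- s / 2) \<le> 1"
      proof -
        have "(1 + ?r\<^sup>2) powr (- s / 2) \<le> 1 powr (- s / 2)" using s n by (intro powr_mono2') auto
        then show ?thesis by simp
      qed
      have 2: "(4 + 2 * n / ?r) powr (n / q) \<le> C * ?r powr (- (n / q))"
      proof -
        have "4 \<le> 4 / ?r" using r1 r by (simp add: le_divide_eq)
        moreover have "4 / ?r + 2 * n / ?r \<le> 2 * (4 + 2 * n) / ?r"
          unfolding add_divide_distrib[symmetric] using n r by (intro divide_right_mono) auto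
        ultimately have "4 + 2 * n / ?r \<le> 2 * (4 + 2 * n) / ?r" by linarith
        then have "(4 + 2 * n / ?r) powr (n / q) \<le> (2 * (4 + 2 * n) / ?r) powr (n / q)"
          using n q r by (intro powr_mono2 add_nonneg_nonneg) auto
        then show ?thesis unfolding C_def powr_divide powr_minus_divide by simp
      qed
      have "(1 + ?r\<^sup>2) powr (- s / 2) * ?r powr (n / 2) * (4 + 2 * n / ?r) powr (n / q) \<le> 1 * ?r powr (n / 2) * (C * ?r powr (- (n / q)))"
        by (intro mult_mono 1 2) auto
      also have "\<dots> = C * 2 powr (real_of_int j * (n / 2 - n / q))"
        unfolding powr_powr by (simp add: algebra_simps powr_add[symmetric])
      also have "\<dots> \<le> C * 2 powr (- \<delta> * \<bar>real_of_int j\<bar>)"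
      proof (intro mult_left_mono powr_mono)
        have "(n / 2 - n / q) * real_of_int j \<le> \<delta> * real_of_int j" using False by (intro mult_right_mono_neg) (auto simp: \<delta>_def)
        then show "real_of_int j * (n / 2 - n / q) \<le> - \<delta> * \<bar>real_of_int j\<bar>" using False by (simp add: algebra_simps)
      qed (use C in auto)
      finally show ?thesis .
    qed
  qed
  then show thesis using that C \<delta> by blast
qed

text \<open>Spatial samples scaled by \<open>r\<close> have crowding number
  \<open>D = (4 + 2 * n / r) ^ n\<close>, so the unit-frequency estimate costs
  \<open>D powr (1 / q)\<close> in the norm. Together with the factor \<open>B\<close> of the
  rescaling this is the product bounded by \<open>dyadic_constant_bound\<close>.\<close>

lemma annulus_wave_sum_powr_le:
  fixes \<epsilon> p s :: real
  assumes \<epsilon>: "\<epsilon> \<in> {0, 1}" and p: "p \<ge> 2 + 8 / real CARD('n::finite)" and s: "s > real CARD('n) / 2"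
  obtains C \<delta> where "0 < C" "0 < \<delta>"
    "\<And>F j E t x. F \<in> borel_measurable borel \<Longrightarrow> sqnorm F \<le> 1 \<Longrightarrow> finite E \<Longrightarrow> (\<And>\<alpha>. \<alpha> \<in> E \<Longrightarrow> x \<alpha> \<in> cube \<alpha>) \<Longrightarrow>
      (\<Sum>\<alpha>\<in>E. norm (annulus_wave \<epsilon> s F j (t \<alpha>) (x \<alpha> :: real ^ 'n)) powr p) \<le> (C * 2 powr (- \<delta> * \<bar>real_of_int j\<bar>)) powr p"
proof -
  let ?n = "real CARD('n)"
  define q where "q = 2 + 6 / ?n"
  have n: "0 < ?n" by simp
  have q2: "2 < q" unfolding q_def by simp
  have "6 / ?n < 8 / ?n" using n by (intro divide_strict_right_mono) auto
  then have pq: "q < p" using p unfolding q_def by linarith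
  obtain K where K: "0 < K" "\<And>a b \<tau> (y :: int ^ 'n \<Rightarrow> real ^ 'n) G E D. sampled_wave a b G \<Longrightarrow> finite E \<Longrightarrow> 0 \<le> D \<Longrightarrow>
      (\<And>i. i \<in> E \<Longrightarrow> (\<Sum>j\<in>E. exp (- norm (y i - y j))) \<le> D) \<Longrightarrow>
      (\<Sum>i\<in>E. norm (sampled_wave.wave a b \<tau> y G i) powr p) \<le> K * D powr (p / q)"
    using sampled_wave_sum_powr_le[where 'a="real ^ 'n" and 'i="int ^ 'n" and p=p] pq unfolding q_def by auto
  obtain C \<delta> where C: "0 < C" "0 < \<delta>" "\<And>j. (1 + (2 powr real_of_int j)\<^sup>2) powr (- s / 2) * (2 powr real_of_int j) powr (?n / 2) *
      (4 + 2 * ?n / 2 powr real_of_int j) powr (?n / q) \<le> C * 2 powr (- \<delta> * \<bar>real_of_int j\<bar>)"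
    using dyadic_constant_bound[OF n s q2] by blast
  have "(\<Sum>\<alpha>\<in>E. norm (annulus_wave \<epsilon> s F j (t \<alpha>) (x \<alpha>)) powr p) \<le> ((K powr (1 / p) * C) * 2 powr (- \<delta> * \<bar>real_of_int j\<bar>)) powr p"
    if F: "F \<in> borel_measurable borel" "sqnorm F \<le> 1" and E: "finite E" and x: "\<And>\<alpha>. \<alpha> \<in> E \<Longrightarrow> x \<alpha> \<in> cube \<alpha>"
    for F j E t and x :: "int ^ 'n \<Rightarrow> real ^ 'n"
  proof -
    define r where "r = 2 powr real_of_int j"
    have r: "0 < r" by (simp add: r_def)
    define B where "B = (1 + r\<^sup>2) powr (- s / 2) * r powr (?n / 2)"
    have s0: "0 \<le> s" using s n by linarith
    have B_DIM: "B = (1 + (2 powr real_of_int j)\<^sup>2) powr (- s / 2) * (2 powr real_of_int j) powr (real DIM(real ^ 'n) / 2)"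
      by (simp add: B_def r_def)
    obtain a b \<kappa> G where sw: "sampled_wave a b G"
      and w: "\<And>t x. annulus_wave \<epsilon> s F j t x = of_real B * (LINT \<eta>|lborel. cis ((r *\<^sub>R x) \<bullet> \<eta> + (\<kappa> * t) * dispersion a b \<eta>) * G \<eta>)"
      using that unfolding B_DIM r_def by (rule annulus_wave_rescale[OF \<epsilon> s0 F, of j])
    have B: "0 \<le> B" unfolding B_def by simp
    let ?y = "\<lambda>\<alpha>. r *\<^sub>R x \<alpha>" and ?\<tau> = "\<lambda>\<alpha>. \<kappa> * t \<alpha>"
    define D where "D = (4 + 2 * ?n / r) ^ CARD('n)"
    have D0: "0 < 4 + 2 * ?n / r" using r n by (simp add: add_pos_pos)
    have "(\<Sum>\<alpha>\<in>E. norm (sampled_wave.wave a b ?\<tau> ?y G \<alpha>) powr p) \<le> K * D powr (p / q)"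
    proof (rule K(2)[OF sw E])
      show "0 \<le> D" unfolding D_def using D0 by simp
      fix \<alpha> assume "\<alpha> \<in> E"
      have "(\<Sum>\<beta>\<in>E. exp (- norm (?y \<alpha> - ?y \<beta>))) = (\<Sum>\<beta>\<in>E. exp (- r * norm (x \<alpha> - x \<beta>)))"
        unfolding scaleR_diff_right[symmetric] norm_scaleR using r by simp
      also have "\<dots> \<le> D" unfolding D_def by (rule sum_exp_cubes_le[OF r E x \<open>\<alpha> \<in> E\<close>])
      finally show "(\<Sum>\<beta>\<in>E. exp (- norm (?y \<alpha> - ?y \<beta>))) \<le> D" .
    qed
    then have "B powr p * (\<Sum>\<alpha>\<in>E. norm (sampled_wave.wave a b ?\<tau> ?y G \<alpha>) powr p) \<le> B powr p * (K * D powr (p / q))"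
      by (rule mult_left_mono) simp
    moreover have "B powr p * (\<Sum>\<alpha>\<in>E. norm (sampled_wave.wave a b ?\<tau> ?y G \<alpha>) powr p) = (\<Sum>\<alpha>\<in>E. norm (annulus_wave \<epsilon> s F j (t \<alpha>) (x \<alpha>)) powr p)"
      unfolding sum_distrib_left w sampled_wave.wave_def[OF sw] norm_mult norm_of_real using B by (simp add: powr_mult)
    \<comment> \<open>All factors are gathered into one p-th power, so that the dyadic bound can be
      applied to its base by monotonicity.\<close>
    moreover have "B powr p * (K * D powr (p / q)) = (K powr (1 / p) * (B * (4 + 2 * ?n / r) powr (?n / q))) powr p"
    proof -
      have p0: "p \<noteq> 0" using pq q2 by simp
      have "D powr (p / q) = ((4 + 2 * ?n / r) powr ?n) powr (p / q)"
        unfolding D_def using D0 by (simp add: powr_realpow)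
      also have "\<dots> = ((4 + 2 * ?n / r) powr (?n / q)) powr p" unfolding powr_powr by simp
      finally have "D powr (p / q) = ((4 + 2 * ?n / r) powr (?n / q)) powr p" .
      moreover have "K = (K powr (1 / p)) powr p" unfolding powr_powr using p0 K(1) by simp
      ultimately show ?thesis unfolding powr_mult by (simp add: mult_ac)
    qed
    ultimately have "(\<Sum>\<alpha>\<in>E. norm (annulus_wave \<epsilon> s F j (t \<alpha>) (x \<alpha>)) powr p) \<le> (K powr (1 / p) * (B * (4 + 2 * ?n / r) powr (?n / q))) powr p"
      by simp
    also have "\<dots> \<le> (K powr (1 / p) * (C * 2 powr (- \<delta> * \<bar>real_of_int j\<bar>))) powr p"
      using pq q2 B D0 C(3)[of j] unfolding B_def r_def by (intro powr_mono2 mult_left_mono mult_nonneg_nonneg) auto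
    finally show ?thesis by (simp only: mult.assoc)
  qed
  moreover have "0 < K powr (1 / p) * C" using K C by simp
  ultimately show thesis using that C(2) by blast
qed

lemma sum_dyadic_weights_le:
  assumes \<delta>: "0 < \<delta>" and J: "finite J"
  shows "(\<Sum>j\<in>J. 2 powr (- \<delta> * \<bar>real_of_int j\<bar>)) \<le> 4 + 2 / (\<delta> * ln 2)"
proof -
  have \<rho>: "0 < \<delta> * ln 2" using \<delta> by simp
  have "(\<Sum>j\<in>J. 2 powr (- \<delta> * \<bar>real_of_int j\<bar>)) \<le> (\<Sum>j\<in>J. exp (- (\<delta> * ln 2) * max 0 (real_of_int \<bar>j\<bar> - 1)))"
  proof (rule sum_mono)
    fix j :: int
    have "(\<delta> * ln 2) * max 0 (real_of_int \<bar>j\<bar> - 1) \<le> (\<delta> * ln 2) * \<bar>real_of_int j\<bar>"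
      using \<rho> by (intro mult_left_mono) auto
    then show "2 powr (- \<delta> * \<bar>real_of_int j\<bar>) \<le> exp (- (\<delta> * ln 2) * max 0 (real_of_int \<bar>j\<bar> - 1))"
      by (simp add: powr_def mult_ac)
  qed
  also have "\<dots> \<le> 4 + 2 / (\<delta> * ln 2)" by (rule sum_exp_int_le[OF \<rho> J])
  finally show ?thesis .
qed

text \<open>The annuli partition the nonzero frequencies, so a partial sum is the full integrand
  restricted to an annular region and dominated by the integrable weighted \<open>F\<close>; the
  origin is a null set.\<close>

lemma annulus_wave_sums:
  fixes F :: "real ^ 'n \<Rightarrow> complex"
  assumes F[measurable]: "F \<in> borel_measurable borel"
    and g: "integrable lborel (\<lambda>\<xi>. complex_of_real (bessel_weight s \<xi>) * F \<xi>)"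
  shows "(\<lambda>J. of_real (fourier_const TYPE('n)) * (\<Sum>j\<in>{- int J..int J}. annulus_wave \<epsilon> s F j t x))
    \<longlonglongrightarrow> free_solution \<epsilon> (\<lambda>\<xi>. complex_of_real (bessel_weight s \<xi>) * F \<xi>) (t, x)"
proof -
  let ?g = "\<lambda>\<xi>. complex_of_real (bessel_weight s \<xi>) * F \<xi>"
  let ?m = "\<lambda>\<xi> :: real ^ 'n. cis (t * ((norm \<xi>) ^ 4 + \<epsilon> * (norm \<xi>)\<^sup>2))"
  let ?h = "\<lambda>\<xi>. cis (\<xi> \<bullet> x) * (?m \<xi> * ?g \<xi>)"
  let ?p = "\<lambda>j \<xi>. cis (\<xi> \<bullet> x) * (?m \<xi> * (indicator (dyadic_annulus j) \<xi> * ?g \<xi>))"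
  have [measurable]: "?g \<in> borel_measurable borel" using borel_measurable_integrable[OF g] by simp
  have gn: "integrable lborel (\<lambda>\<xi>. norm (?g \<xi>))" using g by auto
  have pint: "integrable lborel (?p j)" for j
    by (rule Bochner_Integration.integrable_bound[OF g]) (auto simp: norm_mult indicator_def)
  have psum: "(\<Sum>j\<in>{- int J..int J}. ?p j \<xi>) = of_bool (\<bar>\<lfloor>log 2 (norm \<xi>)\<rfloor>\<bar> \<le> int J) * ?h \<xi>" if "\<xi> \<noteq> 0" for J \<xi>
  proof -
    have "(\<Sum>j\<in>{- int J..int J}. ?p j \<xi>) = (\<Sum>j\<in>{- int J..int J}. if j = \<lfloor>log 2 (norm \<xi>)\<rfloor> then ?h \<xi> else 0)"
      unfolding indicator_dyadic_annulus[OF that] by (intro sum.cong refl) (simp add: of_bool_def)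
    also have "\<dots> = of_bool (\<bar>\<lfloor>log 2 (norm \<xi>)\<rfloor>\<bar> \<le> int J) * ?h \<xi>"
      by (subst sum.delta) (auto simp: of_bool_def abs_le_iff)
    finally show ?thesis .
  qed
  have "(\<lambda>J. LINT \<xi>|lborel. (\<Sum>j\<in>{- int J..int J}. ?p j \<xi>)) \<longlonglongrightarrow> (LINT \<xi>|lborel. ?h \<xi>)"
  proof (rule integral_dominated_convergence[OF _ _ gn])
    show "AE \<xi> in lborel. (\<lambda>J. \<Sum>j\<in>{- int J..int J}. ?p j \<xi>) \<longlonglongrightarrow> ?h \<xi>"
      using AE_lborel_singleton[of "0 :: real ^ 'n"]
    proof eventually_elim
      case (elim \<xi>)
      have "(\<Sum>j\<in>{- int J..int J}. ?p j \<xi>) = ?h \<xi>" if "nat \<bar>\<lfloor>log 2 (norm \<xi>)\<rfloor>\<bar> \<le> J" for J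
        unfolding psum[OF elim] using that by (simp add: nat_le_iff)
      then show ?case by (intro tendsto_eventually) (auto simp: eventually_sequentially)
    qed
    show "AE \<xi> in lborel. norm (\<Sum>j\<in>{- int J..int J}. ?p j \<xi>) \<le> norm (?g \<xi>)" for J
      using AE_lborel_singleton[of "0 :: real ^ 'n"]
    proof eventually_elim
      case (elim \<xi>)
      show ?case unfolding psum[OF elim] by (simp add: of_bool_def norm_mult)
    qed
  qed measurable
  moreover have "(LINT \<xi>|lborel. (\<Sum>j\<in>{- int J..int J}. ?p j \<xi>)) = (\<Sum>j\<in>{- int J..int J}. annulus_wave \<epsilon> s F j t x)" for J
    unfolding annulus_wave_def by (rule Bochner_Integration.integral_sum) (rule pint)
  ultimately have "(\<lambda>J. \<Sum>j\<in>{- int J..int J}. annulus_wave \<epsilon> s F j t x) \<longlonglongrightarrow> (LINT \<xi>|lborel. ?h \<xi>)" by simp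
  then have "(\<lambda>J. of_real (fourier_const TYPE('n)) * (\<Sum>j\<in>{- int J..int J}. annulus_wave \<epsilon> s F j t x))
      \<longlonglongrightarrow> of_real (fourier_const TYPE('n)) * (LINT \<xi>|lborel. ?h \<xi>)"
    by (intro tendsto_mult tendsto_const)
  then show ?thesis unfolding free_solution_def fourier_integral_alt by simp
qed

text \<open>Minkowski over the frequency pieces gives a bound for partial sums that does not depend
  on their number, by the geometric decay of the constants. At finitely many sample points the
  pointwise limit of the partial sums preserves it.\<close>

lemma free_solution_sum_powr_le:
  fixes \<epsilon> p s :: real
  assumes \<epsilon>: "\<epsilon> \<in> {0, 1}" and p: "p \<ge> 2 + 8 / real CARD('n::finite)" and s: "s > real CARD('n) / 2"
  obtains C where "0 < C"
    "\<And>(F :: real ^ 'n \<Rightarrow> complex) B E t x. F \<in> borel_measurable borel \<Longrightarrow> 0 < B \<Longrightarrow> sqnorm F \<le> ennreal (B\<^sup>2) \<Longrightarrow>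
      integrable lborel (\<lambda>\<xi>. complex_of_real (bessel_weight s \<xi>) * F \<xi>) \<Longrightarrow>
      finite E \<Longrightarrow> (\<And>\<alpha>. \<alpha> \<in> E \<Longrightarrow> x \<alpha> \<in> cube \<alpha>) \<Longrightarrow>
      (\<Sum>\<alpha>\<in>E. norm (free_solution \<epsilon> (\<lambda>\<xi>. complex_of_real (bessel_weight s \<xi>) * F \<xi>) (t \<alpha>, x \<alpha>)) powr p) \<le> (C * B) powr p"
proof -
  have p1: "1 \<le> p" using p by (rule order_trans[rotated]) simp
  obtain K \<delta> where K: "0 < K" and \<delta>: "0 < \<delta>" and
    wave: "\<And>F j E t x. F \<in> borel_measurable borel \<Longrightarrow> sqnorm F \<le> 1 \<Longrightarrow> finite E \<Longrightarrow> (\<And>\<alpha>. \<alpha> \<in> E \<Longrightarrow> x \<alpha> \<in> cube \<alpha>) \<Longrightarrow>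
      (\<Sum>\<alpha>\<in>E. norm (annulus_wave \<epsilon> s F j (t \<alpha>) (x \<alpha> :: real ^ 'n)) powr p) \<le> (K * 2 powr (- \<delta> * \<bar>real_of_int j\<bar>)) powr p"
    using annulus_wave_sum_powr_le[OF \<epsilon> p s] by blast
  let ?c = "fourier_const TYPE('n)"
  define Z where "Z = 4 + 2 / (\<delta> * ln 2)"
  have Z: "0 < Z" unfolding Z_def using \<delta> by (simp add: add_pos_pos)
  have unit: "(\<Sum>\<alpha>\<in>E. norm (free_solution \<epsilon> (\<lambda>\<xi>. complex_of_real (bessel_weight s \<xi>) * F \<xi>) (t \<alpha>, x \<alpha>)) powr p) \<le> (?c * (K * Z)) powr p"
    if F: "F \<in> borel_measurable borel" "sqnorm F \<le> 1" and g: "integrable lborel (\<lambda>\<xi>. complex_of_real (bessel_weight s \<xi>) * F \<xi>)"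
      and E: "finite E" and x: "\<And>\<alpha>. \<alpha> \<in> E \<Longrightarrow> x \<alpha> \<in> cube \<alpha>" for F E t and x :: "int ^ 'n \<Rightarrow> real ^ 'n"
  proof -
    let ?P = "\<lambda>J \<alpha>. of_real ?c * (\<Sum>j\<in>{- int J..int J}. annulus_wave \<epsilon> s F j (t \<alpha>) (x \<alpha>))"
    have "(\<lambda>J. \<Sum>\<alpha>\<in>E. norm (?P J \<alpha>) powr p) \<longlonglongrightarrow>
       (\<Sum>\<alpha>\<in>E. norm (free_solution \<epsilon> (\<lambda>\<xi>. complex_of_real (bessel_weight s \<xi>) * F \<xi>) (t \<alpha>, x \<alpha>)) powr p)"
      using p1 by (intro tendsto_sum tendsto_powr' tendsto_norm tendsto_const annulus_wave_sums[OF F(1) g]) auto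
    moreover have "(\<Sum>\<alpha>\<in>E. norm (?P J \<alpha>) powr p) \<le> (?c * (K * Z)) powr p" for J
    proof -
      have c0: "0 < ?c" by (rule fourier_const_pos)
      have "(\<Sum>\<alpha>\<in>E. norm (?P J \<alpha>) powr p) \<le> (\<Sum>\<alpha>\<in>E. ?c powr p * (\<Sum>j\<in>{- int J..int J}. norm (annulus_wave \<epsilon> s F j (t \<alpha>) (x \<alpha>))) powr p)"
      proof (rule sum_mono)
        fix \<alpha>
        have "norm (?P J \<alpha>) \<le> ?c * (\<Sum>j\<in>{- int J..int J}. norm (annulus_wave \<epsilon> s F j (t \<alpha>) (x \<alpha>)))"
          unfolding norm_mult norm_of_real using c0 by (simp add: mult_left_mono norm_sum)
        then have "norm (?P J \<alpha>) powr p \<le> (?c * (\<Sum>j\<in>{- int J..int J}. norm (annulus_wave \<epsilon> s F j (t \<alpha>) (x \<alpha>)))) powr p"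
          using p1 by (intro powr_mono2) auto
        then show "norm (?P J \<alpha>) powr p \<le> ?c powr p * (\<Sum>j\<in>{- int J..int J}. norm (annulus_wave \<epsilon> s F j (t \<alpha>) (x \<alpha>))) powr p"
          unfolding powr_mult .
      qed
      also have "\<dots> = ?c powr p * (\<Sum>\<alpha>\<in>E. (\<Sum>j\<in>{- int J..int J}. norm (annulus_wave \<epsilon> s F j (t \<alpha>) (x \<alpha>))) powr p)"
        by (simp only: sum_distrib_left)
      also have "\<dots> \<le> ?c powr p * (\<Sum>j\<in>{- int J..int J}. K * 2 powr (- \<delta> * \<bar>real_of_int j\<bar>)) powr p"
      proof (intro mult_left_mono sum_powr_sum_le[OF _ E p1])
        show "(\<Sum>\<alpha>\<in>E. norm (annulus_wave \<epsilon> s F j (t \<alpha>) (x \<alpha>)) powr p) \<le> (K * 2 powr (- \<delta> * \<bar>real_of_int j\<bar>)) powr p" for j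
          by (rule wave[OF F E x])
      qed (use K in auto)
      also have "\<dots> \<le> ?c powr p * (K * Z) powr p"
      proof (intro mult_left_mono powr_mono2)
        show "(\<Sum>j\<in>{- int J..int J}. K * 2 powr (- \<delta> * \<bar>real_of_int j\<bar>)) \<le> K * Z"
          unfolding sum_distrib_left[symmetric] Z_def using K by (intro mult_left_mono sum_dyadic_weights_le \<delta>) auto
        show "0 \<le> (\<Sum>j\<in>{- int J..int J}. K * 2 powr (- \<delta> * \<bar>real_of_int j\<bar>))" using K by (intro sum_nonneg) auto
      qed (use p1 in auto)
      also have "\<dots> = (?c * (K * Z)) powr p" unfolding powr_mult ..
      finally show ?thesis .
    qed
    ultimately show ?thesis by (intro LIMSEQ_le_const2) auto
  qed
  \<comment> \<open>Homogeneity reduces to \<open>sqnorm F \<le> 1\<close>: the solution depends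
    linearly on \<open>F\<close>, and \<open>F'\<close> is \<open>F\<close> divided by
    \<open>B\<close>.\<close>
  have scaled: "(\<Sum>\<alpha>\<in>E. norm (free_solution \<epsilon> (\<lambda>\<xi>. complex_of_real (bessel_weight s \<xi>) * F \<xi>) (t \<alpha>, x \<alpha>)) powr p) \<le> (?c * (K * Z) * B) powr p"
    if F[measurable]: "F \<in> borel_measurable borel" and B: "0 < B" and FB: "sqnorm F \<le> ennreal (B\<^sup>2)"
      and g: "integrable lborel (\<lambda>\<xi>. complex_of_real (bessel_weight s \<xi>) * F \<xi>)"
      and E: "finite E" and x: "\<And>\<alpha>. \<alpha> \<in> E \<Longrightarrow> x \<alpha> \<in> cube \<alpha>" for F B E t and x :: "int ^ 'n \<Rightarrow> real ^ 'n"
  proof -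
    define F' where "F' \<xi> = of_real (1 / B) * F \<xi>" for \<xi>
    have [measurable]: "F' \<in> borel_measurable borel" unfolding F'_def by measurable
    have g_eq: "complex_of_real (bessel_weight s \<xi>) * F' \<xi> = of_real (1 / B) * (complex_of_real (bessel_weight s \<xi>) * F \<xi>)" for \<xi>
      by (simp add: F'_def)
    have "sqnorm F' = (\<integral>\<^sup>+\<xi>. ennreal ((1 / B)\<^sup>2) * ennreal ((norm (F \<xi>))\<^sup>2) \<partial>lborel)"
      unfolding sqnorm_def F'_def norm_mult power_mult_distrib norm_of_real power2_abs
      by (intro nn_integral_cong ennreal_mult') simp
    also have "\<dots> = ennreal ((1 / B)\<^sup>2) * sqnorm F" unfolding sqnorm_def by (rule nn_integral_cmult) measurable
    also have "\<dots> \<le> ennreal ((1 / B)\<^sup>2) * ennreal (B\<^sup>2)" by (intro mult_left_mono FB) auto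
    also have "\<dots> = ennreal ((1 / B)\<^sup>2 * B\<^sup>2)" by (rule ennreal_mult[symmetric]) auto
    also have "(1 / B)\<^sup>2 * B\<^sup>2 = 1" using B by (simp add: power_divide)
    finally have F'1: "sqnorm F' \<le> 1" by simp
    have g': "integrable lborel (\<lambda>\<xi>. complex_of_real (bessel_weight s \<xi>) * F' \<xi>)"
      unfolding g_eq by (intro integrable_mult_right g)
    have lin: "free_solution \<epsilon> (\<lambda>\<xi>. complex_of_real (bessel_weight s \<xi>) * F' \<xi>) z
        = of_real (1 / B) * free_solution \<epsilon> (\<lambda>\<xi>. complex_of_real (bessel_weight s \<xi>) * F \<xi>) z" for z
    proof -
      have "cis a * (cis b * (of_real (1 / B) * c)) = of_real (1 / B) * (cis a * (cis b * c))" for a b c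
        by (simp only: mult_ac)
      then show ?thesis unfolding free_solution_def fourier_integral_alt g_eq by (simp only: integral_mult_right_zero mult.left_commute)
    qed
    have "(\<Sum>\<alpha>\<in>E. norm (free_solution \<epsilon> (\<lambda>\<xi>. complex_of_real (bessel_weight s \<xi>) * F \<xi>) (t \<alpha>, x \<alpha>)) powr p)
        = (\<Sum>\<alpha>\<in>E. B powr p * norm (free_solution \<epsilon> (\<lambda>\<xi>. complex_of_real (bessel_weight s \<xi>) * F' \<xi>) (t \<alpha>, x \<alpha>)) powr p)"
      unfolding lin norm_mult norm_of_real powr_mult[symmetric] using B by simp
    also have "\<dots> = B powr p * (\<Sum>\<alpha>\<in>E. norm (free_solution \<epsilon> (\<lambda>\<xi>. complex_of_real (bessel_weight s \<xi>) * F' \<xi>) (t \<alpha>, x \<alpha>)) powr p)"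
      by (simp only: sum_distrib_left)
    also have "\<dots> \<le> B powr p * (?c * (K * Z)) powr p"
      by (intro mult_left_mono unit[OF _ F'1 g' E x]) auto
    also have "\<dots> = (?c * (K * Z) * B) powr p" unfolding powr_mult by (simp only: mult_ac)
    finally show ?thesis .
  qed
  moreover have "0 < ?c * (K * Z)" using K Z fourier_const_pos[where 'n='n] by simp
  ultimately show thesis using that by blast
qed

section \<open>From suprema over cubes to sample points\<close>

lemma center_in_cube: "(\<chi> i. real_of_int (\<alpha> $ i)) \<in> cube \<alpha>"
  by (simp add: cube_def)

text \<open>The supremum over a cube need not be attained, but some point reaches half of it; this
  costs the factor 2. Boundedness of \<open>v\<close> keeps the suprema finite, and one point per
  cube is exactly what the sampled estimate accepts.\<close>

lemma Linf_spacetime_norm_sum_le: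
  fixes v :: "real \<times> (real ^ 'n) \<Rightarrow> complex"
  assumes v: "v \<in> borel_measurable borel" and ae: "\<And>t. AE x in lborel. v (t, x) = U t x"
    and bounded: "\<And>z. norm (v z) \<le> M" and p: "0 < p" and E: "finite E"
    and sum: "\<And>t x. (\<And>\<alpha>. \<alpha> \<in> E \<Longrightarrow> x \<alpha> \<in> cube \<alpha>) \<Longrightarrow> (\<Sum>\<alpha>\<in>E. norm (v (t \<alpha>, x \<alpha>)) powr p) \<le> K powr p"
  shows "(\<Sum>\<alpha>\<in>E. enn_powr (Linf_spacetime_norm U (cube \<alpha>)) p) \<le> ennreal ((2 * K) powr p)"
proof -
  define S where "S \<alpha> = (SUP z\<in>UNIV \<times> cube \<alpha>. norm (v z))" for \<alpha> :: "int ^ 'n"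
  have bdd: "bdd_above ((\<lambda>z. norm (v z)) ` (UNIV \<times> cube \<alpha>))" for \<alpha>
    using bounded by (intro bdd_aboveI[of _ M]) auto
  have le_S: "norm (v (t, x)) \<le> S \<alpha>" if "x \<in> cube \<alpha>" for t x \<alpha>
    unfolding S_def using that by (intro cSUP_upper bdd) auto
  have S0: "0 \<le> S \<alpha>" for \<alpha>
    using le_S[OF center_in_cube] norm_ge_zero order_trans by blast
  \<comment> \<open>If the supremum is 0, no value strictly exceeds half of it, and the centre of
    the cube serves instead.\<close>
  have "\<exists>z. snd z \<in> cube \<alpha> \<and> S \<alpha> \<le> 2 * norm (v z)" for \<alpha>
  proof (cases "S \<alpha> = 0")
    case True
    then show ?thesis using center_in_cube by (intro exI[of _ "(0, \<chi> i. real_of_int (\<alpha> $ i))"]) simp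
  next
    case False
    then have "S \<alpha> / 2 < S \<alpha>" using S0[of \<alpha>] by simp
    then have "\<exists>z\<in>UNIV \<times> cube \<alpha>. S \<alpha> / 2 < norm (v z)"
      unfolding S_def using bdd center_in_cube[of \<alpha>] by (subst (asm) less_cSUP_iff) auto
    then obtain w where "w \<in> UNIV \<times> cube \<alpha>" "S \<alpha> / 2 < norm (v w)" by blast
    then show ?thesis by (intro exI[of _ w]) (auto simp: mem_Times_iff)
  qed
  then obtain z where z: "\<And>\<alpha>. snd (z \<alpha>) \<in> cube \<alpha>" "\<And>\<alpha>. S \<alpha> \<le> 2 * norm (v (z \<alpha>))" by metis
  have "(\<Sum>\<alpha>\<in>E. enn_powr (Linf_spacetime_norm U (cube \<alpha>)) p) \<le> (\<Sum>\<alpha>\<in>E. ennreal ((2 * norm (v (z \<alpha>))) powr p))"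
  proof (rule sum_mono)
    fix \<alpha>
    have "Linf_spacetime_norm U (cube \<alpha>) \<le> ennreal (S \<alpha>)"
      by (rule Linf_spacetime_norm_le[OF v ae le_S])
    also have "\<dots> \<le> ennreal (2 * norm (v (z \<alpha>)))" by (rule ennreal_leI[OF z(2)])
    finally have "enn_powr (Linf_spacetime_norm U (cube \<alpha>)) p \<le> enn_powr (ennreal (2 * norm (v (z \<alpha>)))) p"
      using p by (intro enn_powr_mono) auto
    then show "enn_powr (Linf_spacetime_norm U (cube \<alpha>)) p \<le> ennreal ((2 * norm (v (z \<alpha>))) powr p)"
      by (subst (asm) enn_powr_ennreal) auto
  qed
  also have "\<dots> = ennreal (\<Sum>\<alpha>\<in>E. (2 * norm (v (z \<alpha>))) powr p)" by (rule sum_ennreal) simp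
  also have "\<dots> \<le> ennreal ((2 * K) powr p)"
  proof (rule ennreal_leI)
    have "(\<Sum>\<alpha>\<in>E. (2 * norm (v (z \<alpha>))) powr p) = 2 powr p * (\<Sum>\<alpha>\<in>E. norm (v (fst (z \<alpha>), snd (z \<alpha>))) powr p)"
      by (simp add: powr_mult sum_distrib_left)
    also have "\<dots> \<le> 2 powr p * K powr p" by (intro mult_left_mono sum z) auto
    finally show "(\<Sum>\<alpha>\<in>E. (2 * norm (v (z \<alpha>))) powr p) \<le> (2 * K) powr p" by (simp add: powr_mult)
  qed
  finally show ?thesis .
qed

theorem proposition2p8:
  fixes \<epsilon> p s :: real
  assumes "\<epsilon> \<in> {0, 1}"
    and "p \<ge> 2 + 8 / real CARD('n::finite)"
    and "s > real CARD('n) / 2"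
  shows "\<exists>C::real. C > 0 \<and>
    (\<forall>u\<^sub>0 :: real ^ 'n \<Rightarrow> complex. u\<^sub>0 \<in> Sobolev s \<longrightarrow>
      enn_powr
        (\<Sum>\<^sub>\<infinity>\<alpha>\<in>UNIV. enn_powr (Linf_spacetime_norm (\<lambda>t. propagator \<epsilon> t u\<^sub>0) (cube \<alpha>)) p)
        (1 / p)
      \<le> ennreal C * Sobolev_norm s u\<^sub>0)"
proof -
  have p0: "0 < p" using assms(2) by (rule less_le_trans[rotated]) (simp add: add_pos_nonneg)
  obtain C where C: "0 < C" and
    bound: "\<And>(F :: real ^ 'n \<Rightarrow> complex) B E t x. F \<in> borel_measurable borel \<Longrightarrow> 0 < B \<Longrightarrow> sqnorm F \<le> ennreal (B\<^sup>2) \<Longrightarrow>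
      integrable lborel (\<lambda>\<xi>. complex_of_real (bessel_weight s \<xi>) * F \<xi>) \<Longrightarrow>
      finite E \<Longrightarrow> (\<And>\<alpha>. \<alpha> \<in> E \<Longrightarrow> x \<alpha> \<in> cube \<alpha>) \<Longrightarrow>
      (\<Sum>\<alpha>\<in>E. norm (free_solution \<epsilon> (\<lambda>\<xi>. complex_of_real (bessel_weight s \<xi>) * F \<xi>) (t \<alpha>, x \<alpha>)) powr p) \<le> (C * B) powr p"
    using free_solution_sum_powr_le[OF assms] by blast
  have "enn_powr (\<Sum>\<^sub>\<infinity>\<alpha>\<in>UNIV. enn_powr (Linf_spacetime_norm (\<lambda>t. propagator \<epsilon> t u) (cube \<alpha>)) p) (1 / p)
      \<le> ennreal (2 * C) * Sobolev_norm s u" (is "?L \<le> _") if u: "u \<in> Sobolev s" for u :: "real ^ 'n \<Rightarrow> complex"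
  proof -
    obtain F where F: "F \<in> borel_measurable borel" "sqnorm F < \<infinity>" "Sobolev_norm s u = L2norm F"
      and g: "integrable lborel (\<lambda>\<xi>. complex_of_real (bessel_weight s \<xi>) * F \<xi>)"
      and ae: "\<And>\<epsilon> t. AE x in lborel. free_solution \<epsilon> (\<lambda>\<xi>. complex_of_real (bessel_weight s \<xi>) * F \<xi>) (t, x) = propagator \<epsilon> t u x"
      using Sobolev_representation[OF u assms(3)] by blast
    let ?g = "\<lambda>\<xi>. complex_of_real (bessel_weight s \<xi>) * F \<xi>"
    let ?v = "free_solution \<epsilon> ?g"
    have v: "?v \<in> borel_measurable borel"
      using borel_measurable_integrable[OF g] by (intro free_solution_measurable) simp
    have v_bound: "norm (?v z) \<le> fourier_const TYPE('n) * (LINT \<xi>|lborel. norm (?g \<xi>))" for z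
    proof -
      have "integrable lborel (\<lambda>\<xi>. cis (fst z * ((norm \<xi>) ^ 4 + \<epsilon> * (norm \<xi>)\<^sup>2)) * ?g \<xi>)"
        by (intro integrable_cis_mult g) measurable
      from fourier_integral_bounded[OF this, of 1 "snd z"] show ?thesis
        unfolding free_solution_def by (simp add: norm_mult)
    qed
    obtain a where a: "0 \<le> a" "sqnorm F = ennreal a"
      using F(2) by (cases "sqnorm F" rule: ennreal_cases) auto
    have L2: "L2norm F = ennreal (sqrt a)"
      using a unfolding L2norm_def sqnorm_def[symmetric] by (simp add: enn_powr_ennreal powr_half_sqrt)
    \<comment> \<open>The strict inequality makes \<open>B\<close> positive even when
      \<open>F\<close> vanishes almost everywhere; at the end \<open>B\<close> decreases to
      \<open>sqrt a\<close>, the L2 norm of \<open>F\<close>.\<close>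
    have le: "?L \<le> ennreal (2 * C * B)" if B: "sqrt a < B" for B
    proof -
      have B0: "0 < B" using B a(1) by (meson le_less_trans real_sqrt_ge_zero)
      have "(sqrt a)\<^sup>2 \<le> B\<^sup>2" using B a(1) by (intro power_mono) auto
      then have FB: "sqnorm F \<le> ennreal (B\<^sup>2)" unfolding a(2) using a(1) by (intro ennreal_leI) simp
      \<comment> \<open>In \<open>ennreal\<close> the sum over all cubes is the supremum of its
        finite partial sums, and the bound for those does not depend on the finite set.\<close>
      have "(\<Sum>\<^sub>\<infinity>\<alpha>\<in>UNIV. enn_powr (Linf_spacetime_norm (\<lambda>t. propagator \<epsilon> t u) (cube \<alpha>)) p) \<le> ennreal ((2 * (C * B)) powr p)"
      proof (subst nonneg_infsum_complete)
        show "(SUP E\<in>{E. finite E \<and> E \<subseteq> UNIV}. \<Sum>\<alpha>\<in>E. enn_powr (Linf_spacetime_norm (\<lambda>t. propagator \<epsilon> t u) (cube \<alpha>)) p) \<le> ennreal ((2 * (C * B)) powr p)"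
        proof (rule SUP_least)
          fix E :: "(int ^ 'n) set" assume "E \<in> {E. finite E \<and> E \<subseteq> UNIV}"
          then have E: "finite E" by simp
          show "(\<Sum>\<alpha>\<in>E. enn_powr (Linf_spacetime_norm (\<lambda>t. propagator \<epsilon> t u) (cube \<alpha>)) p) \<le> ennreal ((2 * (C * B)) powr p)"
            by (rule Linf_spacetime_norm_sum_le[OF v ae v_bound p0 E]) (rule bound[OF F(1) B0 FB g E])
        qed
      qed simp
      then have "?L \<le> enn_powr (ennreal ((2 * (C * B)) powr p)) (1 / p)"
        using p0 by (intro enn_powr_mono) auto
      also have "\<dots> = ennreal (2 * C * B)"
        using p0 C B0 by (simp add: enn_powr_ennreal powr_powr mult.assoc)
      finally show ?thesis .
    qed
    have "(\<lambda>k. ennreal (2 * C * (sqrt a + 1 / real (Suc k)))) \<longlonglongrightarrow> ennreal (2 * C * (sqrt a + 0))"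
      by (intro tendsto_ennrealI tendsto_mult tendsto_add tendsto_const lim_1_over_n[THEN LIMSEQ_Suc])
    then have "?L \<le> ennreal (2 * C * (sqrt a + 0))"
      by (rule LIMSEQ_le_const) (intro exI[of _ 0] allI impI le, simp)
    also have "\<dots> = ennreal (2 * C) * Sobolev_norm s u"
      unfolding F(3) L2 using C a(1) by (simp add: ennreal_mult[symmetric])
    finally show ?thesis .
  qed
  then show ?thesis using C by (intro exI[of _ "2 * C"]) auto
qed

end
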